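(* Let $D$ be a graded ring of generalized polynomials over a field $\mathcal{F}$ in the indeterminates $X=\{x_1,\dots,x_m\}$, let $\Sigma\subset D$ be a system of homogeneous $D$-equations (a set of homogeneous elements of $D$), and let $e$ be a positive integer such that $\operatorname{ord}h\le e$ for all $h\in\Sigma$. Let $d$ be the generalized type of $\Sigma$ and $\tau_d(\Sigma)$ its typical dimension. Then: (1) if the codimension of $\Sigma$ is $3$, then $$\tau_d(\Sigma)\le \frac{e^2(e+1)^2}{2},$$ and this estimate is achieved: for every positive integer $e$ there exist a graded ring of generalized polynomials $D$ and a system $\Sigma\subset D$ of homogeneous elements of order at most $e$, of codimension $3$, for which equality holds; (2) if the codimension of $\Sigma$ is $4$, then $$\tau_d(\Sigma)\le \frac{e^2(e+1)^2(3e^4+6e^3+11e^2+8e+8)}{24};$$ (3) if the codimension of $\Sigma$ is $5$, then $$\tau_d(\Sigma)\le \frac{e^2(e+1)^2}{1152}\bigl(288+480e+952e^2+1264e^3+1592e^4+1648e^5+1529e^6+1174e^7+775e^8+420e^9+183e^{10}+54e^{11}+9e^{12}\bigr);$$ (4) in any codimension $\tau>0$ one has $\tau_d(\Sigma)\le O\bigl(e^{2^{\tau-1}}\bigr)$, i.e. for every integer $\tau>0$ there is a constant $C_\tau$ depending only on $\tau$ such that $\tau_d(\Sigma)\le C_\tau e^{2^{\tau-1}}$ for every graded ring $D$ of generalized polynomials over a field in finitely many indeterminates, every system $\Sigma\subset D$ of homogeneous elements of codimension $\tau$ (with $d$ the generalized type of $\Sigma$), and every positive integer $e$ such that $\operatorname{ord}h\le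 e$ for all $h\in\Sigma$.
   Context: Monomials: $T=T(X)$ is the free commutative semigroup with unity, written multiplicatively, generated by $X=\{x_1,\dots,x_m\}$. The order of $\theta=x_1^{i_1}\cdots x_m^{i_m}$ is $\operatorname{ord}\theta=i_1+\dots+i_m$. A ranking on $T$ is a linear order with $1\le\theta$ for all $\theta\in T$ and such that $\theta_1<\theta_2$ implies $\theta\theta_1<\theta\theta_2$. It is orderly if $\operatorname{ord}\theta_1<\operatorname{ord}\theta_2$ implies $\theta_1<\theta_2$. Ring of generalized polynomials: fix a ranking on $T$ and let $D$ be the (left) $\mathcal{F}$-vector space with basis $T$. For $0\ne g=\sum_\theta a_\theta\theta\in D$, the leader $u_g$ is the largest $\theta$ with $a_\theta\ne0$. $D$ is a ring of generalized polynomials in the indeterminates $X$ over $\mathcal{F}$ if it carries an associative unital ring structure extending the left $\mathcal{F}$-vector space structure such that $u_{AB}=u_Au_B$ for all nonzero $A,B\in D$, and such that the product in $D$ of monomials $\theta_1,\theta_2\in T$ is the monomial $\theta_1\theta_2$ (so $x_1,\dots,x_m$ commute pairwise). $\mathcal{F}$ need not be central in $D$; for instance, rings of differential operators over a differential field are rings of generalized polynomials. Graded: let the ranking be orderly and, for $s\in\mathbb{N}_0$, let $D_s$ be the $\mathcal{F}$-span of the monomials of order $s$. $D$ is graded if $D=\bigoplus_{s\ge0}D_s$ and $D_sD_r\subseteq D_{s+r}$ for all $s,r\in\mathbb{N}_0$. Elements of $D_s$ are homogeneous of degree $s$. For $g\in D$, $\operatorname{ord}g$ is the maximal order of a monomial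 occurring in $g$ with nonzero coefficient ($-\infty$ for $g=0$). Characteristic polynomial: for a system $\Sigma\subset D$ of homogeneous elements, let $H$ be the left ideal of $D$ generated by $\Sigma$, with $H_s=H\cap D_s$ and $(D/H)_s=D_s/H_s$. For all sufficiently large $s$, $\dim_{\mathcal{F}}(D/H)_s$ equals the value at $s$ of a numerical polynomial $\omega_{[\Sigma]}(s)$, the characteristic polynomial of $\Sigma$. Its degree $d$ is the (generalized) type of $\Sigma$, and $m-1-d$ is the (generalized) codimension of $\Sigma$. Writing $\omega_{[\Sigma]}(s)=\sum_{i=0}^d a_i\binom{s+i}{i}$ with $a_i\in\mathbb{Z}$ and $a_d\ne0$, the (generalized) typical dimension is $\tau_d(\Sigma)=a_d$. *)

theory Defs
  imports
    "HOL-Library.Poly_Mapping"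
    "HOL-Library.Numeral_Type"
    "HOL-Computational_Algebra.Polynomial"
    "HOL-Computational_Algebra.Formal_Laurent_Series"
begin

text \<open>
  The indeterminates are the elements of a finite type \<open>'x\<close>, so \<open>m = CARD('x)\<close>. Monomials are
  written additively as exponent vectors: the product in \<open>T\<close> is \<open>+\<close> and its unit is \<open>0\<close>.
  The vector space with basis \<open>T\<close> consists of the finitely supported functions from \<open>T\<close> to the
  field. The convolution product that the library puts on this type is never used for
  generalized polynomials: their product is a parameter \<open>mul\<close>.
\<close>

type_synonym 'x monomial = "'x \<Rightarrow>\<^sub>0 nat"
type_synonym ('x, 'f) gpoly = "'x monomial \<Rightarrow>\<^sub>0 'f"

definition mono_ord :: "'x::finite monomial \<Rightarrow> nat" where
  "mono_ord t = (\<Sum>x\<in>UNIV. Poly_Mapping.lookup t x)"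

definition monom_gp :: "'x monomial \<Rightarrow> ('x, 'f::field) gpoly" where
  "monom_gp t = Poly_Mapping.single t 1"

definition scale_gp :: "'f::field \<Rightarrow> ('x, 'f) gpoly \<Rightarrow> ('x, 'f) gpoly" where
  "scale_gp c g = Poly_Mapping.map ((*) c) g"

text \<open>\<open>le s t\<close> is the non-strict form of the ranking.\<close>

locale ranking =
  fixes le :: "'x::finite monomial \<Rightarrow> 'x monomial \<Rightarrow> bool"
  assumes linear: "linear_order_on UNIV {(s, t). le s t}"
    and one_least: "le 0 t"
    and strict_mult: "le s t \<Longrightarrow> s \<noteq> t \<Longrightarrow> le (u + s) (u + t) \<and> u + s \<noteq> u + t"

locale orderly_ranking = ranking +
  assumes orderly: "mono_ord s < mono_ord t \<Longrightarrow> le s t"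

text \<open>Only meaningful for nonzero arguments.\<close>

definition leader ::
    "('x monomial \<Rightarrow> 'x monomial \<Rightarrow> bool) \<Rightarrow> ('x, 'f::field) gpoly \<Rightarrow> 'x monomial" where
  "leader le g = (THE t. t \<in> Poly_Mapping.keys g \<and> (\<forall>s\<in>Poly_Mapping.keys g. le s t))"

text \<open>
  The unit of the ring is necessarily the monomial \<open>1\<close>: by \<open>mul_scale\<close> and \<open>mul_monom\<close> that
  monomial is a left unit. The field need not be central, so there is no
  axiom moving scalars out of the right factor.
\<close>

locale gpoly_ring = ranking le
  for le :: "'x::finite monomial \<Rightarrow> 'x monomial \<Rightarrow> bool" +
  fixes mul :: "('x, 'f::field) gpoly \<Rightarrow> ('x, 'f) gpoly \<Rightarrow> ('x, 'f) gpoly"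
  assumes mul_assoc: "mul (mul A B) C = mul A (mul B C)"
    and mul_add_left: "mul (A + B) C = mul A C + mul B C"
    and mul_add_right: "mul A (B + C) = mul A B + mul A C"
    and mul_one_left: "mul (monom_gp 0) A = A"
    and mul_one_right: "mul A (monom_gp 0) = A"
    and mul_scale: "mul (scale_gp c A) B = scale_gp c (mul A B)"
    and mul_monom: "mul (monom_gp s) (monom_gp t) = monom_gp (s + t)"
    and leader_mul:
      "A \<noteq> 0 \<Longrightarrow> B \<noteq> 0 \<Longrightarrow> mul A B \<noteq> 0 \<and> leader le (mul A B) = leader le A + leader le B"

text \<open>The span \<open>D\<^sub>s\<close> of the monomials of order \<open>s\<close>.\<close>

definition homog_part :: "nat \<Rightarrow> ('x::finite, 'f::field) gpoly set" where
  "homog_part s = {g. \<forall>t\<in>Poly_Mapping.keys g. mono_ord t = s}"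

text \<open>
  The decomposition of \<open>D\<close> as the direct sum of the \<open>D\<^sub>s\<close> holds automatically, because the
  monomials are a basis; being graded is a condition on products only.
\<close>

locale graded_gpoly_ring = gpoly_ring le mul + orderly_ranking le
  for le :: "'x::finite monomial \<Rightarrow> 'x monomial \<Rightarrow> bool"
    and mul :: "('x, 'f::field) gpoly \<Rightarrow> ('x, 'f) gpoly \<Rightarrow> ('x, 'f) gpoly" +
  assumes graded: "A \<in> homog_part s \<Longrightarrow> B \<in> homog_part r \<Longrightarrow> mul A B \<in> homog_part (s + r)"

text \<open>\<open>ord g \<le> e\<close>, including the convention that the order of \<open>0\<close> is \<open>-\<infinity>\<close>.\<close>

definition ord_at_most :: "nat \<Rightarrow> ('x::finite, 'f::field) gpoly \<Rightarrow> bool" where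
  "ord_at_most e g \<longleftrightarrow> (\<forall>t\<in>Poly_Mapping.keys g. mono_ord t \<le> e)"

definition left_ideal_gp ::
    "(('x, 'f::field) gpoly \<Rightarrow> ('x, 'f) gpoly \<Rightarrow> ('x, 'f) gpoly) \<Rightarrow> ('x, 'f) gpoly set \<Rightarrow> bool" where
  "left_ideal_gp mul I \<longleftrightarrow>
     0 \<in> I \<and> (\<forall>g\<in>I. \<forall>h\<in>I. g + h \<in> I) \<and> (\<forall>A. \<forall>g\<in>I. mul A g \<in> I)"

text \<open>\<open>B\<close> represents a finite basis of the quotient space \<open>U / W\<close>.\<close>

definition quot_basis ::
    "('x, 'f::field) gpoly set \<Rightarrow> ('x, 'f) gpoly set \<Rightarrow> ('x, 'f) gpoly set \<Rightarrow> bool" where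
  "quot_basis U W B \<longleftrightarrow> finite B \<and> B \<subseteq> U \<and>
     (\<forall>c. (\<Sum>b\<in>B. scale_gp (c b) b) \<in> W \<longrightarrow> (\<forall>b\<in>B. c b = 0)) \<and>
     (\<forall>g\<in>U. \<exists>c. g - (\<Sum>b\<in>B. scale_gp (c b) b) \<in> W)"

definition quot_dim :: "('x, 'f::field) gpoly set \<Rightarrow> ('x, 'f) gpoly set \<Rightarrow> nat" where
  "quot_dim U W = (THE n. \<exists>B. quot_basis U W B \<and> card B = n)"

text \<open>
  The dimension of \<open>(D/H)\<^sub>s\<close>, where \<open>H\<close> is the left ideal generated by \<open>\<Sigma>\<close>.
\<close>

definition hilbert_fun ::
    "(('x::finite, 'f::field) gpoly \<Rightarrow> ('x, 'f) gpoly \<Rightarrow> ('x, 'f) gpoly)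
      \<Rightarrow> ('x, 'f) gpoly set \<Rightarrow> nat \<Rightarrow> nat" where
  "hilbert_fun mul \<Sigma> s =
     quot_dim (homog_part s) ((left_ideal_gp mul hull \<Sigma>) \<inter> homog_part s)"

definition char_poly ::
    "(('x::finite, 'f::field) gpoly \<Rightarrow> ('x, 'f) gpoly \<Rightarrow> ('x, 'f) gpoly)
      \<Rightarrow> ('x, 'f) gpoly set \<Rightarrow> rat poly" where
  "char_poly mul \<Sigma> =
     (THE w. \<forall>\<^sub>F s in sequentially. of_nat (hilbert_fun mul \<Sigma> s) = poly w (of_nat s))"

definition gen_type ::
    "(('x::finite, 'f::field) gpoly \<Rightarrow> ('x, 'f) gpoly \<Rightarrow> ('x, 'f) gpoly)
      \<Rightarrow> ('x, 'f) gpoly set \<Rightarrow> nat" where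
  "gen_type mul \<Sigma> = degree (char_poly mul \<Sigma>)"

text \<open>
  A system with characteristic polynomial \<open>0\<close> has no nonzero coefficient \<open>a\<^sub>d\<close>, hence neither
  type nor codimension (the library's \<open>degree 0 = 0\<close> must not be used for it).
\<close>

definition has_codim ::
    "(('x::finite, 'f::field) gpoly \<Rightarrow> ('x, 'f) gpoly \<Rightarrow> ('x, 'f) gpoly)
      \<Rightarrow> ('x, 'f) gpoly set \<Rightarrow> nat \<Rightarrow> bool" where
  "has_codim mul \<Sigma> k \<longleftrightarrow> char_poly mul \<Sigma> \<noteq> 0 \<and>
     int CARD('x) - 1 - int (gen_type mul \<Sigma>) = int k"

text \<open>
  An equation that holds at all natural numbers \<open>s\<close> is an identity of polynomials in \<open>s\<close>.
\<close>

definition typical_dim ::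
    "(('x::finite, 'f::field) gpoly \<Rightarrow> ('x, 'f) gpoly \<Rightarrow> ('x, 'f) gpoly)
      \<Rightarrow> ('x, 'f) gpoly set \<Rightarrow> int" where
  "typical_dim mul \<Sigma> =
     (THE t. \<exists>a :: nat \<Rightarrow> int. t = a (gen_type mul \<Sigma>) \<and>
        (\<forall>s :: nat. poly (char_poly mul \<Sigma>) (of_nat s) =
           (\<Sum>i\<le>gen_type mul \<Sigma>. of_int (a i) * of_nat ((s + i) choose i))))"

text \<open>A system \<open>\<Sigma>\<close> of homogeneous elements of order at most \<open>e\<close> in a graded ring.\<close>

definition homog_system ::
    "('x::finite monomial \<Rightarrow> 'x monomial \<Rightarrow> bool)
      \<Rightarrow> (('x, 'f::field) gpoly \<Rightarrow> ('x, 'f) gpoly \<Rightarrow> ('x, 'f) gpoly)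
      \<Rightarrow> ('x, 'f) gpoly set \<Rightarrow> nat \<Rightarrow> bool" where
  "homog_system le mul \<Sigma> e \<longleftrightarrow> graded_gpoly_ring le mul \<and>
     (\<forall>h\<in>\<Sigma>. \<exists>s. h \<in> homog_part s) \<and> (\<forall>h\<in>\<Sigma>. ord_at_most e h)"

text \<open>
  The constant in the bound \<open>C\<^sub>k e\<^bsup>2^(k-1)\<^esup>\<close> for codimension \<open>k\<close>. It must not depend on the
  field nor on the indeterminates, but an existential quantifier over constants inside a formula
  lies in the scope of the types \<open>'f\<close> and \<open>'x\<close>. So an admissible value is fixed here.
  (With \<open>N\<^sub>k\<close> the bound in codimension \<open>k\<close> and \<open>B\<^sub>k = e + N\<^sub>1 + \<dots> + N\<^sub>k\<close>, one has
  \<open>B\<^sub>1 = 2e\<close> and \<open>B\<^sub>k\<^sub>+\<^sub>1 \<le> B\<^sub>k + B\<^sub>k\<^sup>2/2 \<le> B\<^sub>k\<^sup>2\<close>.)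
\<close>

definition codim_const :: "nat \<Rightarrow> nat" where
  "codim_const k = 2 ^ (2 ^ (k - 1))"

end

theory Submission
  imports Defs
begin

text \<open>
  Write \<open>m\<close> for the number of indeterminates, \<open>H\<close> for the left ideal generated by a system of
  homogeneous elements of order at most \<open>e\<close>, and call the set of all monomials \<open>h * w\<close>, with \<open>w\<close>
  a monomial in a set \<open>v\<close> of indeterminates, a cone of degree \<open>ord h\<close> and dimension \<open>card v\<close>.

  Upper bounds. In degrees \<open>\<ge> e\<close> the ideal is generated by a finite \<open>F\<close>-basis of \<open>H\<^sub>e\<close>
  (\<open>gen_part_eq\<close>). Adding these generators one at a time filters it with cyclic factors \<open>D/J\<close>,
  shifted by \<open>e\<close> (\<open>dim_gen_part_Cons\<close>). Taking leaders, \<open>dim (D/J)\<^sub>r\<close> counts the monomials of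
  order \<open>r\<close> outside a monomial ideal, and these split into finitely many disjoint cones. If the
  splitting always keeps a cone of maximal dimension at its apex, the Hilbert polynomial becomes
  a sum of one cone in each of the degrees \<open>0, 1, 2, \<dots>, N\<close>, with dimensions that never increase
  (\<open>hilb_monomial_complement\<close>). Sums of such expansions are again such expansions
  (\<open>cone_chain_add\<close>). So in high degrees \<open>D = H + D/H\<close> turns into: the full cone of degree \<open>0\<close>
  equals some full cones of degree \<open>e\<close>, plus cones of dimension \<open>< m\<close> in consecutive degrees from
  \<open>e\<close> on, plus the Hilbert polynomial of \<open>D/H\<close>. In codimension \<open>k > 0\<close> the last term only involves
  dimensions \<open>\<le> m - k\<close>, so there is exactly one full cone of degree \<open>e\<close>, and in each dimension
  above \<open>m - k\<close> the two sides have equally many cones.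

  This determines everything above dimension \<open>m - k\<close>. A cone of degree \<open>a\<close> minus a cone of the same
  dimension and degree \<open>c \<ge> a\<close> is the sum of cones of one dimension less in the degrees
  \<open>a, \<dots>, c - 1\<close>. The full cones of degrees \<open>0\<close> and \<open>e\<close> differ by cones of degrees \<open>0, \<dots>, e - 1\<close>;
  these are cancelled by cones of degrees \<open>e, \<dots>, 2e - 1\<close>, which leaves \<open>e\<^sup>2\<close> cones of one dimension
  less, to be cancelled by \<open>e\<^sup>2\<close> cones in degrees from \<open>2e\<close> on, and so forth. What remains in
  dimension \<open>m - k\<close> after \<open>k - 1\<close> cancellations bounds the typical dimension
  (\<open>typical_dim_le_length_cone_degs\<close>). The number of cones that remain is \<open>e\<^sup>2 (e + 1)\<^sup>2 / 2\<close> for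
  \<open>k = 3\<close>, the polynomials of the theorem for \<open>k = 4, 5\<close>, and at most \<open>(2e)\<^bsup>2^(k-1)\<^esup>\<close> in
  general (\<open>length_cone_degs_2\<close>, \<open>length_cone_degs_3\<close>, \<open>length_cone_degs_4\<close>,
  \<open>length_cone_degs_le\<close>).

  Equality in codimension three. Let \<open>x\<^sub>1\<close> act on \<open>F = \<rat>((\<theta>))\<close> by \<open>x\<^sub>1 \<theta> = 2 \<theta> x\<^sub>1\<close> and let the
  other three indeterminates be central. The two elements
  \<open>(x\<^sub>1 - x\<^sub>3) (x\<^sub>1 - 2 x\<^sub>3) \<cdots> (x\<^sub>1 - 2\<^bsup>e-1\<^esup> x\<^sub>3)\<close> and \<open>x\<^sub>2\<^bsup>e\<^esup> - \<theta> x\<^sub>3\<^bsup>e\<^esup>\<close> generate a left ideal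
  whose leaders are the multiples of \<open>x\<^sub>2\<^bsup>e\<^esup>\<close> and of \<open>x\<^sub>1\<^bsup>a\<^esup> x\<^sub>3\<^bsup>(e-a)(e+1)\<^esup>\<close> for \<open>a \<le> e\<close>: commuting
  \<open>\<theta>\<close> past the first product lowers its length by one factor and produces \<open>e + 1\<close> factors \<open>x\<^sub>3\<close>.
  Counting the other monomials gives \<open>e \<cdot> \<Sum>\<^bsub>a<e\<^esub> (e - a) (e + 1)\<close> in every large order.
\<close>

section \<open>Symbols of Hilbert functions\<close>

text \<open>
  A cone of degree \<open>c\<close> and dimension \<open>n - j\<close> in \<open>n\<close> indeterminates contains
  \<open>(s - c + n - 1 - j) choose (n - 1 - j)\<close> monomials of order \<open>s\<close>. It is encoded by the polynomial
  \<open>Y\<^sup>j W\<^sup>c\<close>, where \<open>Y\<close> is the backward difference in \<open>s\<close> and \<open>W = 1 - Y\<close> the shift by one. An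
  integral combination of such polynomials is called a symbol. Only its first \<open>n\<close> coefficients
  matter, and the coefficient of \<open>Y\<^sup>j\<close> is the coefficient of \<open>(s + i) choose i\<close>, \<open>i = n - 1 - j\<close>, in
  the Hilbert polynomial.
\<close>

abbreviation Y :: "int poly" where "Y \<equiv> [:0, 1:]"
abbreviation W :: "int poly" where "W \<equiv> [:1, -1:]"

definition hilb :: "nat \<Rightarrow> int poly \<Rightarrow> nat \<Rightarrow> int" where
  "hilb n p s = (\<Sum>j<n. coeff p j * int ((s + (n - 1 - j)) choose (n - 1 - j)))"

lemma hilb_0 [simp]: "hilb n 0 s = 0"
  by (simp add: hilb_def)

lemma hilb_add: "hilb n (p + q) s = hilb n p s + hilb n q s"
  by (simp add: hilb_def sum.distrib algebra_simps)

lemma hilb_diff: "hilb n (p - q) s = hilb n p s - hilb n q s"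
  by (simp add: hilb_def sum_subtractf algebra_simps)

lemma hilb_pCons_0: "hilb (Suc n) (pCons 0 p) s = hilb n p s"
  by (simp add: hilb_def sum.lessThan_Suc_shift del: sum.lessThan_Suc)

text \<open>
  This is Pascal's rule, read for the polynomials \<open>(s + i) choose i\<close>.
\<close>
lemma hilb_mult_W: "hilb n (p * W) (Suc s) = hilb n p s"
proof (cases n)
  case 0
  then show ?thesis by (simp add: hilb_def)
next
  case (Suc m)
  have pW: "p * W = p - pCons 0 p"
    by simp
  have "int ((Suc s + (m - j)) choose (m - j)) - int ((Suc s + (m - 1 - j)) choose (m - 1 - j))
          = int ((s + (m - j)) choose (m - j))" if "j < m" for j
  proof -
    obtain r where r: "m - j = Suc r"
      using \<open>j < m\<close> by (metis Suc_diff_Suc)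
    then have "m - 1 - j = r" by simp
    then show ?thesis using r by simp
  qed
  then have "coeff p j * int ((Suc s + (m - j)) choose (m - j))
      - coeff p j * int ((Suc s + (m - 1 - j)) choose (m - 1 - j))
          = coeff p j * int ((s + (m - j)) choose (m - j))" if "j < m" for j
    using that by (metis right_diff_distrib)
  then have "hilb (Suc m) p (Suc s) - hilb m p (Suc s) = hilb (Suc m) p s"
    by (simp add: hilb_def sum_subtractf[symmetric])
  then show ?thesis
    by (simp only: Suc pW hilb_diff hilb_pCons_0)
qed

lemma hilb_mult_W_power: "hilb n (p * W ^ c) (s + c) = hilb n p s"
proof (induction c)
  case (Suc c)
  have "hilb n (p * W ^ Suc c) (s + Suc c) = hilb n ((p * W ^ c) * W) (Suc (s + c))"
    by (simp only: power_Suc2 mult.assoc add_Suc_right)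
  then show ?case
    using Suc hilb_mult_W by metis
qed simp

lemma Y_power: "Y ^ j = monom 1 j"
  by (metis monom_altdef smult_1_left)

lemma hilb_Y_power: "j < n \<Longrightarrow> hilb n (Y ^ j) s = int ((s + (n - 1 - j)) choose (n - 1 - j))"
  by (simp add: hilb_def Y_power if_distrib[of "\<lambda>x. x * _"] cong: if_cong)

lemma hilb_cone:
  assumes "j < n" "c \<le> s"
  shows "hilb n (Y ^ j * W ^ c) s = int ((s - c + (n - 1 - j)) choose (n - 1 - j))"
  using hilb_mult_W_power[of n "Y ^ j" c "s - c"] assms by (simp add: hilb_Y_power)

lemma coeff_Y_power_dvd: "Y ^ n dvd p \<Longrightarrow> j < n \<Longrightarrow> coeff p j = 0"
  by (auto simp: dvd_def Y_power coeff_monom_mult)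

lemma hilb_Y_power_dvd: "Y ^ n dvd p \<Longrightarrow> hilb n p s = 0"
  by (simp add: hilb_def coeff_Y_power_dvd)

section \<open>Macaulay expansions\<close>

text \<open>
  The symbol, up to a power of \<open>Y\<close>, of \<open>M\<close> cones of equal dimension in the consecutive degrees
  \<open>q, \<dots>, q + M - 1\<close>.
\<close>
definition geom :: "nat \<Rightarrow> nat \<Rightarrow> int poly" where
  "geom q M = (\<Sum>c = q..<q + M. W ^ c)"

lemma geom_0 [simp]: "geom q 0 = 0"
  by (simp add: geom_def)

lemma geom_1 [simp]: "geom q (Suc 0) = W ^ q"
  by (simp add: geom_def)

text \<open>
  Geometrically: a cone of degree \<open>q\<close> minus a cone of degree \<open>q + M\<close> inside it is a union of \<open>M\<close>
  slices of one dimension less.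
\<close>
lemma Y_geom: "Y * geom q M = W ^ q - W ^ (q + M)"
proof (induction M)
  case (Suc M)
  have "Y = 1 - W" by (simp add: one_pCons)
  then have "Y * W ^ (q + M) = W ^ (q + M) - W ^ (q + Suc M)"
    by (simp add: algebra_simps)
  with Suc show ?case by (simp add: geom_def algebra_simps)
qed simp

lemma geom_add: "geom q (M + N) = geom q M + geom (q + M) N"
  unfolding geom_def by (metis add.assoc le_add1 sum.atLeastLessThan_concat)

text \<open>
  Modulo \<open>Y\<^sup>n\<close> the symbol \<open>p\<close> is a sum of cones of dimension at most \<open>r\<close>, exactly one in each
  degree from \<open>q\<close> up to some last one, with dimensions that do not increase with the degree. The
  recursion on \<open>r\<close> splits off the \<open>M\<close> cones of the largest dimension. In Macaulay's description
  of Hilbert functions such expansions start at degree \<open>0\<close>.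
\<close>
primrec cone_chain :: "nat \<Rightarrow> nat \<Rightarrow> nat \<Rightarrow> int poly \<Rightarrow> bool" where
  "cone_chain n 0 q p \<longleftrightarrow> Y ^ n dvd p"
| "cone_chain n (Suc r) q p \<longleftrightarrow>
     (\<exists>M p'. p = Y ^ (n - Suc r) * geom q M + p' \<and> cone_chain n r (q + M) p')"

lemma cone_chain_SucI: "cone_chain n r (q + M) p \<Longrightarrow> cone_chain n (Suc r) q (Y ^ (n - Suc r) * geom q M + p)"
  by auto

lemma cone_chain_Suc: "cone_chain n r q p \<Longrightarrow> cone_chain n (Suc r) q p"
  using cone_chain_SucI[of n r q 0 p] by simp

lemma cone_chain_mono: "r \<le> r' \<Longrightarrow> cone_chain n r q p \<Longrightarrow> cone_chain n r' q p"
  by (induction r' rule: dec_induct) (auto intro: cone_chain_Suc simp del: cone_chain.simps)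

lemma cone_chain_zero: "cone_chain n r q 0"
  using cone_chain_mono[of 0 r n q 0] by simp

lemma cone_chain_dvd: "r \<le> n \<Longrightarrow> cone_chain n r q p \<Longrightarrow> Y ^ (n - r) dvd p"
proof (induction r arbitrary: q p)
  case (Suc r)
  then obtain M p' where p: "p = Y ^ (n - Suc r) * geom q M + p'" and p': "cone_chain n r (q + M) p'"
    by auto
  have "Y ^ (n - Suc r) dvd Y ^ (n - r)"
    by (intro le_imp_power_dvd) simp
  moreover have "Y ^ (n - r) dvd p'"
    using Suc.IH[OF _ p'] Suc.prems(1) by simp
  ultimately have "Y ^ (n - Suc r) dvd p'"
    by (rule dvd_trans)
  then show ?case by (simp add: p)
qed simp

text \<open>
  If the chain \<open>p\<close> already begins with cones of dimension \<open>r\<close>, the new ones are merged with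
  those.
\<close>
lemma cone_chain_prepend:
  assumes "r \<le> n" "cone_chain n r (q + M) p"
  shows "cone_chain n r q (Y ^ (n - r) * geom q M + p)"
proof (cases r)
  case (Suc r')
  with assms(2) obtain N p' where p: "p = Y ^ (n - r) * geom (q + M) N + p'"
      and p': "cone_chain n r' (q + M + N) p'"
    by auto
  have "Y ^ (n - r) * geom q M + p = Y ^ (n - r) * geom q (M + N) + p'"
    by (simp add: p geom_add algebra_simps)
  moreover have "cone_chain n r' (q + (M + N)) p'"
    using p' by (simp add: add.assoc)
  ultimately show ?thesis
    using cone_chain_SucI[of n r' q "M + N" p'] Suc by simp
qed (use assms in simp)

text \<open>
  The cone of degree \<open>q\<close> is moved to the end of the block of cones of its dimension; the slices
  that this sets free have one dimension less, start at degree \<open>q\<close>, and extend the rest of the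
  chain downwards. By induction that rest can be raised as well.
\<close>
lemma cone_chain_raise1: "r \<le> n \<Longrightarrow> cone_chain n r q p \<Longrightarrow> cone_chain n r (Suc q) p"
proof (induction r arbitrary: q p)
  case (Suc r)
  then obtain M p' where p: "p = Y ^ (n - Suc r) * geom q M + p'" and p': "cone_chain n r (q + M) p'"
    by auto
  have raise: "cone_chain n r (q + i) f" if "cone_chain n r q f" for q i f
    using that Suc by (induction i) auto
  have nr: "n - r = Suc (n - Suc r)"
    using Suc.prems(1) by simp
  have "geom q M - geom (Suc q) M = W ^ q - W ^ (q + M)"
    using geom_add[of q 1 M] geom_add[of q M 1] by (simp add: add.commute)
  then have geo: "geom q M = geom (Suc q) M + Y * geom q M"
    unfolding Y_geom by simp
  have "p = Y ^ (n - Suc r) * (geom (Suc q) M + Y * geom q M) + p'"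
    using p geo by simp
  also have "\<dots> = Y ^ (n - Suc r) * geom (Suc q) M + (Y ^ (n - r) * geom q M + p')"
    unfolding nr by (simp only: power_Suc algebra_simps)
  finally have 1: "p = \<dots>" .
  have "cone_chain n r q (Y ^ (n - r) * geom q M + p')"
    using cone_chain_prepend Suc.prems(1) p' by simp
  then have "cone_chain n r (q + Suc M) (Y ^ (n - r) * geom q M + p')"
    by (rule raise)
  then show ?case
    using cone_chain_SucI[of n r "Suc q" M] 1 by simp
qed simp

lemma cone_chain_raise: "q \<le> q' \<Longrightarrow> r \<le> n \<Longrightarrow> cone_chain n r q p \<Longrightarrow> cone_chain n r q' p"
  by (induction q' rule: dec_induct) (auto intro: cone_chain_raise1 simp del: cone_chain.simps)

lemma cone_chain_geom: "r \<le> n \<Longrightarrow> c \<le> q \<Longrightarrow> cone_chain n r q (Y ^ (n - r) * geom c M)"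
  using cone_chain_raise[OF _ _ cone_chain_prepend[OF _ cone_chain_zero]] by simp

text \<open>
  The blocks of largest dimension overlap; the second one is shifted behind the first. Each shifted
  cone leaves slices of one dimension less, and these start early enough to be absorbed by the
  remaining chains, which begin behind both blocks.
\<close>
lemma cone_chain_add: "r \<le> n \<Longrightarrow> cone_chain n r q p1 \<Longrightarrow> cone_chain n r q p2 \<Longrightarrow> cone_chain n r q (p1 + p2)"
proof (induction r arbitrary: q p1 p2)
  case (Suc r)
  then obtain M1 p1' M2 p2' where
      p1: "p1 = Y ^ (n - Suc r) * geom q M1 + p1'" and p1': "cone_chain n r (q + M1) p1'" and
      p2: "p2 = Y ^ (n - Suc r) * geom q M2 + p2'" and p2': "cone_chain n r (q + M2) p2'"
    by auto
  define f where "f C = Y ^ (n - r) * (\<Sum>c\<in>C. geom c M1)" for C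
  have nr: "n - r = Suc (n - Suc r)"
    using Suc.prems(1) by simp
  have "geom (q + M1) M2 = (\<Sum>c = q..<q + M2. W ^ (c + M1))"
    unfolding geom_def by (rule sum.reindex_bij_witness[of _ "\<lambda>c. c + M1" "\<lambda>c. c - M1"]) auto
  then have "geom q M2 - geom (q + M1) M2 = (\<Sum>c = q..<q + M2. W ^ c - W ^ (c + M1))"
    by (simp add: geom_def sum_subtractf)
  also have "\<dots> = Y * (\<Sum>c = q..<q + M2. geom c M1)"
    unfolding sum_distrib_left Y_geom ..
  finally have geo: "geom q M2 = geom (q + M1) M2 + Y * (\<Sum>c = q..<q + M2. geom c M1)"
    by simp
  have "p1 + p2 = Y ^ (n - Suc r) * geom q M1
      + Y ^ (n - Suc r) * (geom (q + M1) M2 + Y * (\<Sum>c = q..<q + M2. geom c M1)) + p1' + p2'"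
    unfolding p1 p2 using geo by simp
  also have "\<dots> = Y ^ (n - Suc r) * geom q (M1 + M2) + (p1' + p2' + f {q..<q + M2})"
    unfolding f_def nr geom_add by (simp only: power_Suc algebra_simps)
  finally have *: "p1 + p2 = \<dots>" .
  have rn: "r \<le> n" using Suc.prems(1) by simp
  have "cone_chain n r (q + (M1 + M2)) (f C)" if "finite C" "C \<subseteq> {q..<q + M2}" for C
    using that
  proof (induction C rule: finite_induct)
    case (insert c C)
    have "f (insert c C) = Y ^ (n - r) * geom c M1 + f C"
      using insert by (simp add: f_def algebra_simps)
    moreover have "cone_chain n r (q + (M1 + M2)) (Y ^ (n - r) * geom c M1)"
      using insert rn by (intro cone_chain_geom) auto
    ultimately show ?case
      using Suc.IH[OF rn] insert by simp
  qed (simp add: f_def cone_chain_zero)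
  then have "cone_chain n r (q + (M1 + M2)) (p1' + p2' + f {q..<q + M2})"
    using rn cone_chain_raise[OF _ rn p1', of "q + (M1 + M2)"] cone_chain_raise[OF _ rn p2', of "q + (M1 + M2)"]
    by (intro Suc.IH) simp_all
  then show ?case
    unfolding * by (rule cone_chain_SucI)
qed simp

lemma geom_shift: "W ^ e * geom q M = geom (q + e) M"
proof -
  have "geom (q + e) M = (\<Sum>c = q..<q + M. W ^ (c + e))"
    unfolding geom_def by (rule sum.reindex_bij_witness[of _ "\<lambda>c. c + e" "\<lambda>c. c - e"]) auto
  then show ?thesis
    by (simp add: geom_def sum_distrib_left power_add mult.commute)
qed

lemma cone_chain_shift: "cone_chain n r q p \<Longrightarrow> cone_chain n r (q + e) (W ^ e * p)"
proof (induction r arbitrary: q p)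
  case (Suc r)
  then obtain M p' where p: "p = Y ^ (n - Suc r) * geom q M + p'" and p': "cone_chain n r (q + M) p'"
    by auto
  have "W ^ e * p = Y ^ (n - Suc r) * (W ^ e * geom q M) + W ^ e * p'"
    by (simp only: p algebra_simps)
  then have "W ^ e * p = Y ^ (n - Suc r) * geom (q + e) M + W ^ e * p'"
    by (simp only: geom_shift)
  moreover have "cone_chain n r (q + e + M) (W ^ e * p')"
    using Suc.IH[OF p'] by (simp add: algebra_simps)
  ultimately show ?case
    using cone_chain_SucI by metis
qed simp

section \<open>The extremal sequence of cone degrees\<close>

text \<open>
  A list of numbers stands for cones of one fixed dimension with these degrees.
\<close>

definition W_sum :: "nat list \<Rightarrow> int poly" where
  "W_sum A = (\<Sum>a\<leftarrow>A. W ^ a)"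

text \<open>
  The degrees of the slices that remain when cones of degrees \<open>A\<close> are cancelled by cones of degrees
  \<open>C\<close>, paired in the given order.
\<close>
definition spread :: "nat list \<Rightarrow> nat list \<Rightarrow> nat list" where
  "spread A C = concat (map2 (\<lambda>a c. [a..<c]) A C)"

text \<open>
  \<open>cone_degs e i\<close> are the degrees of the cones left after \<open>i\<close> cancellations, and \<open>cone_start e i\<close> is
  the first degree free for the cones that cancel them; the list for \<open>i = 0\<close> describes the
  difference of the full cones of degrees \<open>0\<close> and \<open>e\<close>.
\<close>
fun cone_start :: "nat \<Rightarrow> nat \<Rightarrow> nat" and cone_degs :: "nat \<Rightarrow> nat \<Rightarrow> nat list" where
  "cone_start e 0 = e"
| "cone_start e (Suc i) = cone_start e i + length (cone_degs e i)"
| "cone_degs e 0 = [0..<e]"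
| "cone_degs e (Suc i) = spread (cone_degs e i) [cone_start e i..<cone_start e (Suc i)]"

lemma coeff_0_W_sum: "coeff (W_sum A) 0 = int (length A)"
  by (induction A) (simp_all add: W_sum_def coeff_0_power)

lemma W_sum_upt: "W_sum [q..<q + M] = geom q M"
  by (simp add: W_sum_def geom_def interv_sum_list_conv_sum_set_nat)

lemma Y_W_sum_spread:
  assumes "list_all2 (\<le>) A C"
  shows "Y * W_sum (spread A C) = W_sum A - W_sum C"
  using assms
proof (induction rule: list_all2_induct)
  case (Cons a as c cs)
  have "W_sum [a..<c] = geom a (c - a)"
    using W_sum_upt[of a "c - a"] Cons(1) by simp
  then have "Y * W_sum [a..<c] = W ^ a - W ^ c"
    using Cons(1) Y_geom[of a "c - a"] by simp
  moreover have "W_sum (spread (a # as) (c # cs)) = W_sum [a..<c] + W_sum (spread as cs)"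
    by (simp add: W_sum_def spread_def)
  ultimately have "Y * W_sum (spread (a # as) (c # cs)) = W ^ a - W ^ c + (W_sum as - W_sum cs)"
    using Cons(3) by (metis distrib_left)
  then show ?case
    by (simp add: W_sum_def)
qed (simp add: W_sum_def spread_def)

lemma set_spread_less: "a \<in> set (spread A C) \<Longrightarrow> \<exists>c\<in>set C. a < c"
  by (fastforce simp: spread_def dest: set_zip_rightD)

lemma cone_degs_less: "a \<in> set (cone_degs e i) \<Longrightarrow> a < cone_start e i"
  by (cases i) (auto dest!: set_spread_less)

text \<open>
  The pairing is legitimate because every degree in \<open>cone_degs e i\<close> lies below \<open>cone_start e i\<close>.
\<close>
lemma Y_W_sum_cone_degs:
  "Y * W_sum (cone_degs e (Suc i)) =
     W_sum (cone_degs e i) - geom (cone_start e i) (length (cone_degs e i))"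
proof -
  have "list_all2 (\<le>) (cone_degs e i) [cone_start e i..<cone_start e (Suc i)]"
    unfolding list_all2_conv_all_nth
    using cone_degs_less[OF nth_mem, of _ e i] by (fastforce intro: less_imp_le)
  from Y_W_sum_spread[OF this] show ?thesis
    by (simp add: W_sum_upt)
qed

lemma coeff_Y_power_mult: "coeff (Y ^ j * p) k = (if k < j then 0 else coeff p (k - j))"
  by (simp add: Y_power coeff_monom_mult)

text \<open>
  Below \<open>k\<close> the coefficients vanish, so the chain \<open>p\<close> must contain exactly as many cones of the
  current dimension as \<open>cone_degs e i\<close>; cancelling them passes from \<open>i\<close> to \<open>i + 1\<close> and to the next
  dimension. At \<open>k\<close> itself the number of cones of the chain is only known to be nonnegative, which
  gives the inequality.
\<close>
lemma cone_chain_coeff_bound: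
  assumes "cone_chain n r (cone_start e i) p" "r \<le> n" "n - r \<le> k" "k < n"
    and "\<And>j. j < k \<Longrightarrow> coeff (Y ^ (n - r) * W_sum (cone_degs e i) - p) j = 0"
  shows "coeff (Y ^ (n - r) * W_sum (cone_degs e i) - p) k
           \<le> int (length (cone_degs e (i + (k - (n - r)))))"
  using assms
proof (induction r arbitrary: i p)
  case (Suc r)
  define j where "j = n - Suc r"
  have nr: "n - r = Suc j" "j < n"
    using Suc.prems(2) by (simp_all add: j_def)
  obtain M p' where p: "p = Y ^ j * geom (cone_start e i) M + p'"
      and p': "cone_chain n r (cone_start e i + M) p'"
    using Suc.prems(1) by (auto simp: j_def)
  have "Y ^ Suc j dvd p'"
    using cone_chain_dvd[OF _ p'] nr Suc.prems(2) by simp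
  then have "coeff p' j = 0"
    by (rule coeff_Y_power_dvd) simp
  moreover have "coeff (geom (cone_start e i) M) 0 = int M"
    using coeff_0_W_sum[of "[cone_start e i..<cone_start e i + M]"] by (simp add: W_sum_upt)
  ultimately have cj: "coeff (Y ^ j * W_sum (cone_degs e i) - p) j
      = int (length (cone_degs e i)) - int M"
    by (simp add: p coeff_Y_power_mult coeff_0_W_sum)
  show ?case
  proof (cases "k = j")
    case True
    then show ?thesis
      using cj by (simp add: j_def)
  next
    case False
    then have jk: "j < k"
      using Suc.prems(3) by (simp add: j_def)
    then have M: "M = length (cone_degs e i)"
      using Suc.prems(5)[OF jk] cj by (simp add: j_def)
    have "Y ^ j * W_sum (cone_degs e i) - p =
        Y ^ j * (W_sum (cone_degs e i) - geom (cone_start e i) M) - p'"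
      by (simp only: p algebra_simps)
    also have "\<dots> = Y ^ (n - r) * W_sum (cone_degs e (Suc i)) - p'"
      unfolding nr power_Suc2 M Y_W_sum_cone_degs[symmetric] by (simp only: mult.assoc)
    finally have eq: "Y ^ j * W_sum (cone_degs e i) - p = \<dots>" .
    have "coeff (Y ^ (n - r) * W_sum (cone_degs e (Suc i)) - p') k
        \<le> int (length (cone_degs e (Suc i + (k - (n - r)))))"
    proof (rule Suc.IH)
      show "cone_chain n r (cone_start e (Suc i)) p'"
        using p' by (simp add: M)
      show "coeff (Y ^ (n - r) * W_sum (cone_degs e (Suc i)) - p') l = 0" if "l < k" for l
        using Suc.prems(5)[OF that] by (simp only: j_def[symmetric] eq)
    qed (use Suc.prems jk nr in simp_all)
    moreover have "Suc i + (k - (n - r)) = i + (k - j)"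
      using jk nr by simp
    ultimately show ?thesis
      by (simp only: j_def[symmetric] eq)
  qed
qed simp

lemma length_spread_le: "length (spread A C) \<le> sum_list C"
proof (induction A arbitrary: C)
  case (Cons a A)
  then show ?case
    by (cases C) (auto simp: spread_def intro!: add_mono)
qed (simp add: spread_def)

lemma sum_list_upt_le: "2 * sum_list [b..<b + l] \<le> (b + l)\<^sup>2"
  by (induction l) (simp_all add: power2_eq_square algebra_simps)

text \<open>
  If \<open>T\<close> is the first free degree after a cancellation, the next list has at most
  \<open>0 + 1 + \<dots> + (T - 1) \<le> T\<^sup>2/2\<close> entries, so the free degree at most squares each time.
\<close>
lemma cone_start_bound:
  assumes "0 < e"
  shows "cone_start e (Suc i) \<le> (2 * e) ^ 2 ^ i \<and> 2 \<le> cone_start e (Suc i)"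
proof (induction i)
  case (Suc i)
  define T where "T = cone_start e (Suc i)"
  have T: "T \<le> (2 * e) ^ 2 ^ i" "2 \<le> T"
    using Suc by (simp_all add: T_def)
  have "length (cone_degs e (Suc i)) \<le> sum_list [cone_start e i..<T]"
    unfolding T_def cone_degs.simps by (rule length_spread_le)
  also have "2 * \<dots> \<le> T\<^sup>2"
    using sum_list_upt_le[of "cone_start e i" "length (cone_degs e i)"] by (simp add: T_def)
  finally have "2 * length (cone_degs e (Suc i)) \<le> T\<^sup>2"
    by simp
  moreover have "2 * T \<le> T\<^sup>2"
    using T(2) by (simp add: power2_eq_square)
  ultimately have "2 * (T + length (cone_degs e (Suc i))) \<le> 2 * T\<^sup>2"
    by simp
  then have "cone_start e (Suc (Suc i)) \<le> T\<^sup>2"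
    by (simp add: T_def)
  also have "\<dots> \<le> ((2 * e) ^ 2 ^ i)\<^sup>2"
    using T(1) by (rule power_mono) simp
  also have "\<dots> = (2 * e) ^ 2 ^ Suc i"
    by (metis power_Suc2 power_mult)
  finally show ?case
    using T(2) by (simp add: T_def)
qed (use assms in simp)

lemma length_cone_degs_le: "0 < e \<Longrightarrow> length (cone_degs e i) \<le> (2 * e) ^ 2 ^ i"
  using cone_start_bound[of e i] by simp

lemma coeff_W_power: "coeff (W ^ c) j = (- 1) ^ j * int (c choose j)"
proof (induction c arbitrary: j)
  case (Suc c)
  have "W ^ Suc c = W ^ c - pCons 0 (W ^ c)"
    by simp
  then have "coeff (W ^ Suc c) j = coeff (W ^ c) j - coeff (pCons 0 (W ^ c)) j"
    by (simp only: coeff_diff)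
  then show ?case
    using Suc by (cases j) (simp_all add: algebra_simps)
qed (cases "j = 0", simp_all)

lemma coeff_Suc_Y_mult: "coeff (Y * p) (Suc j) = coeff p j"
  by simp

lemma coeff_geom:
  "coeff (geom q M) j = (- 1) ^ j * (int ((q + M) choose Suc j) - int (q choose Suc j))"
proof -
  have "coeff (geom q M) j = coeff (Y * geom q M) (Suc j)"
    by simp
  then show ?thesis
    unfolding Y_geom by (simp add: coeff_W_power algebra_simps)
qed

lemma coeff_W_sum_0: "coeff (W_sum (cone_degs e 0)) j = (- 1) ^ j * int (e choose Suc j)"
  using W_sum_upt[of 0 e] coeff_geom[of 0 e j] by simp

text \<open>
  Together with \<open>coeff_W_sum_0\<close> this computes the lengths of the lists without the lists: the
  length is the constant coefficient, and each step needs one coefficient less.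
\<close>
lemma coeff_W_sum_Suc:
  "coeff (W_sum (cone_degs e (Suc i))) j = coeff (W_sum (cone_degs e i)) (Suc j)
     + (- 1) ^ j * (int (cone_start e (Suc i) choose (j + 2)) - int (cone_start e i choose (j + 2)))"
proof -
  have "coeff (W_sum (cone_degs e (Suc i))) j = coeff (Y * W_sum (cone_degs e (Suc i))) (Suc j)"
    by (rule coeff_Suc_Y_mult[symmetric])
  also have "\<dots> = coeff (W_sum (cone_degs e i)) (Suc j)
      - coeff (geom (cone_start e i) (length (cone_degs e i))) (Suc j)"
    unfolding Y_W_sum_cone_degs by (rule coeff_diff)
  finally show ?thesis
    by (simp add: coeff_geom)
qed

lemma real_choose:
  "real (c choose 2) = real c * (real c - 1) / 2"
  "real (c choose 3) = real c * (real c - 1) * (real c - 2) / 6"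
  "real (c choose 4) = real c * (real c - 1) * (real c - 2) * (real c - 3) / 24"
  "real (c choose 5) = real c * (real c - 1) * (real c - 2) * (real c - 3) * (real c - 4) / 120"
  by (simp_all add: binomial_gbinomial gbinomial_prod_rev eval_nat_numeral)

text \<open>
  The coefficients of the first lists are evaluated as real polynomials in \<open>e\<close>, only as far
  as the length of \<open>cone_degs e 4\<close> depends on them.
\<close>

context
  fixes e :: nat and x :: real
  defines "x \<equiv> real e"
begin

private definition coef :: "nat \<Rightarrow> nat \<Rightarrow> real" where
  "coef i j = real_of_int (coeff (W_sum (cone_degs e i)) j)"

private definition start :: "nat \<Rightarrow> real" where
  "start i = real (cone_start e i)"

private lemma length_coef: "real (length (cone_degs e i)) = coef i 0"
  by (simp add: coef_def coeff_0_W_sum)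

private lemma start_0: "start 0 = x" and start_Suc: "start (Suc i) = start i + coef i 0"
  by (simp_all add: start_def x_def length_coef)

private lemma coef_0: "coef 0 j = (- 1) ^ j * real (e choose Suc j)"
  unfolding coef_def coeff_W_sum_0 by simp

private lemma coef_Suc:
  "coef (Suc i) j = coef i (Suc j) + (- 1) ^ j *
     (real (cone_start e (Suc i) choose (j + 2)) - real (cone_start e i choose (j + 2)))"
  by (simp add: coef_def coeff_W_sum_Suc del: cone_degs.simps cone_start.simps)

private lemma coef_0_values:
  "coef 0 0 = x" "coef 0 (Suc 0) = - x * (x - 1) / 2" "coef 0 2 = x * (x - 1) * (x - 2) / 6"
  "coef 0 3 = - x * (x - 1) * (x - 2) * (x - 3) / 24"
  "coef 0 4 = x * (x - 1) * (x - 2) * (x - 3) * (x - 4) / 120"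
  using real_choose[of e] by (simp_all add: coef_0 x_def eval_nat_numeral)

private lemma coef_Suc_values:
  "coef (Suc i) 0 = coef i (Suc 0) +
     (start (Suc i) * (start (Suc i) - 1) - start i * (start i - 1)) / 2"
  "coef (Suc i) (Suc 0) = coef i 2 - (start (Suc i) * (start (Suc i) - 1) * (start (Suc i) - 2)
     - start i * (start i - 1) * (start i - 2)) / 6"
  "coef (Suc i) 2 = coef i 3 +
     (start (Suc i) * (start (Suc i) - 1) * (start (Suc i) - 2) * (start (Suc i) - 3)
     - start i * (start i - 1) * (start i - 2) * (start i - 3)) / 24"
  "coef (Suc i) 3 = coef i 4 - (start (Suc i) * (start (Suc i) - 1) * (start (Suc i) - 2)
       * (start (Suc i) - 3) * (start (Suc i) - 4)
     - start i * (start i - 1) * (start i - 2) * (start i - 3) * (start i - 4)) / 120"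
  using coef_Suc[of i 0] coef_Suc[of i 1] coef_Suc[of i 2] coef_Suc[of i 3]
    real_choose[of "cone_start e i"] real_choose[of "cone_start e (Suc i)"]
  by (simp_all add: start_def eval_nat_numeral diff_divide_distrib del: cone_start.simps)

private lemma start_1: "start (Suc 0) = 2 * x"
  using start_Suc[of 0] by (simp add: start_0 coef_0_values)

private lemma coef_1:
  "coef (Suc 0) 0 = x\<^sup>2" "coef (Suc 0) (Suc 0) = - x\<^sup>2 * (x - 1)"
  "coef (Suc 0) 2 = x\<^sup>2 * (x - 1) * (7 * x - 11) / 12"
  "coef (Suc 0) 3 = - x\<^sup>2 * (x - 1) * (x - 2) * (3 * x - 5) / 12"
  using coef_Suc_values[of 0] start_1
  by (simp_all add: start_0 coef_0_values) (simp_all add: power2_eq_square field_simps)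

private lemma start_2: "start 2 = x\<^sup>2 + 2 * x"
  using start_Suc[of "Suc 0"] by (simp add: start_1 coef_1 numeral_2_eq_2)

private lemma coef_2:
  "coef 2 0 = x\<^sup>2 * (x + 1)\<^sup>2 / 2"
  "coef 2 (Suc 0) = x\<^sup>2 * (x - 1) * (7 * x - 11) / 12 -
     ((x\<^sup>2 + 2 * x) * (x\<^sup>2 + 2 * x - 1) * (x\<^sup>2 + 2 * x - 2) - 2 * x * (2 * x - 1) * (2 * x - 2)) / 6"
  "coef 2 2 = - x\<^sup>2 * (x - 1) * (x - 2) * (3 * x - 5) / 12 +
     ((x\<^sup>2 + 2 * x) * (x\<^sup>2 + 2 * x - 1) * (x\<^sup>2 + 2 * x - 2) * (x\<^sup>2 + 2 * x - 3)
        - 2 * x * (2 * x - 1) * (2 * x - 2) * (2 * x - 3)) / 24"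
  using coef_Suc_values[of "Suc 0"] start_1 start_2
  by (simp_all add: coef_1 numeral_2_eq_2[symmetric]) (simp add: power2_eq_square field_simps)

private lemma start_3: "start 3 = x\<^sup>2 + 2 * x + x\<^sup>2 * (x + 1)\<^sup>2 / 2"
  using start_Suc[of 2] by (simp add: start_2 coef_2)

private lemma coef_3:
  "coef 3 0 = x\<^sup>2 * (x + 1)\<^sup>2 * (3 * x ^ 4 + 6 * x ^ 3 + 11 * x\<^sup>2 + 8 * x + 8) / 24"
  using coef_Suc_values(1)[of 2] start_2 start_3
  by (simp add: coef_2) (simp add: field_simps eval_nat_numeral)

private lemma coef_3_1:
  "coef 3 (Suc 0) = coef 2 2 - (start 3 * (start 3 - 1) * (start 3 - 2)
     - start 2 * (start 2 - 1) * (start 2 - 2)) / 6"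
  using coef_Suc_values(2)[of 2] by simp

private lemma start_4: "start 4 = start 3 + coef 3 0"
  using start_Suc[of 3] by simp

private lemma coef_4:
  "coef 4 0 = x\<^sup>2 * (x + 1)\<^sup>2 / 1152 *
     (288 + 480 * x + 952 * x\<^sup>2 + 1264 * x ^ 3 + 1592 * x ^ 4 + 1648 * x ^ 5 + 1529 * x ^ 6
      + 1174 * x ^ 7 + 775 * x ^ 8 + 420 * x ^ 9 + 183 * x ^ 10 + 54 * x ^ 11 + 9 * x ^ 12)"
proof -
  have "coef 4 0 = coef 3 (Suc 0) + (start 4 * (start 4 - 1) - start 3 * (start 3 - 1)) / 2"
    using coef_Suc_values(1)[of 3] by simp
  then show ?thesis
    unfolding coef_3_1 start_4 coef_3 start_3 start_2 coef_2
    by (simp add: field_simps eval_nat_numeral)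
qed

lemma length_cone_degs_2: "real (length (cone_degs e 2)) = x\<^sup>2 * (x + 1)\<^sup>2 / 2"
  and length_cone_degs_3: "real (length (cone_degs e 3)) =
    x\<^sup>2 * (x + 1)\<^sup>2 * (3 * x ^ 4 + 6 * x ^ 3 + 11 * x\<^sup>2 + 8 * x + 8) / 24"
  and length_cone_degs_4: "real (length (cone_degs e 4)) = x\<^sup>2 * (x + 1)\<^sup>2 / 1152 *
     (288 + 480 * x + 952 * x\<^sup>2 + 1264 * x ^ 3 + 1592 * x ^ 4 + 1648 * x ^ 5 + 1529 * x ^ 6
      + 1174 * x ^ 7 + 775 * x ^ 8 + 420 * x ^ 9 + 183 * x ^ 10 + 54 * x ^ 11 + 9 * x ^ 12)"
  using coef_2(1) coef_3 coef_4 by (simp_all only: length_coef)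

end

section \<open>Monomial ideals\<close>

abbreviation lookup :: "('a \<Rightarrow>\<^sub>0 'b::zero) \<Rightarrow> 'a \<Rightarrow> 'b" where
  "lookup \<equiv> Poly_Mapping.lookup"

abbreviation keys :: "('a \<Rightarrow>\<^sub>0 'b::zero) \<Rightarrow> 'a set" where
  "keys \<equiv> Poly_Mapping.keys"

lemma mono_ord_add: "mono_ord (s + t) = mono_ord s + mono_ord t"
  by (simp add: mono_ord_def lookup_add sum.distrib)

lemma mono_ord_0 [simp]: "mono_ord 0 = 0"
  by (simp add: mono_ord_def)

lemma mono_ord_single [simp]: "mono_ord (Poly_Mapping.single x i) = i"
  by (simp add: mono_ord_def lookup_single when_def)

lemma finite_mono_ord: "finite {t :: 'x::finite monomial. mono_ord t = s}"
proof (rule finite_subset)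
  show "{t :: 'x monomial. mono_ord t = s} \<subseteq>
      Abs_poly_mapping ` {f. \<forall>x. (x \<in> UNIV \<longrightarrow> f x \<in> {..s}) \<and> (x \<notin> UNIV \<longrightarrow> f x = 0)}"
  proof
    fix t :: "'x monomial"
    assume "t \<in> {t. mono_ord t = s}"
    then have "lookup t x \<le> s" for x
      by (auto simp: mono_ord_def intro: member_le_sum)
    then show "t \<in> Abs_poly_mapping `
        {f. \<forall>x. (x \<in> UNIV \<longrightarrow> f x \<in> {..s}) \<and> (x \<notin> UNIV \<longrightarrow> f x = 0)}"
      by (intro image_eqI[of _ _ "lookup t"]) (simp_all add: lookup_inverse)
  qed
  show "finite (Abs_poly_mapping `
      {f :: 'x \<Rightarrow> nat. \<forall>x. (x \<in> UNIV \<longrightarrow> f x \<in> {..s}) \<and> (x \<notin> UNIV \<longrightarrow> f x = 0)})"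
    by (intro finite_imageI finite_set_of_finite_funs) simp_all
qed

definition mcone :: "'x monomial \<Rightarrow> 'x set \<Rightarrow> 'x monomial set" where
  "mcone h u = {t. (\<forall>y. lookup h y \<le> lookup t y) \<and> (\<forall>y. y \<notin> u \<longrightarrow> lookup t y = lookup h y)}"

definition mcone_part :: "'x::finite monomial \<Rightarrow> 'x set \<Rightarrow> nat \<Rightarrow> 'x monomial set" where
  "mcone_part h u s = {t \<in> mcone h u. mono_ord t = s}"

lemma finite_mcone_part [simp]: "finite (mcone_part h u s)"
  by (rule finite_subset[OF _ finite_mono_ord[of s]]) (auto simp: mcone_part_def)

lemma self_in_mcone [simp]: "h \<in> mcone h u"
  by (simp add: mcone_def)

lemma mcone_empty: "mcone h {} = {h}"
proof -
  have "t = h" if "t \<in> mcone h {}" for t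
    using that by (intro poly_mapping_eqI) (simp add: mcone_def)
  then show ?thesis by auto
qed

lemma mcone_mono_ord_eq: "t \<in> mcone h u \<Longrightarrow> mono_ord t = mono_ord h \<Longrightarrow> t = h"
  using sum_mono_inv[of "lookup h" UNIV "lookup t"]
  by (intro poly_mapping_eqI) (simp add: mcone_def mono_ord_def)

lemma lookup_add_single:
  "lookup (h + Poly_Mapping.single x 1) y = (if y = x then Suc (lookup h y) else lookup h y)"
  by (simp add: lookup_add lookup_single)

lemma mcone_split:
  assumes "x \<in> u"
  shows "mcone h u = mcone h (u - {x}) \<union> mcone (h + Poly_Mapping.single x 1) u"
proof (rule set_eqI)
  fix t
  show "t \<in> mcone h u \<longleftrightarrow> t \<in> mcone h (u - {x}) \<union> mcone (h + Poly_Mapping.single x 1) u"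
  proof (cases "lookup t x = lookup h x")
    case True
    then have "t \<notin> mcone (h + Poly_Mapping.single x 1) u"
      unfolding mcone_def lookup_add_single by (auto intro!: exI[of _ x])
    then show ?thesis
      using True assms by (auto simp: mcone_def)
  next
    case False
    then have "t \<notin> mcone h (u - {x})"
      by (auto simp: mcone_def)
    moreover have "(\<forall>y. lookup h y \<le> lookup t y) \<longleftrightarrow>
        (\<forall>y. lookup (h + Poly_Mapping.single x 1) y \<le> lookup t y)"
    proof (intro iff_allI)
      show "lookup h y \<le> lookup t y \<longleftrightarrow> lookup (h + Poly_Mapping.single x 1) y \<le> lookup t y" for y
        unfolding lookup_add_single using False by (cases "y = x") auto
    qed
    moreover have "(\<forall>y. y \<notin> u \<longrightarrow> lookup t y = lookup h y) \<longleftrightarrow>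
        (\<forall>y. y \<notin> u \<longrightarrow> lookup t y = lookup (h + Poly_Mapping.single x 1) y)"
      unfolding lookup_add_single using assms by auto
    ultimately show ?thesis
      unfolding mcone_def Un_iff mem_Collect_eq by argo
  qed
qed

lemma mcone_split_disjoint:
  "mcone h (u - {x}) \<inter> mcone (h + Poly_Mapping.single x 1) u = {}"
proof -
  have "lookup t x = lookup h x" if "t \<in> mcone h (u - {x})" for t
    using that by (simp add: mcone_def)
  moreover have "lookup h x < lookup t x" if "t \<in> mcone (h + Poly_Mapping.single x 1) u" for t
    using that unfolding mcone_def lookup_add_single by (auto dest!: spec[of _ x])
  ultimately show ?thesis
    by (metis disjoint_iff less_irrefl)
qed

lemma card_mcone_part_split:
  assumes "x \<in> u"
  shows "card (mcone_part h u s - L) =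
    card (mcone_part h (u - {x}) s - L) + card (mcone_part (h + Poly_Mapping.single x 1) u s - L)"
proof -
  have "mcone_part h u s - L =
      (mcone_part h (u - {x}) s - L) \<union> (mcone_part (h + Poly_Mapping.single x 1) u s - L)"
    using mcone_split[OF assms, of h] by (auto simp: mcone_part_def)
  moreover have "(mcone_part h (u - {x}) s - L) \<inter> (mcone_part (h + Poly_Mapping.single x 1) u s - L) = {}"
    using mcone_split_disjoint[of h u x] by (auto simp: mcone_part_def)
  ultimately show ?thesis
    by (simp add: card_Un_disjoint)
qed

text \<open>
  Splitting off one direction turns this into Pascal's rule, with an induction on the sum of the
  dimension and the distance from the apex.
\<close>
lemma card_mcone_part:
  "card (mcone_part h u (mono_ord h + d)) =
    (if u = {} then if d = 0 then 1 else 0 else (d + (card u - 1)) choose (card u - 1))"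
proof (induction "d + card u" arbitrary: d h u rule: less_induct)
  case less
  show ?case
  proof (cases d)
    case 0
    then have "mcone_part h u (mono_ord h + d) = {h}"
      using mcone_mono_ord_eq by (auto simp: mcone_part_def)
    then show ?thesis using 0 by simp
  next
    case (Suc d')
    show ?thesis
    proof (cases "u = {}")
      case True
      then have "mcone_part h u (mono_ord h + d) = {}"
        using Suc True by (auto simp: mcone_part_def mcone_empty)
      then show ?thesis using True Suc by simp
    next
      case False
      then obtain x where x: "x \<in> u" by blast
      have u: "finite u" by simp
      let ?h = "h + Poly_Mapping.single x 1"
      have ord: "mono_ord h + d = mono_ord ?h + d'"
        using Suc by (simp add: mono_ord_add)
      have 1: "card (mcone_part ?h u (mono_ord h + d)) = (d' + (card u - 1)) choose (card u - 1)"
        unfolding ord using less[of d' u ?h] Suc False by simp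
      have 2: "card (mcone_part h (u - {x}) (mono_ord h + d)) =
          (if u - {x} = {} then 0 else (d + (card u - 2)) choose (card u - 2))"
        using less[of d "u - {x}" h] Suc x u False by (simp add: card_gt_0_iff numeral_2_eq_2)
      have 3: "card (mcone_part h u (mono_ord h + d)) =
          card (mcone_part h (u - {x}) (mono_ord h + d)) + card (mcone_part ?h u (mono_ord h + d))"
        using card_mcone_part_split[OF x, of h "mono_ord h + d" "{}"] by simp
      show ?thesis
      proof (cases "u - {x} = {}")
        case True
        then have "u = {x}" using x by auto
        then show ?thesis using 1 2 3 by simp
      next
        case False
        then have "card (u - {x}) > 0"
          by (simp add: card_gt_0_iff)
        then obtain c where "card u = Suc (Suc c)"
          using x u by (metis Suc_pred card_Suc_Diff1)
        then show ?thesis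
          using 1 2 3 False Suc \<open>u \<noteq> {}\<close> by simp
      qed
    qed
  qed
qed

lemma hilb_mcone:
  fixes h :: "'x::finite monomial"
  assumes "mono_ord h < s"
  shows "int (card (mcone_part h u s)) =
    hilb CARD('x) (Y ^ (CARD('x) - card u) * W ^ mono_ord h) s"
proof -
  obtain d where s: "s = mono_ord h + Suc d"
    using assms less_iff_Suc_add by auto
  show ?thesis
  proof (cases "u = {}")
    case True
    then show ?thesis
      unfolding s card_mcone_part by (simp add: hilb_Y_power_dvd)
  next
    case False
    then have "0 < card u" "card u \<le> CARD('x)"
      by (simp_all add: card_gt_0_iff card_mono)
    then show ?thesis
      unfolding s card_mcone_part using False by (simp add: hilb_cone)
  qed
qed

lemma nat_seq_incseq_subseq:
  fixes g :: "nat \<Rightarrow> nat"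
  obtains f where "strict_mono f" "incseq (g \<circ> f)"
proof -
  obtain f where f: "strict_mono f" "monoseq (\<lambda>n. g (f n))"
    using seq_monosub[of g] by auto
  show ?thesis
  proof (cases "incseq (g \<circ> f)")
    case False
    then have dec: "decseq (g \<circ> f)"
      using f(2) by (auto simp: monoseq_iff comp_def)
    define i where "i = (ARG_MIN (g \<circ> f) i. True)"
    have "(g \<circ> f) (j + i) = (g \<circ> f) i" for j
      using dec[unfolded decseq_def, rule_format, of i "j + i"]
        arg_min_nat_le[of "\<lambda>_. True" "j + i" "g \<circ> f"] by (simp add: i_def)
    then have "incseq (g \<circ> (\<lambda>j. f (j + i)))"
      by (simp add: comp_def incseq_def)
    then show ?thesis
      using that[of "\<lambda>j. f (j + i)"] f(1) by (simp add: strict_mono_def)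
  qed (use that f in blast)
qed

text \<open>
  The form of Dickson's lemma needed below: nondecreasing subsequences are extracted for one
  indeterminate after another.
\<close>
lemma monomial_seq_incseq_subseq:
  fixes t :: "nat \<Rightarrow> 'x::finite monomial"
  shows "\<exists>f. strict_mono f \<and> (\<forall>x\<in>A. incseq (\<lambda>i. lookup (t (f i)) x))"
proof -
  have "finite A" by simp
  then show ?thesis
  proof induction
    case empty
    show ?case using strict_mono_id by blast
  next
    case (insert x A)
    then obtain f where f: "strict_mono f" "\<forall>x\<in>A. incseq (\<lambda>i. lookup (t (f i)) x)"
      by blast
    obtain g where g: "strict_mono g" "incseq ((\<lambda>i. lookup (t (f i)) x) \<circ> g)"
      by (rule nat_seq_incseq_subseq)
    have "incseq (\<lambda>i. lookup (t (f (g i))) y)" if "y \<in> insert x A" for y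
      using f(2) g that strict_mono_leD[OF g(1)] by (auto simp: incseq_def comp_def)
    moreover have "strict_mono (\<lambda>i. f (g i))"
      using strict_mono_o[OF f(1) g(1)] by (simp add: comp_def)
    ultimately show ?case
      by (intro exI[of _ "\<lambda>i. f (g i)"]) blast
  qed
qed

definition up_closed :: "'x monomial set \<Rightarrow> bool" where
  "up_closed L \<longleftrightarrow> (\<forall>t\<in>L. \<forall>w. t + w \<in> L)"

lemma up_closedD:
  assumes "up_closed L" "t \<in> L" "\<And>y. lookup t y \<le> lookup t' y"
  shows "t' \<in> L"
proof -
  have "t + (t' - t) = t'"
    using assms(3) by (intro poly_mapping_eqI) (simp add: lookup_add lookup_minus)
  then show ?thesis
    using assms unfolding up_closed_def by metis
qed

text \<open>
  A monomial ideal has bounded generators: otherwise there is, for every \<open>N\<close>, a member that leaves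
  the ideal when exponents beyond \<open>N\<close> are altered, and Dickson's lemma yields two comparable members
  of this sequence that contradict each other.
\<close>
lemma up_closed_stable:
  fixes L :: "'x::finite monomial set"
  assumes L: "up_closed L"
  obtains N where "\<And>t t'. t \<in> L \<Longrightarrow> (\<And>y. min (lookup t y) N = min (lookup t' y) N) \<Longrightarrow> t' \<in> L"
proof (rule ccontr)
  assume "\<not> thesis"
  then have "\<forall>N. \<exists>t t'. t \<in> L \<and> (\<forall>y. min (lookup t y) N = min (lookup t' y) N) \<and> t' \<notin> L"
    using that by meson
  then obtain t t' where t: "\<And>N. t N \<in> L" "\<And>N. t' N \<notin> L"
      and eq: "\<And>N y. min (lookup (t N) y) N = min (lookup (t' N) y) N"
    by metis
  obtain f where f: "strict_mono f" "\<And>x. incseq (\<lambda>i. lookup (t (f i)) x)"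
    using monomial_seq_incseq_subseq[of UNIV t] by auto
  define m where "m = mono_ord (t (f 0))"
  have "lookup (t (f 0)) y \<le> lookup (t' (f m)) y" for y
  proof -
    have "lookup (t (f 0)) y \<le> m"
      by (auto simp: m_def mono_ord_def intro: member_le_sum)
    also have "m \<le> f m"
      using f(1) by (rule strict_mono_imp_increasing)
    finally have "lookup (t (f 0)) y \<le> min (lookup (t (f m)) y) (f m)"
      using f(2)[of y] by (simp add: incseq_def)
    then show ?thesis
      unfolding eq by simp
  qed
  then show False
    using up_closedD[OF L t(1)] t(2) by metis
qed

lemma obtain_max_card:
  fixes V :: "'a::finite set set"
  assumes "A \<in> V"
  obtains w where "w \<in> V" "\<And>w'. w' \<in> V \<Longrightarrow> card w' \<le> card w"
proof -
  have "Max (card ` V) \<in> card ` V"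
    using assms by (intro Max_in) auto
  then obtain w where "w \<in> V" "card w = Max (card ` V)"
    by auto
  then show ?thesis
    using that Max_ge[of "card ` V"] by auto
qed

text \<open>
  Let \<open>v\<close> be a largest set of directions in which the cone at \<open>h\<close> avoids \<open>L\<close>. Splitting
  along a direction \<open>x\<close> outside \<open>v\<close> gives a part with the same apex, for which \<open>v\<close> is still
  largest, and a part with an apex of degree one higher. A cone avoiding \<open>L\<close> at the second apex,
  translated back to \<open>h\<close>, still avoids \<open>L\<close>; so no cone of the second part has dimension above
  \<open>card v\<close>, and its chain can be added behind the first cone. The exponents of the apex stay
  below \<open>N\<close>, because beyond \<open>N\<close> the direction \<open>x\<close> could be added to \<open>v\<close>; this bounds the recursion.
\<close>
lemma hilb_mcone_complement:
  fixes L :: "'x::finite monomial set"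
  assumes L: "up_closed L"
    and N: "\<And>t t'. t \<in> L \<Longrightarrow> (\<And>y. min (lookup t y) N = min (lookup t' y) N) \<Longrightarrow> t' \<in> L"
    and "v \<subseteq> u" "mcone h v \<inter> L = {}"
    and "\<And>w. w \<subseteq> u \<Longrightarrow> mcone h w \<inter> L = {} \<Longrightarrow> card w \<le> card v"
  shows "\<exists>p. cone_chain CARD('x) (card v) (Suc (mono_ord h)) p \<and>
    (\<forall>\<^sub>F s in sequentially. int (card (mcone_part h u s - L)) =
       hilb CARD('x) (Y ^ (CARD('x) - card v) * W ^ mono_ord h + p) s)"
  using assms(3-)
proof (induction "(\<Sum>y\<in>u. N - lookup h y) + card u" arbitrary: u v h rule: less_induct)
  case less
  let ?n = "CARD('x)"
  have fin [simp]: "finite A" for A :: "'x set" by simp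
  have vn: "card w \<le> ?n" for w :: "'x set"
    by (simp add: card_mono)
  show ?case
  proof (cases "u = v")
    case True
    have "mcone_part h u s - L = mcone_part h u s" for s
      using less.prems(2) True by (auto simp: mcone_part_def)
    then have "\<forall>\<^sub>F s in sequentially. int (card (mcone_part h u s - L)) =
       hilb ?n (Y ^ (?n - card v) * W ^ mono_ord h + 0) s"
      by (intro eventually_mono[OF eventually_gt_at_top[of "mono_ord h"]]) (simp add: hilb_mcone True)
    then show ?thesis
      using cone_chain_zero by blast
  next
    case False
    then obtain x where x: "x \<in> u" "x \<notin> v"
      using less.prems(1) by blast
    let ?h = "h + Poly_Mapping.single x 1"
    have ord_h: "mono_ord ?h = Suc (mono_ord h)"
      by (simp add: mono_ord_add)
    \<comment> \<open>otherwise membership in \<open>L\<close> ignores the exponent of \<open>x\<close>, against the choice of \<open>v\<close>\<close>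
    have "lookup h x < N"
    proof (rule ccontr)
      assume Nx: "\<not> lookup h x < N"
      have "card (insert x v) > card v"
        using x(2) by simp
      then have "mcone h (insert x v) \<inter> L \<noteq> {}"
        using less.prems(1,3) x(1) by (metis insert_subset not_le)
      then obtain t where t: "t \<in> mcone h (insert x v)" "t \<in> L"
        by blast
      define t' where "t' = Poly_Mapping.update x (lookup h x) t"
      have lt': "lookup t' y = (if y = x then lookup h x else lookup t y)" for y
        by (simp add: t'_def lookup_update)
      have "t' \<in> mcone h v"
        using t(1) by (auto simp: mcone_def lt')
      moreover have "t' \<in> L"
      proof (rule N[OF t(2)])
        show "min (lookup t y) N = min (lookup t' y) N" for y
          using t(1) Nx by (auto simp: lt' mcone_def not_less min_def) (metis le_antisym le_trans)+
      qed
      ultimately show False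
        using less.prems(2) by blast
    qed
    then have "(\<Sum>y\<in>u. N - lookup ?h y) < (\<Sum>y\<in>u. N - lookup h y)"
      using x(1) by (intro sum_strict_mono_ex1) (auto simp: lookup_add lookup_single when_def)
    then have measure_h: "(\<Sum>y\<in>u. N - lookup ?h y) + card u < (\<Sum>y\<in>u. N - lookup h y) + card u"
      by simp
    have "(\<Sum>y\<in>u - {x}. N - lookup h y) \<le> (\<Sum>y\<in>u. N - lookup h y)"
      by (rule sum_mono2) auto
    moreover have "card (u - {x}) < card u"
      using x(1) by (intro psubset_card_mono) auto
    ultimately have measure_u:
        "(\<Sum>y\<in>u - {x}. N - lookup h y) + card (u - {x}) < (\<Sum>y\<in>u. N - lookup h y) + card u"
      by simp
    have v: "v \<subseteq> u - {x}"
      using less.prems(1) x by blast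
    have max_v: "card w \<le> card v" if "w \<subseteq> u - {x}" "mcone h w \<inter> L = {}" for w
      using less.prems(3)[of w] that by blast
    obtain p1 where p1: "cone_chain ?n (card v) (Suc (mono_ord h)) p1"
        "\<forall>\<^sub>F s in sequentially. int (card (mcone_part h (u - {x}) s - L)) =
           hilb ?n (Y ^ (?n - card v) * W ^ mono_ord h + p1) s"
      using less.hyps[OF measure_u v less.prems(2) max_v] by blast
    obtain p2 where p2: "cone_chain ?n (card v) (Suc (mono_ord h)) p2"
        "\<forall>\<^sub>F s in sequentially. int (card (mcone_part ?h u s - L)) = hilb ?n p2 s"
    proof (cases "?h \<in> L")
      case True
      have "mcone ?h u \<subseteq> L"
        using up_closedD[OF L True] by (auto simp: mcone_def)
      then have "mcone_part ?h u s - L = {}" for s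
        by (auto simp: mcone_part_def)
      then show ?thesis
        using that[of 0] cone_chain_zero by simp
    next
      case False
      define V where "V = {w. w \<subseteq> u \<and> mcone ?h w \<inter> L = {}}"
      have "{} \<in> V"
        using False by (simp add: V_def mcone_empty)
      then obtain w where w: "w \<in> V" "\<And>w'. w' \<in> V \<Longrightarrow> card w' \<le> card w"
        by (rule obtain_max_card) (rule that)
      have "mcone h w \<inter> L = {}"
      proof (rule ccontr)
        assume "mcone h w \<inter> L \<noteq> {}"
        then obtain t where t: "t \<in> mcone h w" "t \<in> L" by blast
        then have "t + Poly_Mapping.single x 1 \<in> mcone ?h w"
          by (simp add: mcone_def lookup_add)
        moreover have "t + Poly_Mapping.single x 1 \<in> L"
          using L t(2) by (simp add: up_closed_def)
        ultimately show False
          using w(1) by (auto simp: V_def)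
      qed
      then have wv: "card w \<le> card v"
        using less.prems(3) w(1) by (simp add: V_def)
      obtain q where q: "cone_chain ?n (card w) (Suc (mono_ord ?h)) q"
          "\<forall>\<^sub>F s in sequentially. int (card (mcone_part ?h u s - L)) =
             hilb ?n (Y ^ (?n - card w) * W ^ mono_ord ?h + q) s"
        using less.hyps[OF measure_h, of w] w unfolding V_def by blast
      have "cone_chain ?n (card w) (mono_ord ?h) (Y ^ (?n - card w) * geom (mono_ord ?h) 1 + q)"
        using q(1) by (intro cone_chain_prepend vn) simp
      then show ?thesis
        by (intro that[OF _ q(2)]) (simp only: geom_1 One_nat_def flip: ord_h, rule cone_chain_mono[OF wv])
    qed
    have "cone_chain ?n (card v) (Suc (mono_ord h)) (p1 + p2)"
      by (intro cone_chain_add vn p1 p2)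
    moreover have "\<forall>\<^sub>F s in sequentially. int (card (mcone_part h u s - L)) =
           hilb ?n (Y ^ (?n - card v) * W ^ mono_ord h + (p1 + p2)) s"
      using p1(2) p2(2)
      by eventually_elim (simp add: card_mcone_part_split[OF x(1), of h] hilb_add)
    ultimately show ?thesis by blast
  qed
qed

text \<open>
  The symbol \<open>1\<close> is that of all monomials; for a nonempty \<open>L\<close> no cone of full dimension avoids \<open>L\<close>.
\<close>
lemma hilb_monomial_complement:
  fixes L :: "'x::finite monomial set"
  assumes L: "up_closed L"
  obtains p where "p = 1 \<or> cone_chain CARD('x) (CARD('x) - 1) 0 p"
    "\<forall>\<^sub>F s in sequentially. int (card {t. mono_ord t = s \<and> t \<notin> L}) = hilb CARD('x) p s"
proof -
  let ?n = "CARD('x)"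
  have part: "{t. mono_ord t = s \<and> t \<notin> L} = mcone_part 0 UNIV s - L" for s
    by (auto simp: mcone_part_def mcone_def)
  show ?thesis
  proof (cases "0 \<in> L")
    case True
    then have "L = UNIV"
      using up_closedD[OF L True] by auto
    then show ?thesis
      using that[of 0] cone_chain_zero by simp
  next
    case False
    define V where "V = {w. mcone 0 w \<inter> L = {}}"
    have "{} \<in> V"
      using False by (simp add: V_def mcone_empty)
    then obtain w where w: "w \<in> V" "\<And>w'. w' \<in> V \<Longrightarrow> card w' \<le> card w"
      by (rule obtain_max_card) (rule that)
    obtain N where N: "\<And>t t'. t \<in> L \<Longrightarrow> (\<And>y. min (lookup t y) N = min (lookup t' y) N) \<Longrightarrow> t' \<in> L"
      using up_closed_stable[OF L] by blast
    have ex: "\<exists>p. cone_chain ?n (card w) (Suc (mono_ord (0 :: 'x monomial))) p \<and>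
      (\<forall>\<^sub>F s in sequentially. int (card (mcone_part 0 UNIV s - L)) =
         hilb ?n (Y ^ (?n - card w) * W ^ mono_ord (0 :: 'x monomial) + p) s)"
    proof (rule hilb_mcone_complement[OF L])
      show "t' \<in> L" if "t \<in> L" "\<And>y. min (lookup t y) N = min (lookup t' y) N" for t t'
        using that by (rule N)
    qed (use w in \<open>auto simp: V_def\<close>)
    then obtain p where p: "cone_chain ?n (card w) (Suc 0) p"
      "\<forall>\<^sub>F s in sequentially. int (card (mcone_part 0 UNIV s - L)) =
         hilb ?n (Y ^ (?n - card w) + p) s"
      using ex by auto
    have wn: "card w \<le> ?n"
      by (simp add: card_mono)
    show ?thesis
    proof (cases "L = {}")
      case True
      have "int (card (mcone_part 0 UNIV s - L)) = hilb ?n 1 s" if "0 < s" for s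
        using hilb_mcone[of 0 s "UNIV :: 'x set"] that True by simp
      then have "\<forall>\<^sub>F s in sequentially. int (card (mcone_part 0 UNIV s - L)) = hilb ?n 1 s"
        using eventually_gt_at_top[of 0] by (rule eventually_mono[rotated])
      then show ?thesis
        using that[of 1] unfolding part by blast
    next
      case False
      have "mcone (0 :: 'x monomial) UNIV = UNIV"
        by (simp add: mcone_def)
      then have "w \<noteq> UNIV"
        using w(1) False by (auto simp: V_def)
      then have "card w < ?n"
        by (intro psubset_card_mono) auto
      moreover have "cone_chain ?n (card w) 0 (Y ^ (?n - card w) * geom 0 1 + p)"
        using p(1) by (intro cone_chain_prepend wn) simp
      ultimately have "cone_chain ?n (?n - 1) 0 (Y ^ (?n - card w) + p)"
        by (intro cone_chain_mono[of "card w" "?n - 1"]) simp_all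
      then show ?thesis
        using that p(2) unfolding part by blast
    qed
  qed
qed

section \<open>Linear algebra of generalized polynomials\<close>

lemma lookup_scale_gp [simp]: "lookup (scale_gp c g) t = c * lookup g t"
  by (simp add: scale_gp_def Poly_Mapping.map.rep_eq when_def)

interpretation gp: vector_space "scale_gp :: 'f::field \<Rightarrow> ('x, 'f) gpoly \<Rightarrow> ('x, 'f) gpoly"
  by unfold_locales (simp_all add: poly_mapping_eq_iff fun_eq_iff lookup_add algebra_simps)

lemma lookup_monom_gp: "lookup (monom_gp s) t = (if s = t then 1 else 0)"
  by (simp add: monom_gp_def lookup_single)

lemma keys_monom_gp [simp]: "keys (monom_gp s) = {s}"
  by (auto simp: in_keys_iff lookup_monom_gp split: if_splits)

lemma lookup_scale_sum:
  "lookup (\<Sum>b\<in>B. scale_gp (c b) (f b)) t = (\<Sum>b\<in>B. c b * lookup (f b) t)"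
  by (simp add: lookup_sum)

lemma gpoly_eq_sum_monom:
  assumes "finite A" "keys g \<subseteq> A"
  shows "g = (\<Sum>t\<in>A. scale_gp (lookup g t) (monom_gp t))"
proof (rule poly_mapping_eqI)
  fix u
  have "(\<Sum>t\<in>A. lookup g t * lookup (monom_gp t) u) = (\<Sum>t\<in>A. if t = u then lookup g t else 0)"
    by (intro sum.cong) (auto simp: lookup_monom_gp)
  also have "\<dots> = lookup g u"
    using assms by (auto simp: in_keys_iff)
  finally show "lookup g u = lookup (\<Sum>t\<in>A. scale_gp (lookup g t) (monom_gp t)) u"
    by (simp add: lookup_scale_sum)
qed

lemma inj_monom_gp: "inj (monom_gp :: _ \<Rightarrow> ('x, 'f::field) gpoly)"
  by (rule injI) (metis keys_monom_gp singleton_inject)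

lemma subspace_homog_part: "gp.subspace (homog_part s)"
  unfolding gp.subspace_def homog_part_def
  by (auto simp: in_keys_iff lookup_add)

lemma monom_gp_in_homog_part: "monom_gp t \<in> homog_part s \<longleftrightarrow> mono_ord t = s"
  by (simp add: homog_part_def)

lemma homog_part_le_span:
  "homog_part s \<subseteq> gp.span (monom_gp ` {t. mono_ord t = s})"
proof
  fix g :: "('x::finite, 'f::field) gpoly"
  assume "g \<in> homog_part s"
  then have "g = (\<Sum>t | mono_ord t = s. scale_gp (lookup g t) (monom_gp t))"
    by (intro gpoly_eq_sum_monom finite_mono_ord) (auto simp: homog_part_def)
  also have "\<dots> \<in> gp.span (monom_gp ` {t. mono_ord t = s})"
    by (intro gp.span_sum gp.span_scale gp.span_base) auto
  finally show "g \<in> gp.span (monom_gp ` {t. mono_ord t = s})" .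
qed

text \<open>
  A basis of \<open>Q\<close> together with representatives of a basis of \<open>U / Q\<close> is a basis of \<open>U\<close>. This makes
  the number of representatives independent of their choice.
\<close>
lemma dim_quot_basis:
  assumes "gp.subspace U" "gp.subspace Q" "Q \<subseteq> U" "U \<subseteq> gp.span S" "finite S"
    and B: "quot_basis U Q B"
  shows "gp.dim U = gp.dim Q + card B"
proof -
  obtain B0 where B0: "B0 \<subseteq> Q" "gp.independent B0" "Q \<subseteq> gp.span B0" "card B0 = gp.dim Q"
    using gp.basis_exists by blast
  have "finite B0"
    using gp.independent_span_bound[OF assms(5) B0(2)] B0(1) assms(3,4) by blast
  have "finite B" "B \<subseteq> U"
    and indep: "\<And>c. (\<Sum>b\<in>B. scale_gp (c b) b) \<in> Q \<Longrightarrow> \<forall>b\<in>B. c b = 0"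
    and spans: "\<And>g. g \<in> U \<Longrightarrow> \<exists>c. g - (\<Sum>b\<in>B. scale_gp (c b) b) \<in> Q"
    using B by (auto simp: quot_basis_def)
  have disj: "B \<inter> B0 = {}"
  proof (rule ccontr)
    assume "B \<inter> B0 \<noteq> {}"
    then obtain b where b: "b \<in> B" "b \<in> B0" by blast
    have "(\<Sum>x\<in>B. scale_gp (if x = b then 1 else 0) x) = (\<Sum>x\<in>B. if x = b then x else 0)"
      by (intro sum.cong) auto
    also have "\<dots> = b"
      using b \<open>finite B\<close> by simp
    finally have "(\<Sum>x\<in>B. scale_gp (if x = b then 1 else 0) x) \<in> Q"
      using b B0(1) by auto
    from bspec[OF indep[OF this] b(1)] show False
      by simp
  qed
  have "gp.independent (B \<union> B0)"
  proof (rule gp.independent_if_scalars_zero)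
    fix f x
    assume 0: "(\<Sum>x\<in>B \<union> B0. scale_gp (f x) x) = 0" and x: "x \<in> B \<union> B0"
    have "(\<Sum>x\<in>B. scale_gp (f x) x) + (\<Sum>x\<in>B0. scale_gp (f x) x) = 0"
      using 0 sum.union_disjoint[OF \<open>finite B\<close> \<open>finite B0\<close> disj] by metis
    then have "(\<Sum>x\<in>B. scale_gp (f x) x) = - (\<Sum>x\<in>B0. scale_gp (f x) x)"
      by (rule eq_neg_iff_add_eq_0[THEN iffD2])
    also have "\<dots> \<in> Q"
      using B0(1) assms(2) by (intro gp.subspace_neg gp.subspace_sum gp.subspace_scale) auto
    finally have fB: "\<forall>b\<in>B. f b = 0"
      by (rule indep)
    then have "(\<Sum>x\<in>B0. scale_gp (f x) x) = 0"
      using \<open>(\<Sum>x\<in>B. scale_gp (f x) x) + _ = 0\<close> by simp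
    then have "\<forall>b\<in>B0. f b = 0"
      using gp.independentD[OF B0(2) \<open>finite B0\<close> order_refl] by blast
    then show "f x = 0"
      using fB x by blast
  qed (use \<open>finite B\<close> \<open>finite B0\<close> in simp)
  moreover have "U \<subseteq> gp.span (B \<union> B0)"
  proof
    fix g assume "g \<in> U"
    then obtain c where c: "g - (\<Sum>b\<in>B. scale_gp (c b) b) \<in> Q"
      using spans by blast
    then have "g - (\<Sum>b\<in>B. scale_gp (c b) b) \<in> gp.span (B \<union> B0)"
      using B0(3) gp.span_mono[of B0 "B \<union> B0"] by blast
    moreover have "(\<Sum>b\<in>B. scale_gp (c b) b) \<in> gp.span (B \<union> B0)"
      by (intro gp.span_sum gp.span_scale gp.span_base) auto
    ultimately show "g \<in> gp.span (B \<union> B0)"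
      using gp.span_add by fastforce
  qed
  ultimately have "card (B \<union> B0) = gp.dim U"
    using \<open>B \<subseteq> U\<close> B0(1) assms(3) by (intro gp.basis_card_eq_dim) auto
  then show ?thesis
    using card_Un_disjoint[OF \<open>finite B\<close> \<open>finite B0\<close> disj] B0(4) by simp
qed

lemma quot_dim_eqI:
  assumes "gp.subspace U" "gp.subspace Q" "Q \<subseteq> U" "U \<subseteq> gp.span S" "finite S"
    and B: "quot_basis U Q B"
  shows "quot_dim U Q = card B"
  unfolding quot_dim_def
proof (rule the_equality)
  show "\<exists>B'. quot_basis U Q B' \<and> card B' = card B"
    using B by blast
  show "k = card B" if "\<exists>B'. quot_basis U Q B' \<and> card B' = k" for k
    using that dim_quot_basis[OF assms(1-5)] B by (metis add_left_cancel)
qed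

context ranking
begin

lemma le_refl: "le t t"
  and le_trans: "le r s \<Longrightarrow> le s t \<Longrightarrow> le r t"
  and le_antisym: "le s t \<Longrightarrow> le t s \<Longrightarrow> s = t"
  and le_linear: "le s t \<or> le t s"
  using linear
  by (auto simp: linear_order_on_def partial_order_on_def preorder_on_def refl_on_def
      trans_def antisym_def total_on_def) metis

lemma finite_has_greatest:
  assumes "finite A" "A \<noteq> {}"
  shows "\<exists>t\<in>A. \<forall>s\<in>A. le s t"
  using assms
proof (induction A rule: finite_ne_induct)
  case (insert x A)
  then show ?case
    by (metis insert_iff le_linear le_refl le_trans)
qed (simp add: le_refl)

lemma leader_eqI: "t \<in> keys g \<Longrightarrow> (\<And>s. s \<in> keys g \<Longrightarrow> le s t) \<Longrightarrow> leader le g = t"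
  unfolding leader_def by (rule the_equality) (auto intro: le_antisym)

lemma leader_in_keys: "g \<noteq> 0 \<Longrightarrow> leader le g \<in> keys g"
  and le_leader: "s \<in> keys g \<Longrightarrow> le s (leader le g)"
proof -
  have *: "leader le g \<in> keys g \<and> (\<forall>s\<in>keys g. le s (leader le g))" if "g \<noteq> 0"
  proof -
    have "keys g \<noteq> {}"
      using that by simp
    then obtain t where t: "t \<in> keys g" "\<forall>s\<in>keys g. le s t"
      using finite_has_greatest[OF finite_keys] by blast
    then have "leader le g = t"
      by (intro leader_eqI) auto
    then show ?thesis
      using t by simp
  qed
  show "g \<noteq> 0 \<Longrightarrow> leader le g \<in> keys g"
    using * by blast
  show "s \<in> keys g \<Longrightarrow> le s (leader le g)"
    using * by (cases "g = 0") auto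
qed

lemma leader_monom_gp [simp]: "leader le (monom_gp t :: ('x, 'f::field) gpoly) = t"
  by (rule leader_eqI) (auto simp: le_refl)

definition leaders :: "('x, 'f::field) gpoly set \<Rightarrow> 'x monomial set" where
  "leaders V = leader le ` (V - {0})"

lemma reduce_leader:
  assumes "g \<noteq> 0" "w \<noteq> 0" "leader le w = leader le g"
  defines "g' \<equiv> g - scale_gp (lookup g (leader le g) / lookup w (leader le g)) w"
  shows "g' = 0 \<or> (le (leader le g') (leader le g) \<and> leader le g' \<noteq> leader le g)"
proof (rule disjCI)
  assume "\<not> (le (leader le g') (leader le g) \<and> leader le g' \<noteq> leader le g)"
  moreover have "keys g' \<subseteq> keys g \<union> keys w"
    by (auto simp: g'_def in_keys_iff lookup_minus)
  then have "le s (leader le g)" if "s \<in> keys g'" for s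
    using that le_leader[of s g] le_leader[of s w] assms(3) by auto
  moreover have "lookup g' (leader le g) = 0"
    using leader_in_keys[OF assms(2)] by (simp add: g'_def lookup_minus assms(3) in_keys_iff)
  then have "leader le g \<notin> keys g'"
    by (simp add: in_keys_iff)
  ultimately show "g' = 0"
    using leader_in_keys[of g'] by metis
qed

text \<open>
  The division algorithm: the leader is cancelled by an element of \<open>Q\<close> or moved to the remainder \<open>h\<close>.
  It decreases within the finite set of monomials of order \<open>s\<close>, which ends the process.
\<close>
lemma reduce_modulo:
  fixes Q :: "('x, 'b::field) gpoly set"
  assumes "gp.subspace Q" "Q \<subseteq> homog_part s" "g \<in> homog_part s"
  shows "\<exists>h. keys h \<subseteq> {t. mono_ord t = s} - leaders Q \<and> g - h \<in> Q"
  using assms(3)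
proof (induction "if g = 0 then 0 else Suc (card {t. mono_ord t = s \<and> le t (leader le g)})"
    arbitrary: g rule: less_induct)
  case less
  let ?down = "\<lambda>u. {t. mono_ord t = s \<and> le t u}"
  show ?case
  proof (cases "g = 0")
    case True
    then show ?thesis
      using gp.subspace_0[OF assms(1)] by (intro exI[of _ 0]) simp
  next
    case False
    define u where "u = leader le g"
    have u: "mono_ord u = s"
      using leader_in_keys[OF False] less.prems by (simp add: u_def homog_part_def)
    have IH: "\<exists>h. keys h \<subseteq> {t. mono_ord t = s} - leaders Q \<and> g' - h \<in> Q"
      if w: "w \<in> homog_part s" "w \<noteq> 0" "leader le w = u"
        and g': "g' = g - scale_gp (lookup g u / lookup w u) w" for w g'
    proof (rule less.hyps)
      show "g' \<in> homog_part s"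
        using subspace_homog_part less.prems w(1) unfolding g'
        by (intro gp.subspace_diff gp.subspace_scale)
      have "g' = 0 \<or> le (leader le g') u \<and> leader le g' \<noteq> u"
        using reduce_leader[OF False w(2)] w(3) by (simp add: g' u_def)
      moreover have "card (?down (leader le g')) < card (?down u)"
        if "le (leader le g') u" "leader le g' \<noteq> u"
      proof (rule psubset_card_mono)
        show "finite (?down u)"
          by (rule finite_subset[OF _ finite_mono_ord[of s]]) auto
        show "?down (leader le g') \<subset> ?down u"
          using that u le_trans le_refl le_antisym by blast
      qed
      ultimately show "(if g' = 0 then 0 else Suc (card (?down (leader le g'))))
          < (if g = 0 then 0 else Suc (card (?down (leader le g))))"
        using False by (auto simp: u_def)
    qed
    show ?thesis
    proof (cases "u \<in> leaders Q")
      case True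
      then obtain w where w: "w \<in> Q" "w \<noteq> 0" "leader le w = u"
        by (auto simp: leaders_def)
      let ?w = "scale_gp (lookup g u / lookup w u) w"
      obtain h where h: "keys h \<subseteq> {t. mono_ord t = s} - leaders Q" "g - ?w - h \<in> Q"
        using IH[OF _ w(2,3) refl] w(1) assms(2) by blast
      have "(g - ?w - h) + ?w \<in> Q"
        using assms(1) h(2) w(1) by (intro gp.subspace_add gp.subspace_scale)
      then have "g - h \<in> Q" by simp
      then show ?thesis
        using h(1) by blast
    next
      case False
      let ?w = "scale_gp (lookup g u) (monom_gp u)"
      have "lookup (monom_gp u) u = (1 :: 'b)"
        by (simp add: lookup_monom_gp)
      then obtain h where h: "keys h \<subseteq> {t. mono_ord t = s} - leaders Q" "g - ?w - h \<in> Q"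
        using IH[of "monom_gp u", OF _ _ _ refl] u
        by (auto simp: monom_gp_in_homog_part lookup_monom_gp) (metis keys_monom_gp keys_zero insert_not_empty)
      have "keys (?w + h) \<subseteq> {u} \<union> keys h"
        by (auto simp: in_keys_iff lookup_add lookup_monom_gp split: if_splits)
      then have "keys (?w + h) \<subseteq> {t. mono_ord t = s} - leaders Q"
        using h(1) u False by blast
      then show ?thesis
        using h(2) by (intro exI[of _ "?w + h"]) (simp add: diff_diff_eq)
    qed
  qed
qed

lemma quot_basis_standard:
  fixes Q :: "('x, 'b::field) gpoly set"
  assumes "gp.subspace Q" "Q \<subseteq> homog_part s"
  shows "quot_basis (homog_part s) Q (monom_gp ` ({t. mono_ord t = s} - leaders Q))"
proof -
  let ?S = "{t. mono_ord t = s} - leaders Q"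
  have fin: "finite ?S"
    by (simp add: finite_mono_ord)
  have sum_eq: "(\<Sum>b\<in>monom_gp ` ?S. scale_gp (c b) b) = (\<Sum>t\<in>?S. scale_gp (c (monom_gp t)) (monom_gp t))"
    for c :: "('x, 'b) gpoly \<Rightarrow> 'b"
    using inj_monom_gp by (subst sum.reindex) (auto intro: inj_on_subset)
  show ?thesis
    unfolding quot_basis_def sum_eq
  proof (intro conjI allI impI ballI)
    show "finite (monom_gp ` ?S)"
      using fin by simp
    show "monom_gp ` ?S \<subseteq> homog_part s"
      by (auto simp: monom_gp_in_homog_part)
  next
    fix c :: "('x, 'b) gpoly \<Rightarrow> 'b" and b :: "('x, 'b) gpoly"
    define g where "g = (\<Sum>t\<in>?S. scale_gp (c (monom_gp t)) (monom_gp t))"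
    assume "(\<Sum>t\<in>?S. scale_gp (c (monom_gp t)) (monom_gp t)) \<in> Q" and b: "b \<in> monom_gp ` ?S"
    then have g: "g \<in> Q" by (simp add: g_def)
    have lookup_g: "lookup g u = (if u \<in> ?S then c (monom_gp u) else 0)" for u
    proof -
      have "lookup g u = (\<Sum>t\<in>?S. if t = u then c (monom_gp t) else 0)"
        unfolding g_def lookup_scale_sum by (intro sum.cong) (auto simp: lookup_monom_gp)
      then show ?thesis
        using fin by simp
    qed
    have "g = 0"
    proof (rule ccontr)
      assume "g \<noteq> 0"
      then have "leader le g \<in> ?S" "leader le g \<in> leaders Q"
        using leader_in_keys[of g] g lookup_g by (auto simp: leaders_def in_keys_iff split: if_splits)
      then show False by blast
    qed
    then show "c b = 0"
      using b lookup_g by (metis (no_types, lifting) imageE lookup_zero)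
  next
    fix g :: "('x, 'b) gpoly"
    assume "g \<in> homog_part s"
    then obtain h where h: "keys h \<subseteq> ?S" "g - h \<in> Q"
      using reduce_modulo[OF assms] by blast
    have h_eq: "h = (\<Sum>t\<in>?S. scale_gp (lookup h (inv monom_gp (monom_gp t :: ('x, 'b) gpoly))) (monom_gp t))"
      using gpoly_eq_sum_monom[OF fin h(1)] by (simp add: inv_f_f[OF inj_monom_gp])
    show "\<exists>c :: ('x, 'b) gpoly \<Rightarrow> 'b. g - (\<Sum>t\<in>?S. scale_gp (c (monom_gp t)) (monom_gp t)) \<in> Q"
      using h(2) unfolding arg_cong[OF h_eq, of "\<lambda>h. g - h \<in> Q"]
      by (rule exI[of _ "\<lambda>b :: ('x, 'b) gpoly. lookup h (inv monom_gp b)"])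
  qed
qed

text \<open>
  The monomials that are not leaders form a basis of the quotient. The second part compares with
  the case \<open>Q = {0}\<close>.
\<close>
lemma quot_dim_standard:
  fixes Q :: "('x, 'b::field) gpoly set"
  assumes "gp.subspace Q" "Q \<subseteq> homog_part s"
  shows "quot_dim (homog_part s) Q = card ({t. mono_ord t = s} - leaders Q)"
    and "card {t :: 'x monomial. mono_ord t = s} = gp.dim Q + card ({t. mono_ord t = s} - leaders Q)"
proof -
  let ?S = "{t. mono_ord t = s} - leaders Q"
  have card: "card (monom_gp ` ?S :: ('x, 'b) gpoly set) = card ?S"
    using inj_monom_gp by (intro card_image) (auto intro: inj_on_subset)
  have fin: "finite (monom_gp ` {t. mono_ord t = s})"
    by (simp add: finite_mono_ord)
  show "quot_dim (homog_part s) Q = card ?S"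
    using quot_dim_eqI[OF subspace_homog_part assms homog_part_le_span fin quot_basis_standard[OF assms]]
      card by simp
  have "gp.dim (homog_part s :: ('x, 'b) gpoly set) = gp.dim Q + card ?S"
    using dim_quot_basis[OF subspace_homog_part assms homog_part_le_span fin quot_basis_standard[OF assms]]
      card by simp
  moreover have "gp.dim (homog_part s :: ('x, 'b) gpoly set) = card {t :: 'x monomial. mono_ord t = s}"
  proof -
    have 0: "gp.subspace ({0} :: ('x, 'b) gpoly set)" "{0 :: ('x, 'b) gpoly} \<subseteq> homog_part s"
      by (auto simp: gp.subspace_def homog_part_def)
    have "leaders ({0} :: ('x, 'b) gpoly set) = {}"
      by (simp add: leaders_def)
    moreover have "gp.dim ({0} :: ('x, 'b) gpoly set) = 0"
      by (rule gp.dim_unique[of "{}"]) (simp_all add: gp.independent_empty)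
    moreover have "card (monom_gp ` {t. mono_ord t = s} :: ('x, 'b) gpoly set) = card {t :: 'x monomial. mono_ord t = s}"
      using inj_monom_gp by (intro card_image) (auto intro: inj_on_subset)
    ultimately show ?thesis
      using dim_quot_basis[OF subspace_homog_part 0 homog_part_le_span fin quot_basis_standard[OF 0]]
      by simp
  qed
  ultimately show "card {t :: 'x monomial. mono_ord t = s} = gp.dim Q + card ?S"
    by simp
qed

end

context ranking
begin

lemma leader_diff:
  assumes "A \<noteq> 0" "le (leader le B) (leader le A)" "leader le B \<noteq> leader le A"
  shows "A - B \<noteq> 0 \<and> leader le (A - B) = leader le A"
proof -
  let ?u = "leader le A"
  have uA: "?u \<in> keys A"
    using assms(1) by (rule leader_in_keys)
  have "?u \<notin> keys B"
    using le_leader[of ?u B] le_antisym assms(2,3) by blast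
  then have *: "?u \<in> keys (A - B)"
    using uA by (simp add: in_keys_iff lookup_minus)
  have "le s ?u" if "s \<in> keys (A - B)" for s
  proof -
    have "s \<in> keys A \<or> s \<in> keys B"
      using that by (auto simp: in_keys_iff lookup_minus)
    then show ?thesis
      using le_leader le_trans assms(2) by blast
  qed
  then have "leader le (A - B) = ?u"
    using * by (intro leader_eqI)
  then show ?thesis
    using * by auto
qed

lemma leader_scale: "c \<noteq> 0 \<Longrightarrow> leader le (scale_gp c A) = leader le A"
proof -
  assume "c \<noteq> 0"
  then have "keys (scale_gp c A) = keys A"
    by (auto simp: in_keys_iff)
  then show ?thesis
    by (simp add: leader_def)
qed

text \<open>
  Distinct leaders cannot cancel: the largest one among the terms with nonzero coefficient
  survives.
\<close>
lemma leader_in_span: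
  assumes B: "\<And>b. b \<in> B \<Longrightarrow> b \<noteq> 0" "inj_on (leader le) B" and g: "g \<in> gp.span B" "g \<noteq> 0"
  shows "leader le g \<in> leader le ` B"
proof -
  obtain T c where T: "finite T" "T \<subseteq> B" and g_eq: "g = (\<Sum>b\<in>T. scale_gp (c b) b)"
    using g(1) by (auto simp: gp.span_explicit)
  define T' where "T' = {b \<in> T. c b \<noteq> 0}"
  have g_eq': "g = (\<Sum>b\<in>T'. scale_gp (c b) b)"
    unfolding g_eq T'_def using T(1) by (intro sum.mono_neutral_right) auto
  then have "T' \<noteq> {}"
    using g(2) by auto
  then obtain b0 where b0: "b0 \<in> T'" "\<forall>b\<in>T'. le (leader le b) (leader le b0)"
    using finite_has_greatest[of "leader le ` T'"] T(1) by (auto simp: T'_def)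
  let ?u = "leader le b0"
  have b0B: "b0 \<in> B" "b0 \<noteq> 0" "c b0 \<noteq> 0"
    using b0(1) T(2) B(1) by (auto simp: T'_def)
  have "lookup b ?u = 0" if "b \<in> T'" "b \<noteq> b0" for b
  proof (rule ccontr)
    assume "lookup b ?u \<noteq> 0"
    then have "le ?u (leader le b)"
      by (intro le_leader) (simp add: in_keys_iff)
    then have "leader le b = ?u"
      using b0(2) that(1) le_antisym by blast
    then show False
      using inj_onD[OF B(2)] that T(2) b0B(1) by (auto simp: T'_def)
  qed
  then have "lookup g ?u = (\<Sum>b\<in>T'. if b = b0 then c b0 * lookup b0 ?u else 0)"
    unfolding g_eq' lookup_scale_sum by (intro sum.cong) auto
  also have "\<dots> = c b0 * lookup b0 ?u"
    using b0(1) T(1) by (simp add: T'_def)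
  also have "\<dots> \<noteq> 0"
    using b0B leader_in_keys[of b0] by (simp add: in_keys_iff)
  finally have "?u \<in> keys g"
    by (simp add: in_keys_iff)
  moreover have "le s ?u" if "s \<in> keys g" for s
  proof -
    have "(\<Sum>b\<in>T'. c b * lookup b s) \<noteq> 0"
      using that unfolding g_eq' in_keys_iff lookup_scale_sum .
    then obtain b where "b \<in> T'" "c b * lookup b s \<noteq> 0"
      by (meson sum.neutral)
    then have "s \<in> keys b"
      by (auto simp: in_keys_iff)
    then show ?thesis
      using le_leader le_trans b0(2) \<open>b \<in> T'\<close> by blast
  qed
  ultimately have "leader le g = ?u"
    by (rule leader_eqI)
  then show ?thesis
    using b0B(1) by blast
qed

end

section \<open>Filtering a left ideal by cyclic modules\<close>

definition homog_component :: "nat \<Rightarrow> ('x::finite, 'f::field) gpoly \<Rightarrow> ('x, 'f) gpoly" where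
  "homog_component s g = (\<Sum>t | mono_ord t = s. scale_gp (lookup g t) (monom_gp t))"

lemma lookup_homog_component: "lookup (homog_component s g) t = (if mono_ord t = s then lookup g t else 0)"
proof -
  have "lookup (homog_component s g) t = (\<Sum>u | mono_ord u = s. if u = t then lookup g u else 0)"
    unfolding homog_component_def lookup_scale_sum by (intro sum.cong) (auto simp: lookup_monom_gp)
  then show ?thesis
    by (simp add: finite_mono_ord)
qed

lemma homog_component_add: "homog_component s (g + h) = homog_component s g + homog_component s h"
  by (rule poly_mapping_eqI) (simp add: lookup_homog_component lookup_add)

lemma homog_component_zero [simp]: "homog_component s 0 = 0"
  by (rule poly_mapping_eqI) (simp add: lookup_homog_component)

lemma homog_component_sum: "homog_component s (sum f A) = (\<Sum>a\<in>A. homog_component s (f a))"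
  by (induction A rule: infinite_finite_induct) (simp_all add: homog_component_add)

lemma homog_component_in_homog_part: "homog_component s g \<in> homog_part s"
  by (auto simp: homog_part_def in_keys_iff lookup_homog_component split: if_splits)

lemma homog_component_homog: "g \<in> homog_part r \<Longrightarrow> homog_component s g = (if s = r then g else 0)"
  by (rule poly_mapping_eqI) (auto simp: lookup_homog_component homog_part_def in_keys_iff)

lemma gpoly_eq_sum_homog_component: "\<exists>N. g = (\<Sum>s\<le>N. homog_component s g)"
proof
  let ?N = "Max (insert 0 (mono_ord ` keys g))"
  show "g = (\<Sum>s\<le>?N. homog_component s g)"
  proof (rule poly_mapping_eqI)
    fix t
    have "mono_ord t \<le> ?N" if "lookup g t \<noteq> 0"
      using that by (intro Max_ge) (auto simp: in_keys_iff)
    then show "lookup g t = lookup (\<Sum>s\<le>?N. homog_component s g) t"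
      by (auto simp: lookup_sum lookup_homog_component)
  qed
qed

lemma monomial_split:
  "k \<le> mono_ord t \<Longrightarrow> \<exists>t1 t2. t = t1 + t2 \<and> mono_ord t2 = k"
proof (induction k)
  case 0
  show ?case by (intro exI[of _ t] exI[of _ 0]) simp
next
  case (Suc k)
  then obtain t1 t2 where t: "t = t1 + t2" "mono_ord t2 = k"
    by auto
  then have "mono_ord t1 \<noteq> 0"
    using Suc.prems by (auto simp: mono_ord_add)
  then obtain x where x: "lookup t1 x \<noteq> 0"
    by (auto simp: mono_ord_def)
  have "t1 = (t1 - Poly_Mapping.single x 1) + Poly_Mapping.single x 1"
    using x by (intro poly_mapping_eqI) (auto simp: lookup_add lookup_minus lookup_single when_def)
  then have "t = (t1 - Poly_Mapping.single x 1) + (Poly_Mapping.single x 1 + t2)"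
    using t(1) by (metis add.assoc)
  then show ?case
    using t(2) by (metis mono_ord_add mono_ord_single plus_1_eq_Suc)
qed

context gpoly_ring
begin

lemma mul_zero_left [simp]: "mul 0 C = 0"
  using mul_add_left[of 0 0 C] by simp

lemma mul_zero_right [simp]: "mul A 0 = 0"
  using mul_add_right[of A 0 0] by simp

lemma mul_diff_left: "mul (A - B) C = mul A C - mul B C"
  using mul_add_left[of "A - B" B C] by simp

lemma mul_diff_right: "mul A (B - C) = mul A B - mul A C"
  using mul_add_right[of A "B - C" C] by simp

lemma mul_sum_left: "mul (sum f I) C = (\<Sum>i\<in>I. mul (f i) C)"
  by (induction I rule: infinite_finite_induct) (simp_all add: mul_add_left)

lemma mul_sum_right: "mul A (sum f I) = (\<Sum>i\<in>I. mul A (f i))"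
  by (induction I rule: infinite_finite_induct) (simp_all add: mul_add_right)

text \<open>
  Scalars need not commute with \<open>A\<close>, but they can be moved into the left factor as elements of the
  ring.
\<close>
lemma mul_scale_right: "mul A (scale_gp c B) = mul (mul A (scale_gp c (monom_gp 0))) B"
  by (simp add: mul_assoc mul_scale mul_one_left)

lemma subspace_left_ideal: "left_ideal_gp mul I \<Longrightarrow> gp.subspace I"
  unfolding left_ideal_gp_def gp.subspace_def by (metis mul_one_left mul_scale)

lemma left_ideal_hull: "left_ideal_gp mul (left_ideal_gp mul hull S)"
  by (rule hull_in) (auto simp: left_ideal_gp_def)

end

context graded_gpoly_ring
begin

text \<open>
  The component of degree \<open>s\<close> of a product is the sum of the products of components whose degrees
  add up to \<open>s\<close>.
\<close>
lemma homog_component_mul_mem: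
  assumes Q: "gp.subspace Q"
    and mem: "\<And>u v. u + v = s \<Longrightarrow> mul (homog_component u A) (homog_component v B) \<in> Q"
  shows "homog_component s (mul A B) \<in> Q"
proof -
  obtain N M where A: "A = (\<Sum>u\<le>N. homog_component u A)" and B: "B = (\<Sum>v\<le>M. homog_component v B)"
    using gpoly_eq_sum_homog_component by metis
  have "mul A B = (\<Sum>u\<le>N. \<Sum>v\<le>M. mul (homog_component u A) (homog_component v B))"
    by (subst A, subst B, subst mul_sum_left) (simp only: mul_sum_right)
  then have "homog_component s (mul A B) = (\<Sum>u\<le>N. \<Sum>v\<le>M. homog_component s (mul (homog_component u A) (homog_component v B)))"
    by (simp only: homog_component_sum)
  moreover have "homog_component s (mul (homog_component u A) (homog_component v B)) \<in> Q" for u v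
    using homog_component_homog[OF graded[OF homog_component_in_homog_part homog_component_in_homog_part], of s u A v B]
      mem[of u v] gp.subspace_0[OF Q] by (auto split: if_splits)
  ultimately show ?thesis
    by (simp only:) (intro gp.subspace_sum Q)
qed

text \<open>
  The elements \<open>\<Sum> A\<^sub>i f\<^sub>i\<close> with coefficients \<open>A\<^sub>i\<close> homogeneous of degree \<open>r\<close>: for generators of
  degree \<open>e\<close>, the part of degree \<open>r + e\<close> of the ideal that they generate.
\<close>
primrec gen_part :: "('x, 'f) gpoly list \<Rightarrow> nat \<Rightarrow> ('x, 'f) gpoly set" where
  "gen_part [] r = {0}"
| "gen_part (f # fs) r = {mul A f + g |A g. A \<in> homog_part r \<and> g \<in> gen_part fs r}"

lemma gen_part_ConsI:
  "A \<in> homog_part r \<Longrightarrow> g \<in> gen_part fs r \<Longrightarrow> mul A f + g \<in> gen_part (f # fs) r"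
  by auto

lemma subspace_gen_part: "gp.subspace (gen_part fs r)"
proof (induction fs)
  case (Cons f fs)
  show ?case
    unfolding gp.subspace_def
  proof (intro conjI ballI allI)
    show "0 \<in> gen_part (f # fs) r"
      using gp.subspace_0[OF Cons] gp.subspace_0[OF subspace_homog_part[of r]]
      by (force intro: exI[of _ 0])
    fix x assume "x \<in> gen_part (f # fs) r"
    then obtain A g where x: "x = mul A f + g" "A \<in> homog_part r" "g \<in> gen_part fs r"
      by auto
    show "scale_gp c x \<in> gen_part (f # fs) r" for c
    proof -
      have "scale_gp c x = mul (scale_gp c A) f + scale_gp c g"
        by (simp add: x(1) mul_scale gp.scale_right_distrib)
      then show ?thesis
        using gp.subspace_scale[OF Cons x(3)] gp.subspace_scale[OF subspace_homog_part x(2)]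
        by auto
    qed
    fix y assume "y \<in> gen_part (f # fs) r"
    then obtain B h where y: "y = mul B f + h" "B \<in> homog_part r" "h \<in> gen_part fs r"
      by auto
    have "x + y = mul (A + B) f + (g + h)"
      by (simp add: x(1) y(1) mul_add_left)
    then show "x + y \<in> gen_part (f # fs) r"
      using gp.subspace_add[OF Cons x(3) y(3)] gp.subspace_add[OF subspace_homog_part x(2) y(2)]
      by auto
  qed
qed (auto simp: gp.subspace_def)

lemma gen_part_Cons_mono: "gen_part fs r \<subseteq> gen_part (f # fs) r"
  using gen_part_ConsI[OF gp.subspace_0[OF subspace_homog_part], of _ fs r f] by auto

lemma gen_part_homog: "set fs \<subseteq> homog_part e \<Longrightarrow> gen_part fs r \<subseteq> homog_part (r + e)"
proof (induction fs)
  case (Cons f fs)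
  then have "mul A f + g \<in> homog_part (r + e)" if "A \<in> homog_part r" "g \<in> gen_part fs r" for A g
    using that graded by (intro gp.subspace_add[OF subspace_homog_part]) auto
  then show ?case by auto
qed (auto simp: homog_part_def)

lemma mul_gen_part: "B \<in> homog_part q \<Longrightarrow> g \<in> gen_part fs r \<Longrightarrow> mul B g \<in> gen_part fs (q + r)"
proof (induction fs arbitrary: g)
  case (Cons f fs)
  then obtain A h where g: "g = mul A f + h" "A \<in> homog_part r" "h \<in> gen_part fs r"
    by auto
  then have "mul B g = mul (mul B A) f + mul B h"
    by (simp add: mul_add_right mul_assoc)
  then show ?case
    using Cons g graded[OF Cons.prems(1) g(2)] by auto
qed simp

lemma gen_part_gen: "f \<in> set fs \<Longrightarrow> A \<in> homog_part r \<Longrightarrow> mul A f \<in> gen_part fs r"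
proof (induction fs)
  case (Cons g fs)
  then show ?case
    using gen_part_ConsI[OF Cons.prems(2) gp.subspace_0[OF subspace_gen_part], of f fs]
      gen_part_Cons_mono[of fs r g] by (cases "f = g") auto
qed simp

text \<open>
  Multiplication by \<open>f\<close> identifies \<open>D\<^sub>r\<close> modulo \<open>J\<^sub>r = {A. A f \<in> gen_part fs r}\<close> with the quotient of
  the two parts. The \<open>J\<^sub>r\<close> are the graded parts of a left ideal, so their leaders form a monomial
  ideal \<open>L\<close>, and the monomials outside \<open>L\<close>, multiplied by \<open>f\<close>, are representatives of a basis.
\<close>
lemma dim_gen_part_Cons:
  assumes "f \<in> homog_part e" "set fs \<subseteq> homog_part e"
  obtains L :: "'x monomial set" where "up_closed L"
    "\<And>r. gp.dim (gen_part (f # fs) r) = gp.dim (gen_part fs r) + card {t. mono_ord t = r \<and> t \<notin> L}"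
proof -
  define J where "J r = {A \<in> homog_part r. mul A f \<in> gen_part fs r}" for r
  define L where "L = (\<Union>r. leaders (J r))"
  have subJ: "gp.subspace (J r)" for r
    using gp.subspace_0[OF subspace_gen_part[of fs r]] gp.subspace_0[OF subspace_homog_part[of r]]
    by (auto simp: gp.subspace_def J_def mul_add_left mul_scale
        intro: gp.subspace_add[OF subspace_homog_part] gp.subspace_add[OF subspace_gen_part]
          gp.subspace_scale[OF subspace_homog_part] gp.subspace_scale[OF subspace_gen_part])
  have J_homog: "J r \<subseteq> homog_part r" for r
    by (auto simp: J_def)
  have "up_closed L"
    unfolding up_closed_def
  proof (intro ballI allI)
    fix t w assume "t \<in> L"
    then obtain r A where A: "A \<in> J r" "A \<noteq> 0" "t = leader le A"
      by (auto simp: L_def leaders_def)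
    let ?B = "mul (monom_gp w) A"
    have w0: "monom_gp w \<noteq> (0 :: ('x, 'f) gpoly)"
      by (metis keys_monom_gp keys_zero insert_not_empty)
    have w: "monom_gp w \<in> homog_part (mono_ord w)"
      by (simp add: monom_gp_in_homog_part)
    have "?B \<in> J (mono_ord w + r)"
      using A(1) graded[OF w, of A r] mul_gen_part[OF w, of "mul A f" fs r]
      by (simp add: J_def mul_assoc)
    moreover have "?B \<noteq> 0" "leader le ?B = t + w"
      using leader_mul[OF w0 A(2)] A(3) by (simp_all add: add.commute)
    ultimately have "t + w \<in> leaders (J (mono_ord w + r))"
      unfolding leaders_def by (intro image_eqI[of _ _ ?B]) simp_all
    then show "t + w \<in> L"
      unfolding L_def by (rule UN_I[OF UNIV_I])
  qed
  have std: "{t. mono_ord t = r} - leaders (J r) = {t. mono_ord t = r \<and> t \<notin> L}" for r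
  proof -
    have "t \<in> leaders (J r)" if t: "t \<in> leaders (J r')" "mono_ord t = r" for t r'
    proof -
      obtain A where A: "A \<in> J r'" "A \<noteq> 0" "t = leader le A"
        using t(1) by (auto simp: leaders_def)
      then have "mono_ord t = r'"
        using leader_in_keys[of A] J_homog[of r'] by (auto simp: homog_part_def)
      then show ?thesis
        using t by simp
    qed
    then show ?thesis
      by (auto simp: L_def)
  qed
  have "gp.dim (gen_part (f # fs) r) = gp.dim (gen_part fs r) + card {t. mono_ord t = r \<and> t \<notin> L}" for r
  proof -
    define T :: "('x, 'f) gpoly set" where "T = monom_gp ` ({t. mono_ord t = r} - leaders (J r))"
    have T: "finite T" "T \<subseteq> homog_part r"
        "\<And>c. (\<Sum>b\<in>T. scale_gp (c b) b) \<in> J r \<Longrightarrow> \<forall>b\<in>T. c b = 0"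
        "\<And>g. g \<in> homog_part r \<Longrightarrow> \<exists>c. g - (\<Sum>b\<in>T. scale_gp (c b) b) \<in> J r"
      using quot_basis_standard[OF subJ J_homog, of r] by (auto simp: quot_basis_def T_def)
    have comb: "mul (\<Sum>b\<in>T. scale_gp (c b) b) f = (\<Sum>b\<in>T. scale_gp (c b) (mul b f))" for c
      by (simp add: mul_sum_left mul_scale)
    have comb_homog: "(\<Sum>b\<in>T. scale_gp (c b) b) \<in> homog_part r" for c
      using T(2) by (intro gp.subspace_sum gp.subspace_scale subspace_homog_part) auto
    have comb_zero: "\<forall>b\<in>T. c b = 0" if "(\<Sum>b\<in>T. scale_gp (c b) (mul b f)) \<in> gen_part fs r" for c
      using T(3)[of c] that comb_homog[of c] comb[of c] by (simp add: J_def)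
    have inj: "inj_on (\<lambda>b. mul b f) T"
    proof (rule inj_onI, rule ccontr)
      fix a b assume ab: "a \<in> T" "b \<in> T" "mul a f = mul b f" "a \<noteq> b"
      define c where "c x = (if x = a then 1 else if x = b then - 1 else 0 :: 'f)" for x
      have "(\<Sum>x\<in>T. scale_gp (c x) (mul x f)) =
          (\<Sum>x\<in>T. (if x = a then mul a f else 0) - (if x = b then mul b f else 0))"
        using ab(4) by (intro sum.cong) (auto simp: c_def)
      also have "\<dots> = 0"
        using T(1) ab by (simp add: sum_subtractf)
      finally have "\<forall>b\<in>T. c b = 0"
        using gp.subspace_0[OF subspace_gen_part] by (intro comb_zero) simp
      then show False
        using ab(1) by (auto simp: c_def)
    qed
    have "quot_basis (gen_part (f # fs) r) (gen_part fs r) ((\<lambda>b. mul b f) ` T)"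
      unfolding quot_basis_def
    proof (intro conjI allI impI ballI)
      show "finite ((\<lambda>b. mul b f) ` T)"
        using T(1) by simp
      show "(\<lambda>b. mul b f) ` T \<subseteq> gen_part (f # fs) r"
        using T(2) gen_part_gen[of f "f # fs"] by auto
    next
      fix c b
      assume "(\<Sum>b\<in>(\<lambda>b. mul b f) ` T. scale_gp (c b) b) \<in> gen_part fs r"
        and "b \<in> (\<lambda>b. mul b f) ` T"
      then show "c b = 0"
        using comb_zero[of "\<lambda>b. c (mul b f)"] by (auto simp: sum.reindex[OF inj])
    next
      fix g assume "g \<in> gen_part (f # fs) r"
      then obtain A h where g: "g = mul A f + h" "A \<in> homog_part r" "h \<in> gen_part fs r"
        by auto
      obtain c where c: "A - (\<Sum>b\<in>T. scale_gp (c b) b) \<in> J r"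
        using T(4)[OF g(2)] by blast
      have "mul (A - (\<Sum>b\<in>T. scale_gp (c b) b)) f + h \<in> gen_part fs r"
        using c g(3) by (intro gp.subspace_add[OF subspace_gen_part]) (auto simp: J_def)
      then have *: "g - (\<Sum>b\<in>T. scale_gp (c b) (mul b f)) \<in> gen_part fs r"
        by (simp add: g(1) mul_diff_left comb algebra_simps)
      define c' where "c' = c \<circ> the_inv_into T (\<lambda>b. mul b f)"
      have "(\<Sum>b\<in>(\<lambda>b. mul b f) ` T. scale_gp (c' b) b) = (\<Sum>b\<in>T. scale_gp (c b) (mul b f))"
        unfolding sum.reindex[OF inj] by (intro sum.cong) (auto simp: c'_def the_inv_into_f_f[OF inj])
      with * have "g - (\<Sum>b\<in>(\<lambda>b. mul b f) ` T. scale_gp (c' b) b) \<in> gen_part fs r"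
        by (simp only:)
      then show "\<exists>c. g - (\<Sum>b\<in>(\<lambda>b. mul b f) ` T. scale_gp (c b) b) \<in> gen_part fs r"
        by (rule exI[of _ c'])
    qed
    moreover have "gen_part (f # fs) r \<subseteq> gp.span (monom_gp ` {t. mono_ord t = r + e})"
      using gen_part_homog[of "f # fs" e r] assms homog_part_le_span[of "r + e"] by auto
    ultimately have "gp.dim (gen_part (f # fs) r) = gp.dim (gen_part fs r) + card ((\<lambda>b. mul b f) ` T)"
      by (intro dim_quot_basis subspace_gen_part gen_part_Cons_mono) (auto simp: finite_mono_ord)
    moreover have "card ((\<lambda>b. mul b f) ` T) = card {t. mono_ord t = r \<and> t \<notin> L}"
      unfolding card_image[OF inj] unfolding T_def std[symmetric]
      using inj_monom_gp by (intro card_image) (auto intro: inj_on_subset)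
    ultimately show ?thesis by simp
  qed
  then show ?thesis
    using that[OF \<open>up_closed L\<close>] by blast
qed

text \<open>
  The number \<open>m\<close> counts the generators \<open>f\<close> in the list for which no multiple \<open>A f\<close> with \<open>A \<noteq> 0\<close>
  lies in the part generated by the later ones. In positive codimension
  it turns out to be \<open>1\<close>.
\<close>
lemma dim_gen_part:
  assumes "set fs \<subseteq> homog_part e"
  shows "\<exists>m p. cone_chain CARD('x) (CARD('x) - 1) 0 p \<and>
    (\<forall>\<^sub>F r in sequentially. int (gp.dim (gen_part fs r)) = hilb CARD('x) (of_nat m + p) r)"
  using assms
proof (induction fs)
  case Nil
  have "gp.dim ({0} :: ('x, 'f) gpoly set) = 0"
    by (rule gp.dim_unique[of "{}"]) (simp_all add: gp.independent_empty)
  then show ?case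
    by (intro exI[of _ 0]) (simp add: cone_chain_zero)
next
  case (Cons f fs)
  then obtain m p where p: "cone_chain CARD('x) (CARD('x) - 1) 0 p"
    "\<forall>\<^sub>F r in sequentially. int (gp.dim (gen_part fs r)) = hilb CARD('x) (of_nat m + p) r"
    by auto
  obtain L :: "'x monomial set" where L: "up_closed L"
    "\<And>r. gp.dim (gen_part (f # fs) r) = gp.dim (gen_part fs r) + card {t. mono_ord t = r \<and> t \<notin> L}"
    using dim_gen_part_Cons[of f e fs] Cons.prems by auto
  obtain q where q: "q = 1 \<or> cone_chain CARD('x) (CARD('x) - 1) 0 q"
    "\<forall>\<^sub>F r in sequentially. int (card {t. mono_ord t = r \<and> t \<notin> L}) = hilb CARD('x) q r"
    using hilb_monomial_complement[OF L(1)] by blast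
  have ev: "\<forall>\<^sub>F r in sequentially. int (gp.dim (gen_part (f # fs) r)) =
      hilb CARD('x) (of_nat m + p + q) r"
    using p(2) q(2) by eventually_elim (simp add: L(2) hilb_add del: gen_part.simps)
  show ?case
  proof (cases "q = 1")
    case True
    then have "of_nat m + p + q = of_nat (Suc m) + p" by simp
    with ev show ?thesis
      using p(1) by (intro exI[of _ "Suc m"] exI[of _ p]) simp
  next
    case False
    then have "cone_chain CARD('x) (CARD('x) - 1) 0 (p + q)"
      using p(1) q(1) by (intro cone_chain_add) auto
    with ev show ?thesis
      by (intro exI[of _ m] exI[of _ "p + q"]) (simp add: add.assoc)
  qed
qed

text \<open>
  The components of a product \<open>A g\<close> in degrees \<open>\<ge> e\<close> come from components of \<open>g\<close> of degree \<open>\<ge> e\<close>, or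
  from a component of some degree \<open>v < e\<close> multiplied by monomials of order \<open>\<ge> e - v\<close>. In the second
  case a factor of order exactly \<open>e - v\<close> is applied first and lands in the part of degree \<open>e\<close>, which
  \<open>fs\<close> spans over \<open>F\<close>. So the elements with all components as described form a left ideal.
\<close>
lemma gen_part_eq:
  fixes S :: "('x, 'f) gpoly set"
  defines "H \<equiv> left_ideal_gp mul hull S"
  assumes homog: "\<And>h. h \<in> S \<Longrightarrow> \<exists>s. h \<in> homog_part s"
    and ord: "\<And>h. h \<in> S \<Longrightarrow> ord_at_most e h"
    and fs: "set fs \<subseteq> H \<inter> homog_part e" "H \<inter> homog_part e \<subseteq> gp.span (set fs)"
  shows "gen_part fs r = H \<inter> homog_part (r + e)"
proof
  have H: "left_ideal_gp mul H"
    unfolding H_def by (rule left_ideal_hull)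
  have subH: "gp.subspace H"
    using H by (rule subspace_left_ideal)
  have mulH: "mul A g \<in> H" if "g \<in> H" for A g
    using H that by (simp add: left_ideal_gp_def)
  have "gen_part gs r \<subseteq> H" if "set gs \<subseteq> H" for gs
    using that
  proof (induction gs)
    case (Cons g gs)
    then show ?case
      using mulH by (auto intro: gp.subspace_add[OF subH])
  qed (simp add: gp.subspace_0[OF subH])
  then show "gen_part fs r \<subseteq> H \<inter> homog_part (r + e)"
    using fs(1) gen_part_homog[of fs e r] by auto
  have gen_span: "mul A h \<in> gen_part fs r" if "h \<in> H \<inter> homog_part e" "A \<in> homog_part r" for A h r
  proof -
    have "h \<in> gp.span (set fs)"
      using that fs(2) by blast
    then show ?thesis
      using that(2)
    proof (induction arbitrary: A rule: gp.span_induct_alt)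
      case base
      then show ?case
        using gp.subspace_0[OF subspace_gen_part] by simp
    next
      case (step c x y)
      have "mul A (scale_gp c (monom_gp 0)) \<in> homog_part (r + 0)"
        using step by (intro graded gp.subspace_scale[OF subspace_homog_part])
          (simp_all add: monom_gp_in_homog_part)
      then have "mul A (scale_gp c x) \<in> gen_part fs r"
        using gen_part_gen[OF step(1)] unfolding mul_scale_right[of A c x] by simp
      then show ?case
        using step by (simp add: mul_add_right gp.subspace_add[OF subspace_gen_part])
    qed
  qed
  define I where "I = {g. (\<forall>s. homog_component s g \<in> H) \<and> (\<forall>r. homog_component (r + e) g \<in> gen_part fs r)}"
  have "left_ideal_gp mul I"
    unfolding left_ideal_gp_def
  proof (intro conjI ballI allI)
    show "0 \<in> I"
      using gp.subspace_0[OF subH] gp.subspace_0[OF subspace_gen_part] by (simp add: I_def)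
    fix g assume g: "g \<in> I"
    show "g + h \<in> I" if "h \<in> I" for h
      using g that by (auto simp: I_def homog_component_add intro: gp.subspace_add[OF subH]
          gp.subspace_add[OF subspace_gen_part])
    fix A
    have "homog_component s (mul A g) \<in> H" for s
      using g by (intro homog_component_mul_mem subH mulH) (simp add: I_def)
    moreover have "homog_component (r + e) (mul A g) \<in> gen_part fs r" for r
    proof (rule homog_component_mul_mem[OF subspace_gen_part])
      fix u v assume uv: "u + v = r + e"
      show "mul (homog_component u A) (homog_component v g) \<in> gen_part fs r"
      proof (cases "e \<le> v")
        case True
        then have "homog_component (v - e + e) g \<in> gen_part fs (v - e)"
          using g by (simp only: I_def mem_Collect_eq)
        then show ?thesis
          using mul_gen_part[OF homog_component_in_homog_part, of "homog_component v g" fs "v - e" u A] True uv by simp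
      next
        case False
        have "mul (monom_gp t) (homog_component v g) \<in> gen_part fs r" if tu: "mono_ord t = u" for t
        proof -
          have "e - v \<le> mono_ord t"
            using tu uv by simp
          then obtain t1 t2 where t: "t = t1 + t2" "mono_ord t2 = e - v"
            using monomial_split by blast
          have "mul (monom_gp t2) (homog_component v g) \<in> homog_part (e - v + v)"
            using t(2) by (intro graded homog_component_in_homog_part) (simp add: monom_gp_in_homog_part)
          then have "mul (monom_gp t2) (homog_component v g) \<in> H \<inter> homog_part e"
            using g mulH False by (simp add: I_def)
          moreover have "monom_gp t1 \<in> homog_part r"
            using t tu uv False by (simp add: monom_gp_in_homog_part mono_ord_add)
          ultimately have "mul (monom_gp t1) (mul (monom_gp t2) (homog_component v g)) \<in> gen_part fs r"
            by (rule gen_span)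
          then show ?thesis
            by (simp only: t(1) mul_monom[symmetric] mul_assoc)
        qed
        then show ?thesis
          unfolding homog_component_def[of u A] mul_sum_left mul_scale
          by (intro gp.subspace_sum gp.subspace_scale subspace_gen_part) auto
      qed
    qed
    ultimately show "mul A g \<in> I"
      by (simp add: I_def)
  qed
  moreover have "S \<subseteq> I"
  proof
    fix h assume h: "h \<in> S"
    then have hH: "h \<in> H"
      unfolding H_def by (rule hull_inc)
    obtain s where s: "h \<in> homog_part s"
      using homog[OF h] by blast
    have "homog_component (r + e) h \<in> gen_part fs r" for r
    proof (cases "homog_component (r + e) h = 0")
      case True
      then show ?thesis
        using gp.subspace_0[OF subspace_gen_part] by simp
    next
      case False
      then have sr: "s = r + e" "homog_component (r + e) h = h" "h \<noteq> 0"
        using homog_component_homog[OF s] by (auto split: if_splits)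
      then obtain t where "t \<in> keys h"
        by fastforce
      then have "mono_ord t = s" "mono_ord t \<le> e"
        using s ord[OF h] by (auto simp: homog_part_def ord_at_most_def)
      then have "r = 0" "h \<in> H \<inter> homog_part e"
        using sr s hH by auto
      then have "mul (monom_gp 0) h \<in> gen_part fs r"
        by (intro gen_span) (simp_all add: monom_gp_in_homog_part)
      then show ?thesis
        using sr by (simp add: mul_one_left)
    qed
    moreover have "homog_component q h \<in> H" for q
      using homog_component_homog[OF s, of q] hH gp.subspace_0[OF subH] by simp
    ultimately show "h \<in> I"
      by (simp add: I_def)
  qed
  ultimately have "H \<subseteq> I"
    unfolding H_def by (intro hull_minimal)
  show "H \<inter> homog_part (r + e) \<subseteq> gen_part fs r"
  proof
    fix g assume g: "g \<in> H \<inter> homog_part (r + e)"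
    then have "homog_component (r + e) g \<in> gen_part fs r"
      using \<open>H \<subseteq> I\<close> by (auto simp: I_def)
    then show "g \<in> gen_part fs r"
      using homog_component_homog[of g "r + e" "r + e"] g by simp
  qed
qed

text \<open>
  The symbol of \<open>D/H\<close> is the symbol \<open>1\<close> of \<open>D\<close> minus the symbol of \<open>H\<close>, which is that of
  \<open>dim_gen_part\<close> shifted by \<open>e\<close>.
\<close>
lemma hilbert_fun_symbol:
  fixes S :: "('x, 'f) gpoly set"
  assumes homog: "\<And>h. h \<in> S \<Longrightarrow> \<exists>s. h \<in> homog_part s"
    and ord: "\<And>h. h \<in> S \<Longrightarrow> ord_at_most e h"
  obtains m p where "cone_chain CARD('x) (CARD('x) - 1) e p"
    "\<forall>\<^sub>F s in sequentially.
       int (hilbert_fun mul S s) = hilb CARD('x) (1 - (of_nat m * W ^ e + p)) s"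
proof -
  define H where "H = left_ideal_gp mul hull S"
  have subH: "gp.subspace (H \<inter> homog_part s)" for s
    unfolding H_def
    by (intro gp.subspace_inter subspace_left_ideal left_ideal_hull subspace_homog_part)
  obtain B where B: "B \<subseteq> H \<inter> homog_part e" "gp.independent B" "H \<inter> homog_part e \<subseteq> gp.span B"
    using gp.basis_exists by metis
  have "finite B"
    using gp.independent_span_bound[OF _ B(2), of "monom_gp ` {t. mono_ord t = e}"]
      B(1) homog_part_le_span[of e] by (auto simp: finite_mono_ord)
  then obtain fs where fs: "set fs = B"
    using finite_list by blast
  have part: "gen_part fs r = H \<inter> homog_part (r + e)" for r
    unfolding H_def using B fs by (intro gen_part_eq homog ord) (simp_all add: H_def)
  obtain m p where p: "cone_chain CARD('x) (CARD('x) - 1) 0 p"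
      "\<forall>\<^sub>F r in sequentially. int (gp.dim (gen_part fs r)) = hilb CARD('x) (of_nat m + p) r"
    using dim_gen_part[of fs e] fs B(1) by auto
  have "\<forall>\<^sub>F r in sequentially.
      int (hilbert_fun mul S (r + e)) = hilb CARD('x) (1 - (of_nat m * W ^ e + W ^ e * p)) (r + e)"
    using p(2) eventually_gt_at_top[of 0]
  proof eventually_elim
    case (elim r)
    have "{t :: 'x monomial. mono_ord t = r + e} = mcone_part 0 UNIV (r + e)"
      by (simp add: mcone_part_def mcone_def)
    then have "int (card {t :: 'x monomial. mono_ord t = r + e}) = hilb CARD('x) 1 (r + e)"
      using hilb_mcone[of "0 :: 'x monomial" "r + e" UNIV] elim(2) by simp
    moreover have "hilb CARD('x) (of_nat m * W ^ e + W ^ e * p) (r + e) = hilb CARD('x) (of_nat m + p) r"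
      using hilb_mult_W_power[of "CARD('x)" "of_nat m + p" e r] by (simp add: algebra_simps)
    moreover have "hilbert_fun mul S (r + e) = card ({t. mono_ord t = r + e} - leaders (H \<inter> homog_part (r + e)))"
      unfolding hilbert_fun_def H_def[symmetric] by (rule quot_dim_standard[OF subH]) simp
    moreover have "card {t :: 'x monomial. mono_ord t = r + e} = gp.dim (gen_part fs r)
        + card ({t. mono_ord t = r + e} - leaders (H \<inter> homog_part (r + e)))"
      unfolding part by (rule quot_dim_standard[OF subH]) simp
    ultimately show ?case
      using elim(1) by (simp only: hilb_diff of_nat_add)
  qed
  then have "\<forall>\<^sub>F s in sequentially.
      int (hilbert_fun mul S s) = hilb CARD('x) (1 - (of_nat m * W ^ e + W ^ e * p)) s"
    by (rule eventually_sequentially_seg[THEN iffD1])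
  moreover have "cone_chain CARD('x) (CARD('x) - 1) e (W ^ e * p)"
    using cone_chain_shift[OF p(1), of e] by simp
  ultimately show ?thesis
    using that by blast
qed

end

section \<open>Type, codimension and typical dimension from the symbol\<close>

text \<open>The polynomial \<open>(s + r) choose r\<close> in \<open>s\<close>.\<close>

definition binom_poly :: "nat \<Rightarrow> rat poly" where
  "binom_poly r = smult (1 / fact r) (\<Prod>i = 0..<r. [:1 + of_nat i, 1:])"

lemma poly_binom_poly: "poly (binom_poly r) (of_nat s) = of_nat ((s + r) choose r)"
proof -
  have "of_nat ((s + r) choose r) = (of_nat (s + r) :: rat) gchoose r"
    by (rule binomial_gbinomial)
  also have "\<dots> = pochhammer (of_nat s + 1) r / fact r"
    by (simp add: gbinomial_pochhammer')
  also have "\<dots> = poly (binom_poly r) (of_nat s)"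
    by (simp add: binom_poly_def pochhammer_prod poly_prod algebra_simps)
  finally show ?thesis ..
qed

lemma degree_binom_prod:
  "degree (\<Prod>i = 0..<r. [:1 + of_nat i, 1 :: rat:]) = r"
  "coeff (\<Prod>i = 0..<r. [:1 + of_nat i, 1 :: rat:]) r = 1"
proof -
  have "degree (\<Prod>i = 0..<r. [:1 + of_nat i, 1 :: rat:]) = (\<Sum>i = 0..<r. 1)"
    by (subst degree_prod_eq_sum_degree) auto
  then show deg: "degree (\<Prod>i = 0..<r. [:1 + of_nat i, 1 :: rat:]) = r"
    by simp
  have "lead_coeff (\<Prod>i = 0..<r. [:1 + of_nat i, 1 :: rat:]) = 1"
    by (simp add: lead_coeff_prod)
  then show "coeff (\<Prod>i = 0..<r. [:1 + of_nat i, 1 :: rat:]) r = 1"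
    by (simp only: deg)
qed

lemma degree_binom_poly: "degree (binom_poly r) = r"
  and coeff_binom_poly: "coeff (binom_poly r) r = 1 / fact r"
  by (simp_all add: binom_poly_def degree_binom_prod)

definition binom_comb :: "nat \<Rightarrow> (nat \<Rightarrow> int) \<Rightarrow> rat poly" where
  "binom_comb d a = (\<Sum>i\<le>d. smult (of_int (a i)) (binom_poly i))"

lemma poly_binom_comb:
  "poly (binom_comb d a) (of_nat s) = (\<Sum>i\<le>d. of_int (a i) * of_nat ((s + i) choose i))"
  by (simp add: binom_comb_def poly_sum poly_binom_poly)

lemma coeff_binom_comb: "coeff (binom_comb d a) d = of_int (a d) / fact d"
proof -
  have "(\<Sum>i\<in>{..<d}. coeff (smult (of_int (a i)) (binom_poly i)) d) = 0"
    by (intro sum.neutral) (simp add: coeff_eq_0 degree_binom_poly)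
  then show ?thesis
    by (simp add: binom_comb_def coeff_sum lessThan_Suc_atMost[symmetric] coeff_binom_poly)
qed

lemma degree_binom_comb_le: "degree (binom_comb d a) \<le> d"
  unfolding binom_comb_def
  by (intro degree_sum_le) (auto intro!: order_trans[OF degree_smult_le] simp: degree_binom_poly)

lemma degree_binom_comb: "a d \<noteq> 0 \<Longrightarrow> degree (binom_comb d a) = d"
  using coeff_binom_comb[of d a] degree_binom_comb_le[of d a]
  by (intro order_antisym le_degree) simp_all

lemma poly_eq_if_eventually_eq:
  fixes p q :: "'a::field_char_0 poly"
  assumes "\<forall>\<^sub>F s in sequentially. poly p (of_nat s) = poly q (of_nat s)"
  shows "p = q"
proof -
  obtain N where N: "\<And>s. s \<ge> N \<Longrightarrow> poly p (of_nat s) = poly q (of_nat s)"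
    using assms by (auto simp: eventually_sequentially)
  have "infinite (of_nat ` {N..} :: 'a set)"
    using infinite_Ici by (subst finite_image_iff) (auto intro: inj_on_of_nat)
  moreover have "of_nat ` {N..} \<subseteq> {x. poly (p - q) x = 0}"
    using N by auto
  ultimately have "infinite {x. poly (p - q) x = 0}"
    by (rule infinite_super[rotated])
  then show ?thesis
    using poly_roots_finite[of "p - q"] by auto
qed

lemma poly_binom_comb_hilb:
  "poly (binom_comb N (\<lambda>i. coeff p (N - i))) (of_nat s) = of_int (hilb (Suc N) p s)"
  unfolding poly_binom_comb hilb_def of_int_sum lessThan_Suc_atMost
  by (rule sum.reindex_bij_witness[of _ "\<lambda>j. N - j" "\<lambda>i. N - i"]) auto

text \<open>
  A symbol of the Hilbert function determines all invariants: with \<open>k\<close> the position of its first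
  nonzero coefficient among the first \<open>CARD('x)\<close>, the codimension is \<open>k\<close> and the typical dimension is that
  coefficient.
\<close>

context
  fixes mul :: "('x::finite, 'f::field) gpoly \<Rightarrow> ('x, 'f) gpoly \<Rightarrow> ('x, 'f) gpoly"
    and S :: "('x, 'f) gpoly set" and p :: "int poly"
  assumes symbol: "\<forall>\<^sub>F s in sequentially. int (hilbert_fun mul S s) = hilb CARD('x) p s"
begin

lemma char_poly_eq: "char_poly mul S = binom_comb (CARD('x) - 1) (\<lambda>i. coeff p (CARD('x) - 1 - i))"
  unfolding char_poly_def
proof (rule the_equality)
  have n: "Suc (CARD('x) - 1) = CARD('x)"
    by simp
  show *: "\<forall>\<^sub>F s in sequentially. of_nat (hilbert_fun mul S s) =
      poly (binom_comb (CARD('x) - 1) (\<lambda>i. coeff p (CARD('x) - 1 - i))) (of_nat s)"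
    using symbol
  proof eventually_elim
    case (elim s)
    have "(of_nat (hilbert_fun mul S s) :: rat) = of_int (int (hilbert_fun mul S s))"
      by simp
    also have "\<dots> = of_int (hilb (Suc (CARD('x) - 1)) p s)"
      by (simp only: elim n)
    also have "\<dots> = poly (binom_comb (CARD('x) - 1) (\<lambda>i. coeff p (CARD('x) - 1 - i))) (of_nat s)"
      by (rule poly_binom_comb_hilb[symmetric])
    finally show ?case .
  qed
  show "w = binom_comb (CARD('x) - 1) (\<lambda>i. coeff p (CARD('x) - 1 - i))"
    if "\<forall>\<^sub>F s in sequentially. of_nat (hilbert_fun mul S s) = poly w (of_nat s)" for w
  proof (rule poly_eq_if_eventually_eq)
    show "\<forall>\<^sub>F s in sequentially. poly w (of_nat s) =
        poly (binom_comb (CARD('x) - 1) (\<lambda>i. coeff p (CARD('x) - 1 - i))) (of_nat s)"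
      using * that by eventually_elim simp
  qed
qed

lemma char_poly_eq_truncated:
  assumes "k < CARD('x)" "\<And>j. j < k \<Longrightarrow> coeff p j = 0"
  shows "char_poly mul S = binom_comb (CARD('x) - 1 - k) (\<lambda>i. coeff p (CARD('x) - 1 - i))"
  unfolding char_poly_eq binom_comb_def
  using assms by (intro sum.mono_neutral_right) auto

lemma gen_type_eq:
  assumes "k < CARD('x)" "\<And>j. j < k \<Longrightarrow> coeff p j = 0" "coeff p k \<noteq> 0"
  shows "gen_type mul S = CARD('x) - 1 - k"
proof -
  have "char_poly mul S = binom_comb (CARD('x) - 1 - k) (\<lambda>i. coeff p (CARD('x) - 1 - i))"
    using assms(1,2) by (rule char_poly_eq_truncated)
  then show ?thesis
    unfolding gen_type_def using assms by (simp add: degree_binom_comb)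
qed

lemma has_codim_iff:
  "has_codim mul S k \<longleftrightarrow> k < CARD('x) \<and> (\<forall>j<k. coeff p j = 0) \<and> coeff p k \<noteq> 0"
proof
  assume k: "k < CARD('x) \<and> (\<forall>j<k. coeff p j = 0) \<and> coeff p k \<noteq> 0"
  then have "coeff (char_poly mul S) (CARD('x) - 1 - k) \<noteq> 0"
    using coeff_binom_comb by (subst char_poly_eq_truncated[of k]) simp_all
  moreover have "gen_type mul S = CARD('x) - 1 - k"
    using k by (intro gen_type_eq) auto
  ultimately show "has_codim mul S k"
    using k by (auto simp: has_codim_def)
next
  assume cod: "has_codim mul S k"
  have "\<exists>j<CARD('x). coeff p j \<noteq> 0"
  proof (rule ccontr)
    assume "\<not> (\<exists>j<CARD('x). coeff p j \<noteq> 0)"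
    then have "char_poly mul S = 0"
      unfolding char_poly_eq binom_comb_def by (intro sum.neutral) simp
    then show False
      using cod by (simp add: has_codim_def)
  qed
  then obtain j where j: "j < CARD('x)" "coeff p j \<noteq> 0" "\<And>i. i < j \<Longrightarrow> coeff p i = 0"
    using exists_least_iff[of "\<lambda>j. j < CARD('x) \<and> coeff p j \<noteq> 0"]
    by (metis order.strict_trans)
  then have "gen_type mul S = CARD('x) - 1 - j"
    by (intro gen_type_eq) auto
  then have "j = k"
    using cod j(1) by (simp add: has_codim_def)
  then show "k < CARD('x) \<and> (\<forall>j<k. coeff p j = 0) \<and> coeff p k \<noteq> 0"
    using j by simp
qed

lemma typical_dim_eq:
  assumes "has_codim mul S k"
  shows "typical_dim mul S = coeff p k"
proof -
  have k: "k < CARD('x)" "\<And>j. j < k \<Longrightarrow> coeff p j = 0" "coeff p k \<noteq> 0"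
    using assms by (simp_all add: has_codim_iff)
  define d where "d = CARD('x) - 1 - k"
  have d: "gen_type mul S = d"
    unfolding d_def using k by (rule gen_type_eq)
  have cp: "char_poly mul S = binom_comb d (\<lambda>i. coeff p (CARD('x) - 1 - i))"
    unfolding d_def using k(1,2) by (rule char_poly_eq_truncated)
  have dk: "CARD('x) - 1 - d = k"
    using k(1) by (simp add: d_def)
  show ?thesis
    unfolding typical_dim_def
  proof (rule the_equality)
    show "\<exists>a. coeff p k = a (gen_type mul S) \<and> (\<forall>s. poly (char_poly mul S) (of_nat s) =
        (\<Sum>i\<le>gen_type mul S. of_int (a i) * of_nat ((s + i) choose i)))"
      unfolding d cp by (intro exI[of _ "\<lambda>i. coeff p (CARD('x) - 1 - i)"])
        (simp only: poly_binom_comb dk simp_thms)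
    fix t
    assume "\<exists>a. t = a (gen_type mul S) \<and> (\<forall>s. poly (char_poly mul S) (of_nat s) =
        (\<Sum>i\<le>gen_type mul S. of_int (a i) * of_nat ((s + i) choose i)))"
    then obtain a where a: "t = a d" "\<And>s. poly (char_poly mul S) (of_nat s) = poly (binom_comb d a) (of_nat s)"
      unfolding d poly_binom_comb by blast
    then have "char_poly mul S = binom_comb d a"
      by (intro poly_eq_if_eventually_eq) simp
    then have "of_int (a d) / fact d = (of_int (coeff p k) / fact d :: rat)"
      using coeff_binom_comb[of d a] coeff_binom_comb[of d "\<lambda>i. coeff p (CARD('x) - 1 - i)"]
      by (simp only: cp dk)
    then show "t = coeff p k"
      by (simp add: a(1))
  qed
qed

end

text \<open>
  With \<open>m\<close> as in \<open>hilbert_fun_symbol\<close>, codimension \<open>k > 0\<close> makes the constant coefficient \<open>1 - m\<close> of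
  the symbol vanish, so \<open>m = 1\<close>: the ideal contributes exactly one full cone of degree \<open>e\<close>. The symbol of \<open>D/H\<close> is then
  \<open>1 - W\<^sup>e = Y \<cdot> W_sum (cone_degs e 0)\<close> minus a chain of cones starting at degree \<open>e\<close>.
\<close>
theorem typical_dim_le_length_cone_degs:
  fixes mul :: "('x::finite, 'f::field) gpoly \<Rightarrow> ('x, 'f) gpoly \<Rightarrow> ('x, 'f) gpoly"
  assumes sys: "homog_system le mul S e" and cod: "has_codim mul S k" and k: "0 < k"
  shows "typical_dim mul S \<le> int (length (cone_degs e (k - 1)))"
proof -
  interpret graded_gpoly_ring le mul
    using sys by (simp add: homog_system_def)
  let ?n = "CARD('x)"
  obtain m p where p: "cone_chain ?n (?n - 1) e p"
      and symbol: "\<forall>\<^sub>F s in sequentially.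
        int (hilbert_fun mul S s) = hilb ?n (1 - (of_nat m * W ^ e + p)) s"
  proof (rule hilbert_fun_symbol)
    show "\<exists>s. h \<in> homog_part s" "ord_at_most e h" if "h \<in> S" for h
      using sys that by (simp_all add: homog_system_def)
  qed (rule that)
  define q where "q = 1 - (of_nat m * W ^ e + p)"
  have q: "k < ?n" "\<And>j. j < k \<Longrightarrow> coeff q j = 0"
    using cod has_codim_iff[OF symbol] by (simp_all add: q_def)
  have n1: "?n - (?n - 1) = 1"
    using k q(1) by simp
  have "Y ^ 1 dvd p"
    using cone_chain_dvd[OF _ p] n1 by simp
  then have "coeff p 0 = 0"
    by (rule coeff_Y_power_dvd) simp
  moreover have "coeff q 0 = 0"
    using q(2) k by simp
  moreover have "coeff q 0 = 1 - int m - coeff p 0"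
    by (simp add: q_def coeff_mult_0 coeff_0_power of_nat_poly)
  ultimately have "m = 1" by simp
  have "1 - W ^ e = Y * W_sum (cone_degs e 0)"
    using Y_geom[of 0 e] W_sum_upt[of 0 e] by simp
  then have q_eq: "q = Y ^ 1 * W_sum (cone_degs e 0) - p"
    using \<open>m = 1\<close> by (simp add: q_def)
  have "typical_dim mul S = coeff q k"
    using typical_dim_eq[OF symbol cod] by (simp add: q_def)
  also have "\<dots> \<le> int (length (cone_degs e (0 + (k - 1))))"
    using cone_chain_coeff_bound[of ?n "?n - 1" e 0 p k] p q k unfolding n1 q_eq by simp
  finally show ?thesis by simp
qed

section \<open>Skew polynomial rings\<close>

text \<open>
  Ties are broken by the lexicographic order on exponent vectors, in which smaller indices weigh
  more.
\<close>

definition deglex :: "'x::{finite, linorder} monomial \<Rightarrow> 'x monomial \<Rightarrow> bool" where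
  "deglex s t \<longleftrightarrow> mono_ord s < mono_ord t \<or> mono_ord s = mono_ord t \<and> s \<le> t"

lemma ranking_deglex: "orderly_ranking (deglex :: 'x::{finite, linorder} monomial \<Rightarrow> 'x monomial \<Rightarrow> bool)"
proof
  show "linear_order_on UNIV {(s, t). deglex s (t :: 'x monomial)}"
    by (auto simp: linear_order_on_def partial_order_on_def preorder_on_def refl_on_def
        trans_def antisym_def total_on_def deglex_def)
  show "deglex 0 t" for t :: "'x monomial"
  proof (cases "t = 0")
    case False
    then obtain x where "lookup t x \<noteq> 0"
      by (metis lookup_zero poly_mapping_eqI)
    then have "0 < mono_ord t"
      by (auto simp: mono_ord_def intro!: sum_pos2[of _ x])
    then show ?thesis
      by (simp add: deglex_def)
  qed (simp add: deglex_def)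
qed (auto simp: deglex_def mono_ord_add)

text \<open>
  The product determined by \<open>x b = \<sigma> b \<cdot> x\<close> for one indeterminate \<open>x\<close>, with all other indeterminates
  commuting with the scalars.
\<close>
definition skew_mul ::
    "('f \<Rightarrow> 'f) \<Rightarrow> 'x \<Rightarrow> ('x::finite, 'f::field) gpoly \<Rightarrow> ('x, 'f) gpoly \<Rightarrow> ('x, 'f) gpoly" where
  "skew_mul \<sigma> x A B = (\<Sum>s\<in>keys A. \<Sum>t\<in>keys B.
     Poly_Mapping.single (s + t) (lookup A s * (\<sigma> ^^ lookup s x) (lookup B t)))"

lemma scale_monom_gp: "scale_gp c (monom_gp t) = Poly_Mapping.single t c"
  by (rule poly_mapping_eqI) (simp add: lookup_monom_gp lookup_single when_def)

lemma scale_single: "scale_gp c (Poly_Mapping.single t b) = Poly_Mapping.single t (c * b)"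
  by (rule poly_mapping_eqI) (simp add: lookup_single when_def)

text \<open>
  Additive identities need only be checked on terms \<open>a \<cdot> t\<close>.
\<close>
lemma gpoly_single_induct:
  assumes "P 0" "\<And>g h. P g \<Longrightarrow> P h \<Longrightarrow> P (g + h)" "\<And>t a. P (Poly_Mapping.single t a)"
  shows "P (g :: ('x, 'f::field) gpoly)"
proof -
  have "P (\<Sum>t\<in>A. Poly_Mapping.single t (lookup g t))" for A
    using assms by (induction A rule: infinite_finite_induct) simp_all
  from this[of "keys g"] show ?thesis
    using gpoly_eq_sum_monom[of "keys g" g] by (simp add: scale_monom_gp)
qed

locale skew_poly =
  fixes \<sigma> :: "'f::field \<Rightarrow> 'f" and x0 :: "'x::{finite, linorder}"
  assumes hom_add: "\<sigma> (a + b) = \<sigma> a + \<sigma> b"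
    and hom_mult: "\<sigma> (a * b) = \<sigma> a * \<sigma> b"
    and hom_one: "\<sigma> 1 = 1"
begin

abbreviation smul :: "('x, 'f) gpoly \<Rightarrow> ('x, 'f) gpoly \<Rightarrow> ('x, 'f) gpoly" where
  "smul \<equiv> skew_mul \<sigma> x0"

lemma hom_zero: "\<sigma> 0 = 0"
  using hom_add[of 0 0] by (metis add.right_neutral add_left_cancel)

lemma hom_eq_0_iff: "\<sigma> a = 0 \<longleftrightarrow> a = 0"
proof
  show "a = 0" if "\<sigma> a = 0"
    using hom_mult[of a "inverse a"] that hom_one by (cases "a = 0") auto
qed (simp add: hom_zero)

lemma funpow_hom:
  "(\<sigma> ^^ k) (a + b) = (\<sigma> ^^ k) a + (\<sigma> ^^ k) b"
  "(\<sigma> ^^ k) (a * b) = (\<sigma> ^^ k) a * (\<sigma> ^^ k) b"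
  "(\<sigma> ^^ k) 1 = 1"
  "(\<sigma> ^^ k) a = 0 \<longleftrightarrow> a = 0"
  by (induction k) (simp_all add: hom_add hom_mult hom_one hom_eq_0_iff)

lemma funpow_hom_zero [simp]: "(\<sigma> ^^ k) 0 = 0"
  by (simp add: funpow_hom)

lemma smul_superset:
  assumes "finite K" "finite L" "keys A \<subseteq> K" "keys B \<subseteq> L"
  shows "smul A B = (\<Sum>s\<in>K. \<Sum>t\<in>L.
     Poly_Mapping.single (s + t) (lookup A s * (\<sigma> ^^ lookup s x0) (lookup B t)))"
proof -
  have "(\<Sum>t\<in>keys B. Poly_Mapping.single (s + t) (lookup A s * (\<sigma> ^^ lookup s x0) (lookup B t)))
      = (\<Sum>t\<in>L. Poly_Mapping.single (s + t) (lookup A s * (\<sigma> ^^ lookup s x0) (lookup B t)))" for s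
    using assms by (intro sum.mono_neutral_left) (auto simp: in_keys_iff)
  then show ?thesis
    unfolding skew_mul_def
    using assms by (simp, intro sum.mono_neutral_left) (auto simp: in_keys_iff)
qed

lemma smul_add_left: "smul (A + B) C = smul A C + smul B C"
proof -
  let ?K = "keys A \<union> keys B"
  have "keys (A + B) \<subseteq> ?K"
    by (rule Poly_Mapping.keys_add)
  then show ?thesis
    using smul_superset[of ?K "keys C" "A + B" C] smul_superset[of ?K "keys C" A C]
      smul_superset[of ?K "keys C" B C]
    by (simp add: lookup_add algebra_simps single_add sum.distrib)
qed

lemma smul_add_right: "smul A (B + C) = smul A B + smul A C"
proof -
  let ?L = "keys B \<union> keys C"
  have "keys (B + C) \<subseteq> ?L"
    by (rule Poly_Mapping.keys_add)
  then show ?thesis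
    using smul_superset[of "keys A" ?L A "B + C"] smul_superset[of "keys A" ?L A B]
      smul_superset[of "keys A" ?L A C]
    by (simp add: lookup_add algebra_simps single_add sum.distrib funpow_hom)
qed

lemma smul_zero_left [simp]: "smul 0 A = 0"
  and smul_zero_right [simp]: "smul A 0 = 0"
  by (simp_all add: skew_mul_def)

lemma smul_single: "smul (Poly_Mapping.single s a) (Poly_Mapping.single t b) =
    Poly_Mapping.single (s + t) (a * (\<sigma> ^^ lookup s x0) b)"
  using smul_superset[of "{s}" "{t}" "Poly_Mapping.single s a" "Poly_Mapping.single t b"]
  by (simp add: lookup_single)

lemma smul_assoc: "smul (smul A B) C = smul A (smul B C)"
proof (induction A rule: gpoly_single_induct)
  case (3 s a)
  show ?case
  proof (induction B rule: gpoly_single_induct)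
    case (3 t b)
    show ?case
      by (induction C rule: gpoly_single_induct)
        (simp_all add: smul_add_right smul_single lookup_add funpow_add funpow_hom algebra_simps)
  qed (simp_all add: smul_add_right smul_add_left)
qed (simp_all add: smul_add_left)

lemma smul_monom_single:
  "smul (monom_gp s) (Poly_Mapping.single t b) = Poly_Mapping.single (s + t) ((\<sigma> ^^ lookup s x0) b)"
  unfolding monom_gp_def smul_single by simp

lemma smul_single_monom:
  "smul (Poly_Mapping.single s a) (monom_gp t) = Poly_Mapping.single (s + t) a"
  unfolding monom_gp_def smul_single by (simp add: funpow_hom)

lemma smul_one_left: "smul (monom_gp 0) A = A"
  by (induction A rule: gpoly_single_induct) (simp_all add: smul_add_right smul_monom_single)

lemma smul_one_right: "smul A (monom_gp 0) = A"
  by (induction A rule: gpoly_single_induct) (simp_all add: smul_add_left smul_single_monom)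

lemma smul_scale: "smul (scale_gp c A) B = scale_gp c (smul A B)"
proof (induction A rule: gpoly_single_induct)
  case (3 s a)
  show ?case
    by (induction B rule: gpoly_single_induct)
      (simp_all add: smul_add_right smul_single scale_single gp.scale_right_distrib mult.assoc)
qed (simp_all add: smul_add_left gp.scale_right_distrib)

lemma smul_monom: "smul (monom_gp s) (monom_gp t) = monom_gp (s + t)"
  using smul_single_monom[of s 1 t] unfolding monom_gp_def .

lemma smul_monom_scale:
  "smul (monom_gp s) (scale_gp c B) = scale_gp ((\<sigma> ^^ lookup s x0) c) (smul (monom_gp s) B)"
  by (induction B rule: gpoly_single_induct)
    (simp_all add: smul_add_right smul_monom_single scale_single gp.scale_right_distrib funpow_hom)

lemma keys_smul: "keys (smul A B) \<subseteq> (\<Union>s\<in>keys A. \<Union>t\<in>keys B. {s + t})"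
  unfolding skew_mul_def
  by (intro order_trans[OF Poly_Mapping.keys_sum] UN_mono order_refl) simp

text \<open>
  Only the two leaders contribute to the product of the leading monomials, and the coefficient
  \<open>a \<cdot> \<sigma>\<^sup>i b\<close> is nonzero because a ring homomorphism between fields is injective.
\<close>
lemma leader_smul:
  fixes A B :: "('x, 'f) gpoly"
  assumes A: "A \<noteq> 0" and B: "B \<noteq> 0"
  shows "smul A B \<noteq> 0 \<and> leader deglex (smul A B) = leader deglex A + leader deglex B"
proof -
  interpret orderly_ranking "deglex :: 'x monomial \<Rightarrow> 'x monomial \<Rightarrow> bool"
    by (rule ranking_deglex)
  define u v where "u = leader deglex A" and "v = leader deglex B"
  have u: "u \<in> keys A" "\<And>s. s \<in> keys A \<Longrightarrow> deglex s u"
    and v: "v \<in> keys B" "\<And>s. s \<in> keys B \<Longrightarrow> deglex s v"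
    using leader_in_keys le_leader A B by (auto simp: u_def v_def)
  have less: "deglex (s + t) (u + v)" and eq: "s + t = u + v \<Longrightarrow> s = u \<and> t = v"
    if "deglex s u" "deglex t v" for s t
  proof -
    have 1: "deglex (t + s) (t + u) \<and> (s \<noteq> u \<longrightarrow> t + s \<noteq> t + u)"
      using strict_mult[OF that(1), of t] by (cases "s = u") (auto simp: le_refl)
    have 2: "deglex (u + t) (u + v) \<and> (t \<noteq> v \<longrightarrow> u + t \<noteq> u + v)"
      using strict_mult[OF that(2), of u] by (cases "t = v") (auto simp: le_refl)
    show "deglex (s + t) (u + v)"
      using 1 2 le_trans by (metis add.commute)
    show "s = u \<and> t = v" if "s + t = u + v"
      using 1 2 le_antisym that by (metis add.commute)
  qed
  have "lookup (smul A B) (u + v) =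
      (\<Sum>s\<in>keys A. \<Sum>t\<in>keys B. if s = u \<and> t = v then lookup A s * (\<sigma> ^^ lookup s x0) (lookup B t) else 0)"
    unfolding skew_mul_def lookup_sum
    using eq u v by (intro sum.cong refl) (auto simp: lookup_single when_def)
  also have "\<dots> = (\<Sum>s\<in>keys A. if s = u then lookup A u * (\<sigma> ^^ lookup u x0) (lookup B v) else 0)"
    using v(1) by (intro sum.cong refl) auto
  also have "\<dots> = lookup A u * (\<sigma> ^^ lookup u x0) (lookup B v)"
    using u(1) by simp
  also have "\<dots> \<noteq> 0"
    using u(1) v(1) by (simp add: in_keys_iff funpow_hom)
  finally have *: "u + v \<in> keys (smul A B)"
    by (simp add: in_keys_iff)
  have "leader deglex (smul A B) = u + v"
    using keys_smul[of A B] u v less by (intro leader_eqI *) blast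
  then show ?thesis
    using * by (auto simp: u_def v_def)
qed

sublocale graded_gpoly_ring "deglex :: 'x monomial \<Rightarrow> 'x monomial \<Rightarrow> bool" smul
proof -
  interpret orderly_ranking "deglex :: 'x monomial \<Rightarrow> 'x monomial \<Rightarrow> bool"
    by (rule ranking_deglex)
  show "graded_gpoly_ring (deglex :: 'x monomial \<Rightarrow> 'x monomial \<Rightarrow> bool) smul"
  proof
    show "smul A B \<in> homog_part (s + r)" if "A \<in> homog_part s" "B \<in> homog_part r" for A B s r
      using keys_smul[of A B] that by (auto simp: homog_part_def mono_ord_add)
  qed (use smul_assoc smul_add_left smul_add_right smul_one_left smul_one_right smul_scale smul_monom
      leader_smul in blast)+
qed

end

section \<open>An extremal system of codimension three\<close>

lemma UNIV_4: "(UNIV :: 4 set) = {0, 1, 2, 3}"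
  by (rule card_subset_eq[symmetric]) simp_all

lemma cases_4: "(i :: 4) = 0 \<or> i = 1 \<or> i = 2 \<or> i = 3"
  using UNIV_4 by auto

lemma less_4: "\<not> (i :: 4) < 0" "(i :: 4) < 1 \<Longrightarrow> i = 0"
  using cases_4[of i]
  by (auto simp: less_bit0_def bit0.Rep_0 bit0.Rep_1 bit0.Rep_numeral)

text \<open>
  The indices \<open>0, 1, 2, 3\<close> of type \<open>4\<close> stand for \<open>x\<^sub>1, x\<^sub>2, x\<^sub>3, x\<^sub>4\<close>.
\<close>
definition mexp :: "nat \<Rightarrow> nat \<Rightarrow> nat \<Rightarrow> nat \<Rightarrow> 4 monomial" where
  "mexp a b c d = Poly_Mapping.single 0 a + Poly_Mapping.single 1 b
     + Poly_Mapping.single 2 c + Poly_Mapping.single 3 d"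

lemma lookup_mexp [simp]:
  "lookup (mexp a b c d) 0 = a" "lookup (mexp a b c d) 1 = b"
  "lookup (mexp a b c d) 2 = c" "lookup (mexp a b c d) 3 = d"
  by (simp_all add: mexp_def lookup_add lookup_single)

lemma mexp_eqI:
  "lookup t 0 = a \<Longrightarrow> lookup t 1 = b \<Longrightarrow> lookup t 2 = c \<Longrightarrow> lookup t 3 = d \<Longrightarrow> t = mexp a b c d"
  by (rule poly_mapping_eqI) (metis cases_4 lookup_mexp)

lemma mexp_inject: "mexp a b c d = mexp a' b' c' d' \<longleftrightarrow> a = a' \<and> b = b' \<and> c = c' \<and> d = d'"
  by (metis lookup_mexp)

lemma mexp_add: "mexp a b c d + mexp a' b' c' d' = mexp (a + a') (b + b') (c + c') (d + d')"
  by (rule mexp_eqI) (simp_all add: lookup_add)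

lemma mono_ord_mexp: "mono_ord (mexp a b c d) = a + b + c + d"
  by (simp add: mexp_def mono_ord_add)

lemma mexp_less_0: "a < a' \<Longrightarrow> mexp a b c d < mexp a' b' c' d'"
  unfolding less_poly_mapping.rep_eq less_fun_def
  by (intro exI[of _ 0]) (auto simp: less_4)

lemma mexp_less_1: "b < b' \<Longrightarrow> mexp a b c d < mexp a b' c' d'"
  unfolding less_poly_mapping.rep_eq less_fun_def
  by (intro exI[of _ 1]) (auto dest!: less_4(2))

text \<open>
  The construction works over any field of characteristic \<open>0\<close> with an endomorphism \<open>\<sigma>\<close> and a nonzero
  element \<open>\<theta>\<close> such that \<open>\<sigma> \<theta> = 2 \<theta>\<close>.
\<close>
locale extremal_example = skew_poly \<sigma> "0 :: 4"
  for \<sigma> :: "'f::field_char_0 \<Rightarrow> 'f" +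
  fixes \<theta> :: 'f and e :: nat
  assumes hom_gen: "\<sigma> \<theta> = 2 * \<theta>" and gen_nz: "\<theta> \<noteq> 0" and e_pos: "0 < e"
begin

abbreviation mon :: "nat \<Rightarrow> nat \<Rightarrow> nat \<Rightarrow> nat \<Rightarrow> (4, 'f) gpoly" where
  "mon a b c d \<equiv> monom_gp (mexp a b c d)"

lemma mon_mult: "smul (mon a b c d) (mon a' b' c' d') = mon (a + a') (b + b') (c + c') (d + d')"
  by (simp add: smul_monom mexp_add)

lemma mon_mult_assoc:
  "smul (mon a b c d) (smul (mon a' b' c' d') A) = smul (mon (a + a') (b + b') (c + c') (d + d')) A"
  by (simp add: smul_assoc[symmetric] mon_mult)

lemma hom_of_nat: "\<sigma> (of_nat n) = of_nat n"
  by (induction n) (simp_all add: hom_zero hom_add hom_one)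

lemma smul_mon_scale: "smul (mon 0 b c d) (scale_gp r B) = scale_gp r (smul (mon 0 b c d) B)"
  by (simp add: smul_monom_scale)

text \<open>
  The product of the \<open>x\<^sub>1 - 2\<^sup>i x\<^sub>3\<close> for \<open>i < a\<close>. In the representation with \<open>x\<^sub>1 = \<sigma>\<close> and \<open>x\<^sub>3 = 1\<close> it
  annihilates \<open>1, \<theta>, \<dots>, \<theta>\<^bsup>a-1\<^esup>\<close>; multiplication by \<open>\<theta>\<close> maps these to \<open>\<theta>, \<dots>, \<theta>\<^sup>a\<close>, which differ
  by a single new power. This is why \<open>falling a\<close> and \<open>\<theta>\<close> almost commute.
\<close>
primrec falling :: "nat \<Rightarrow> (4, 'f) gpoly" where
  "falling 0 = mon 0 0 0 0"
| "falling (Suc a) = smul (mon (Suc 0) 0 0 0) (falling a)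
     - scale_gp (of_nat (2 ^ a)) (smul (mon 0 0 (Suc 0) 0) (falling a))"

lemma mexp_zero: "mexp 0 0 0 0 = 0"
  by (simp add: mexp_def)

lemma falling_commute: "smul (falling a) (mon 0 b c d) = smul (mon 0 b c d) (falling a)"
proof (induction a)
  case 0
  show ?case by (simp add: mon_mult)
next
  case (Suc a)
  then show ?case
    by (simp add: mul_diff_left mul_diff_right smul_scale smul_mon_scale smul_assoc mon_mult_assoc)
qed

text \<open>
  Together the \<open>basis_elt a b c d\<close> form an \<open>F\<close>-basis of the ring that is better adapted to the
  ideal than the monomials, and triangular with respect to them.
\<close>
definition basis_elt :: "nat \<Rightarrow> nat \<Rightarrow> nat \<Rightarrow> nat \<Rightarrow> (4, 'f) gpoly" where
  "basis_elt a b c d = smul (mon 0 b c d) (falling a)"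

lemma mon_mult_basis_elt:
  "smul (mon 0 b c d) (basis_elt a b' c' d') = basis_elt a (b + b') (c + c') (d + d')"
  by (simp add: basis_elt_def mon_mult_assoc)

lemma mon_0_mult_basis_elt:
  "smul (mon (Suc 0) 0 0 0) (basis_elt a b c d) =
     basis_elt (Suc a) b c d + scale_gp (of_nat (2 ^ a)) (basis_elt a b (Suc c) d)"
  by (simp add: basis_elt_def mul_diff_right smul_mon_scale mon_mult_assoc)

lemma leader_falling: "falling a \<noteq> 0 \<and> leader deglex (falling a) = mexp a 0 0 0"
proof (induction a)
  case 0
  show ?case
    by (metis falling.simps(1) keys_monom_gp keys_zero insert_not_empty leader_monom_gp)
next
  case (Suc a)
  have mon_nz: "mon a b c d \<noteq> 0" for a b c d
    by (metis keys_monom_gp keys_zero insert_not_empty)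
  have 1: "smul (mon (Suc 0) 0 0 0) (falling a) \<noteq> 0"
      "leader deglex (smul (mon (Suc 0) 0 0 0) (falling a)) = mexp (Suc a) 0 0 0"
    and 2: "leader deglex (smul (mon 0 0 (Suc 0) 0) (falling a)) = mexp a 0 (Suc 0) 0"
    using leader_mul[OF mon_nz, of "falling a"] Suc by (simp_all add: mexp_add)
  have 3: "leader deglex (scale_gp (of_nat (2 ^ a)) (smul (mon 0 0 (Suc 0) 0) (falling a))) = mexp a 0 (Suc 0) 0"
    using 2 by (simp add: leader_scale del: of_nat_power)
  show ?case
    unfolding falling.simps 1(2)[symmetric]
    by (rule leader_diff[OF 1(1)])
      (simp_all add: 1(2) 3 deglex_def mono_ord_mexp mexp_inject mexp_less_0 less_imp_le del: of_nat_power)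
qed


text \<open>
  The coefficient by which \<open>falling a\<close> fails to commute with \<open>\<theta>\<close>. In closed form,
  \<open>gap (a + 1) = 2\<^sup>a (2\<^bsup>a+1\<^esup> - 1)\<close>; what matters is that it is nonzero.
\<close>
primrec gap :: "nat \<Rightarrow> nat" where
  "gap 0 = 0"
| "gap (Suc a) = 4 ^ a + 2 * gap a"

lemma mon_0_mult: "smul (mon 0 0 0 0) A = A"
  by (simp add: mexp_zero smul_one_left)

text \<open>
  Moving \<open>\<theta>\<close> to the left past \<open>falling a\<close> multiplies it by \<open>2\<^sup>a\<close>, up to a correction in which one
  factor of the product has been replaced by \<open>x\<^sub>3\<close>.
\<close>
lemma falling_scale_gen:
  "smul (falling a) (scale_gp \<theta> Z) = scale_gp (of_nat (2 ^ a) * \<theta>) (smul (falling a) Z)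
     + scale_gp (of_nat (gap a) * \<theta>) (smul (mon 0 0 (Suc 0) 0) (smul (falling (a - 1)) Z))"
proof (induction a)
  case 0
  show ?case by (simp add: mon_0_mult)
next
  case (Suc a)
  define u where "u b = smul (falling b) Z" for b
  define w where "w b = smul (mon 0 0 (Suc 0) 0) (u b)" for b
  define v where "v b = smul (mon 0 0 (Suc 0) 0) (w b)" for b
  have X0u: "smul (mon (Suc 0) 0 0 0) (u b) = u (Suc b) + scale_gp (of_nat (2 ^ b)) (w b)" for b
    by (simp add: u_def w_def mul_diff_left smul_scale smul_assoc del: of_nat_power)
  have X0w: "smul (mon (Suc 0) 0 0 0) (w b) = w (Suc b) + scale_gp (of_nat (2 ^ b)) (v b)" for b
  proof -
    have "smul (mon (Suc 0) 0 0 0) (w b) = smul (mon 0 0 (Suc 0) 0) (smul (mon (Suc 0) 0 0 0) (u b))"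
      by (simp add: w_def mon_mult_assoc)
    then show ?thesis
      by (simp add: X0u smul_add_right smul_mon_scale v_def w_def del: of_nat_power)
  qed
  have scale0: "smul (mon (Suc 0) 0 0 0) (scale_gp (of_nat m * \<theta>) A)
      = scale_gp (of_nat m * (2 * \<theta>)) (smul (mon (Suc 0) 0 0 0) A)" for m A
    by (simp add: smul_monom_scale hom_mult hom_of_nat hom_gen)
  have IH: "smul (falling a) (scale_gp \<theta> Z) =
      scale_gp (of_nat (2 ^ a) * \<theta>) (u a) + scale_gp (of_nat (gap a) * \<theta>) (w (a - 1))"
    using Suc by (simp only: u_def w_def)
  have "smul (falling (Suc a)) (scale_gp \<theta> Z) = smul (mon (Suc 0) 0 0 0) (smul (falling a) (scale_gp \<theta> Z))
      - scale_gp (of_nat (2 ^ a)) (smul (mon 0 0 (Suc 0) 0) (smul (falling a) (scale_gp \<theta> Z)))"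
    by (simp add: mul_diff_left smul_scale smul_assoc del: of_nat_power)
  also have "\<dots> = scale_gp (of_nat (2 ^ a) * (2 * \<theta>)) (u (Suc a) + scale_gp (of_nat (2 ^ a)) (w a))
      + scale_gp (of_nat (gap a) * (2 * \<theta>)) (smul (mon (Suc 0) 0 0 0) (w (a - 1)))
      - scale_gp (of_nat (2 ^ a)) (scale_gp (of_nat (2 ^ a) * \<theta>) (w a)
          + scale_gp (of_nat (gap a) * \<theta>) (v (a - 1)))"
    unfolding IH by (simp only: smul_add_right scale0 smul_mon_scale X0u w_def[symmetric] v_def[symmetric])
  also have "\<dots> = scale_gp (of_nat (2 ^ Suc a) * \<theta>) (u (Suc a)) + scale_gp (of_nat (gap (Suc a)) * \<theta>) (w a)"
  proof (cases a)
    case 0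
    then show ?thesis
      by (intro poly_mapping_eqI) (simp add: lookup_add lookup_minus algebra_simps)
  next
    case (Suc b)
    have "(4 :: 'f) ^ b = 2 ^ b * 2 ^ b"
      by (simp flip: power_mult_distrib)
    then show ?thesis
      unfolding Suc diff_Suc_1 X0w
      by (intro poly_mapping_eqI) (simp add: lookup_add lookup_minus algebra_simps)
  qed
  finally show ?case
    by (simp only: u_def w_def diff_Suc_1)
qed

definition eq1 :: "(4, 'f) gpoly" where
  "eq1 = falling e"

definition eq2 :: "(4, 'f) gpoly" where
  "eq2 = mon 0 e 0 0 - scale_gp \<theta> (mon 0 0 e 0)"

text \<open>
  Read modulo the ideal, this relation trades \<open>x\<^sub>2\<^sup>e\<close> for \<open>\<theta> x\<^sub>3\<^sup>e\<close>, and whenever \<open>falling a\<close> times a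
  power of \<open>x\<^sub>3\<close> lies in the ideal, so does \<open>falling (a - 1)\<close> times that power increased by \<open>e + 1\<close>.
\<close>
lemma basis_elt_mult_eq2:
  "smul (basis_elt a b c d) eq2 = basis_elt a (b + e) c d
     - scale_gp (of_nat (2 ^ a) * \<theta>) (basis_elt a b (c + e) d)
     - scale_gp (of_nat (gap a) * \<theta>) (basis_elt (a - 1) b (c + e + 1) d)"
proof -
  have "smul (basis_elt a b c d) eq2 = smul (mon 0 b c d)
      (smul (falling a) (mon 0 e 0 0) - smul (falling a) (scale_gp \<theta> (mon 0 0 e 0)))"
    by (simp add: basis_elt_def eq2_def smul_assoc mul_diff_right)
  then show ?thesis
    by (simp add: falling_scale_gen falling_commute mul_diff_right smul_add_right smul_mon_scale
        mon_mult_assoc del: of_nat_power) (simp add: basis_elt_def algebra_simps)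
qed

text \<open>
  The least power of \<open>x\<^sub>3\<close> whose product with \<open>falling a\<close> lies in the ideal.
\<close>
definition height :: "nat \<Rightarrow> nat" where
  "height a = (e - a) * (e + 1)"

lemma height_Suc_le: "height a \<le> height (Suc a) + (e + 1)"
proof -
  have "height a \<le> (e - Suc a + 1) * (e + 1)"
    unfolding height_def by (intro mult_right_mono) auto
  then show ?thesis
    by (simp add: height_def)
qed

lemma height_Suc: "a < e \<Longrightarrow> height a = height (Suc a) + (e + 1)"
proof -
  assume "a < e"
  then have "e - a = e - Suc a + 1" by simp
  then show ?thesis
    by (simp add: height_def)
qed

lemma height_antimono: "height (Suc a) \<le> height a"
  unfolding height_def by (intro mult_right_mono) auto

lemma height_pos: "0 < height a \<longleftrightarrow> a < e"
  by (auto simp: height_def)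

text \<open>
  The exponents of the leaders of the ideal; \<open>ideal_elt\<close> below realizes each of them.
\<close>
definition lead_ideal :: "(nat \<times> nat \<times> nat \<times> nat) set" where
  "lead_ideal = {(a, b, c, d). e \<le> b \<or> height a \<le> c}"

definition ideal_elt :: "nat \<times> nat \<times> nat \<times> nat \<Rightarrow> (4, 'f) gpoly" where
  "ideal_elt = (\<lambda>(a, b, c, d). if e \<le> b then smul (basis_elt a (b - e) c d) eq2 else basis_elt a b c d)"

lemma leader_basis_elt:
  "basis_elt a b c d \<noteq> 0" "leader deglex (basis_elt a b c d) = mexp a b c d"
proof -
  have "mon 0 b c d \<noteq> 0"
    by (metis keys_monom_gp keys_zero insert_not_empty)
  then show "basis_elt a b c d \<noteq> 0" "leader deglex (basis_elt a b c d) = mexp a b c d"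
    unfolding basis_elt_def using leader_mul[of "mon 0 b c d" "falling a"] leader_falling[of a]
    by (simp_all add: mexp_add)
qed

lemma leader_eq2: "eq2 \<noteq> 0" "leader deglex eq2 = mexp 0 e 0 0"
proof -
  have nz: "mon 0 e 0 0 \<noteq> 0"
    by (metis keys_monom_gp keys_zero insert_not_empty)
  have "deglex (mexp 0 0 e 0) (mexp 0 e 0 0)" "mexp 0 0 e 0 \<noteq> mexp 0 e 0 0"
    using e_pos by (auto simp: deglex_def mono_ord_mexp mexp_inject mexp_less_1 less_imp_le)
  then show "eq2 \<noteq> 0" "leader deglex eq2 = mexp 0 e 0 0"
    unfolding eq2_def using leader_diff[OF nz, of "scale_gp \<theta> (mon 0 0 e 0)"]
    by (simp_all add: leader_scale gen_nz)
qed

lemma leader_ideal_elt: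
  "ideal_elt (a, b, c, d) \<noteq> 0" "leader deglex (ideal_elt (a, b, c, d)) = mexp a b c d"
  using leader_mul[OF leader_basis_elt(1) leader_eq2(1), of a "b - e" c d]
    leader_basis_elt[of a "b - e" c d] leader_basis_elt[of a b c d] leader_eq2(2)
  by (auto simp: ideal_elt_def mexp_add)

definition eqs_ideal :: "(4, 'f) gpoly set" where
  "eqs_ideal = left_ideal_gp smul hull {eq1, eq2}"

lemma left_ideal_eqs_ideal: "left_ideal_gp smul eqs_ideal"
  unfolding eqs_ideal_def by (rule left_ideal_hull)

lemma subspace_eqs_ideal: "gp.subspace eqs_ideal"
  using left_ideal_eqs_ideal by (rule subspace_left_ideal)

lemma smul_eqs_ideal: "g \<in> eqs_ideal \<Longrightarrow> smul A g \<in> eqs_ideal"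
  using left_ideal_eqs_ideal by (simp add: left_ideal_gp_def)

text \<open>
  Starting from \<open>falling e\<close>, the relation \<open>basis_elt_mult_eq2\<close> is applied downwards in \<open>a\<close>; the gap is
  inverted in \<open>F\<close>.
\<close>
lemma basis_elt_in_eqs_ideal: "height a \<le> c \<Longrightarrow> basis_elt a b c d \<in> eqs_ideal"
proof (induction "e - a" arbitrary: a b c)
  case 0
  have "falling (e + i) \<in> eqs_ideal" for i
  proof (induction i)
    case 0
    show ?case
      unfolding eqs_ideal_def by (rule hull_inc) (simp add: eq1_def)
  next
    case (Suc i)
    then show ?case
      by (simp add: gp.subspace_diff[OF subspace_eqs_ideal] gp.subspace_scale[OF subspace_eqs_ideal]
          smul_eqs_ideal del: of_nat_power)
  qed
  from this[of "a - e"] show ?case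
    using 0 by (simp add: basis_elt_def smul_eqs_ideal)
next
  case (Suc k)
  define c' where "c' = c - (e + 1)"
  have "height (Suc a) + (e + 1) \<le> c"
    using Suc.hyps(2) Suc.prems height_Suc[of a] by simp
  then have c: "c = c' + e + 1" and c': "height (Suc a) \<le> c'"
    by (simp_all add: c'_def)
  have "eq2 \<in> eqs_ideal"
    unfolding eqs_ideal_def by (rule hull_inc) simp
  then have "smul (basis_elt (Suc a) b c' d) eq2 \<in> eqs_ideal"
    by (rule smul_eqs_ideal)
  moreover have "basis_elt (Suc a) (b + e) c' d \<in> eqs_ideal" "basis_elt (Suc a) b (c' + e) d \<in> eqs_ideal"
    using Suc.hyps c' by (auto intro!: Suc.hyps(1))
  ultimately have "basis_elt (Suc a) (b + e) c' d
      - scale_gp (of_nat (2 ^ Suc a) * \<theta>) (basis_elt (Suc a) b (c' + e) d)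
      - smul (basis_elt (Suc a) b c' d) eq2 \<in> eqs_ideal"
    by (intro gp.subspace_diff gp.subspace_scale subspace_eqs_ideal)
  then have "scale_gp (of_nat (gap (Suc a)) * \<theta>) (basis_elt a b c d) \<in> eqs_ideal"
    unfolding basis_elt_mult_eq2 c by simp
  then have "scale_gp (inverse (of_nat (gap (Suc a)) * \<theta>))
      (scale_gp (of_nat (gap (Suc a)) * \<theta>) (basis_elt a b c d)) \<in> eqs_ideal"
    by (rule gp.subspace_scale[OF subspace_eqs_ideal])
  moreover have "inverse (of_nat (gap (Suc a)) * \<theta>) * (of_nat (gap (Suc a)) * \<theta>) = 1"
    using gen_nz by (intro left_inverse) (simp del: of_nat_add)
  ultimately show ?case
    by (simp only: gp.scale_scale gp.scale_one)
qed

lemma ideal_elt_in_eqs_ideal: "i \<in> lead_ideal \<Longrightarrow> ideal_elt i \<in> eqs_ideal"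
proof -
  assume "i \<in> lead_ideal"
  moreover have "eq2 \<in> eqs_ideal"
    unfolding eqs_ideal_def by (rule hull_inc) simp
  ultimately show ?thesis
    by (auto simp: ideal_elt_def lead_ideal_def intro: smul_eqs_ideal basis_elt_in_eqs_ideal)
qed

text \<open>
  The ideal is described from above by an \<open>F\<close>-span of elements with distinct leaders. Since it turns
  out to be a left ideal containing both equations, no further leaders can occur.
\<close>
definition ideal_span :: "(4, 'f) gpoly set" where
  "ideal_span = gp.span (ideal_elt ` lead_ideal)"

text \<open>
  By induction on \<open>b\<close>: the relation \<open>basis_elt_mult_eq2\<close> rewrites \<open>x\<^sub>2\<^sup>e\<close> without leaving the range of
  exponents, because \<open>height\<close> grows by at most \<open>e + 1\<close> when \<open>a\<close> decreases by one.
\<close>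
lemma basis_elt_in_ideal_span: "height a \<le> c \<Longrightarrow> basis_elt a b c d \<in> ideal_span"
proof (induction b arbitrary: a c rule: less_induct)
  case (less b)
  have elt: "ideal_elt (a, b, c, d) \<in> ideal_span"
    unfolding ideal_span_def using less.prems by (intro gp.span_base) (simp add: lead_ideal_def)
  show ?case
  proof (cases "e \<le> b")
    case True
    then have b: "b - e < b"
      using e_pos by simp
    have 1: "basis_elt a (b - e) (c + e) d \<in> ideal_span"
      using b less.prems by (intro less.IH) auto
    have 2: "scale_gp (of_nat (gap a) * \<theta>) (basis_elt (a - 1) (b - e) (c + e + 1) d) \<in> ideal_span"
    proof (cases a)
      case 0
      then show ?thesis
        by (simp add: ideal_span_def gp.span_zero)
    next
      case (Suc a')
      have "height a' \<le> c + e + 1"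
        using height_Suc_le[of a'] less.prems by (simp add: Suc)
      then have "basis_elt a' (b - e) (c + e + 1) d \<in> ideal_span"
        using b by (intro less.IH)
      then show ?thesis
        unfolding Suc ideal_span_def by (simp only: diff_Suc_1 gp.span_scale)
    qed
    have "basis_elt a b c d = ideal_elt (a, b, c, d)
        + scale_gp (of_nat (2 ^ a) * \<theta>) (basis_elt a (b - e) (c + e) d)
        + scale_gp (of_nat (gap a) * \<theta>) (basis_elt (a - 1) (b - e) (c + e + 1) d)"
      using True by (simp add: ideal_elt_def basis_elt_mult_eq2 del: of_nat_power)
    then show ?thesis
      using elt 1 2 unfolding ideal_span_def by (simp only: gp.span_add gp.span_scale)
  next
    case False
    then show ?thesis
      using elt by (simp add: ideal_elt_def)
  qed
qed

lemma mult_eq2_in_ideal_span: "smul (basis_elt a b c d) eq2 \<in> ideal_span"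
proof -
  have "ideal_elt (a, b + e, c, d) \<in> ideal_span"
    unfolding ideal_span_def by (intro gp.span_base) (simp add: lead_ideal_def)
  then show ?thesis
    by (simp add: ideal_elt_def)
qed


lemma subspace_ideal_span: "gp.subspace ideal_span"
  by (simp add: ideal_span_def)

text \<open>
  Left multiplication by a monomial is only semilinear, so the scalars of a combination are replaced
  by their images under a power of \<open>\<sigma>\<close>.
\<close>
lemma smul_monom_ideal_span:
  assumes "\<And>i. i \<in> lead_ideal \<Longrightarrow> smul (monom_gp t) (ideal_elt i) \<in> ideal_span"
    and "g \<in> ideal_span"
  shows "smul (monom_gp t) g \<in> ideal_span"
  using assms(2) unfolding ideal_span_def
proof (induction rule: gp.span_induct_alt)
  case (step c x y)
  then have "scale_gp ((\<sigma> ^^ lookup t 0) c) (smul (monom_gp t) x) + smul (monom_gp t) y \<in> ideal_span"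
    using assms(1) unfolding ideal_span_def[symmetric]
    by (intro gp.subspace_add gp.subspace_scale subspace_ideal_span) auto
  then show ?case
    by (simp add: smul_add_right smul_monom_scale ideal_span_def)
qed (simp add: gp.span_zero)

lemma left_ideal_ideal_span: "left_ideal_gp smul ideal_span"
proof -
  have 1: "smul (mon 0 b c d) g \<in> ideal_span" if "g \<in> ideal_span" for b c d g
  proof (rule smul_monom_ideal_span[OF _ that])
    fix i assume i: "i \<in> lead_ideal"
    obtain a' b' c' d' where abcd: "i = (a', b', c', d')"
      by (cases i) auto
    show "smul (mon 0 b c d) (ideal_elt i) \<in> ideal_span"
      using i unfolding abcd lead_ideal_def ideal_elt_def
      by (cases "e \<le> b'") (simp_all add: smul_assoc[symmetric] mon_mult_basis_elt
          mult_eq2_in_ideal_span basis_elt_in_ideal_span)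
  qed
  have 2: "smul (mon (Suc 0) 0 0 0) g \<in> ideal_span" if "g \<in> ideal_span" for g
  proof (rule smul_monom_ideal_span[OF _ that])
    fix i assume i: "i \<in> lead_ideal"
    obtain a b c d where abcd: "i = (a, b, c, d)"
      by (cases i) auto
    show "smul (mon (Suc 0) 0 0 0) (ideal_elt i) \<in> ideal_span"
    proof (cases "e \<le> b")
      case True
      then show ?thesis
        unfolding abcd ideal_elt_def
        by (simp add: smul_assoc[symmetric] mon_0_mult_basis_elt[unfolded One_nat_def] smul_add_left smul_scale
            gp.subspace_add[OF subspace_ideal_span] gp.subspace_scale[OF subspace_ideal_span]
            mult_eq2_in_ideal_span del: of_nat_power)
    next
      case False
      then have c: "height a \<le> c"
        using i by (simp add: abcd lead_ideal_def)
      then have "basis_elt (Suc a) b c d \<in> ideal_span" "basis_elt a b (Suc c) d \<in> ideal_span"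
        using height_antimono[of a] by (auto intro!: basis_elt_in_ideal_span)
      then show ?thesis
        using False unfolding abcd ideal_elt_def
        by (simp add: mon_0_mult_basis_elt[unfolded One_nat_def] gp.subspace_add[OF subspace_ideal_span]
            gp.subspace_scale[OF subspace_ideal_span] del: of_nat_power)
    qed
  qed
  have mon_closed: "smul (mon a b c d) g \<in> ideal_span" if "g \<in> ideal_span" for a b c d g
  proof (induction a)
    case (Suc a)
    have "smul (mon (Suc a) b c d) g = smul (mon (Suc 0) 0 0 0) (smul (mon a b c d) g)"
      by (simp add: mon_mult_assoc)
    then show ?case
      using 2 Suc by simp
  qed (use 1 that in simp)
  have "smul A g \<in> ideal_span" if "g \<in> ideal_span" for A g
  proof (induction A rule: gpoly_single_induct)
    case (3 t a)
    have "t = mexp (lookup t 0) (lookup t 1) (lookup t 2) (lookup t 3)"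
      by (rule mexp_eqI) simp_all
    then have "smul (monom_gp t) g \<in> ideal_span"
      using mon_closed[OF that] by metis
    then show ?case
      unfolding scale_monom_gp[symmetric] smul_scale by (rule gp.subspace_scale[OF subspace_ideal_span])
  qed (simp_all add: smul_add_left gp.subspace_0[OF subspace_ideal_span] gp.subspace_add[OF subspace_ideal_span])
  then show ?thesis
    unfolding left_ideal_gp_def
    using gp.subspace_0[OF subspace_ideal_span] gp.subspace_add[OF subspace_ideal_span] by blast
qed

lemma eqs_ideal_eq: "eqs_ideal = ideal_span"
proof
  have "basis_elt e 0 0 0 = eq1"
    by (simp add: basis_elt_def eq1_def mon_0_mult)
  moreover have "smul (basis_elt 0 0 0 0) eq2 = eq2"
    by (simp add: basis_elt_def mon_0_mult)
  ultimately have "{eq1, eq2} \<subseteq> ideal_span"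
    using basis_elt_in_ideal_span[of e 0 0 0] mult_eq2_in_ideal_span[of 0 0 0 0]
    by (simp add: height_def)
  then show "eqs_ideal \<subseteq> ideal_span"
    unfolding eqs_ideal_def by (rule hull_minimal) (rule left_ideal_ideal_span)
  show "ideal_span \<subseteq> eqs_ideal"
    unfolding ideal_span_def
    by (rule gp.span_minimal[OF _ subspace_eqs_ideal]) (auto intro: ideal_elt_in_eqs_ideal)
qed

lemma mon_homog: "mon a b c d \<in> homog_part (a + b + c + d)"
  by (simp add: monom_gp_in_homog_part mono_ord_mexp)

lemma falling_homog: "falling a \<in> homog_part a"
proof (induction a)
  case (Suc a)
  have "smul (mon (Suc 0) 0 0 0) (falling a) \<in> homog_part (Suc a)"
    "smul (mon 0 0 (Suc 0) 0) (falling a) \<in> homog_part (Suc a)"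
    using graded[OF mon_homog Suc, of "Suc 0" 0 0 0] graded[OF mon_homog Suc, of 0 0 "Suc 0" 0] by simp_all
  then show ?case
    unfolding falling.simps
    by (intro gp.subspace_diff gp.subspace_scale subspace_homog_part)
qed (use mon_homog[of 0 0 0 0] in simp)

lemma basis_elt_homog: "basis_elt a b c d \<in> homog_part (a + b + c + d)"
  using graded[OF mon_homog[of 0 b c d] falling_homog[of a]] by (simp add: basis_elt_def add_ac)

lemma eq2_homog: "eq2 \<in> homog_part e"
  unfolding eq2_def using mon_homog[of 0 e 0 0] mon_homog[of 0 0 e 0]
  by (intro gp.subspace_diff gp.subspace_scale subspace_homog_part) simp_all

lemma ideal_elt_homog: "ideal_elt (a, b, c, d) \<in> homog_part (a + b + c + d)"
  using graded[OF basis_elt_homog[of a "b - e" c d] eq2_homog] basis_elt_homog[of a b c d]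
  by (auto simp: ideal_elt_def add_ac)

lemma leaders_eqs_ideal:
  "leaders (eqs_ideal \<inter> homog_part s) =
     {mexp a b c d |a b c d. (a, b, c, d) \<in> lead_ideal \<and> a + b + c + d = s}"
proof (intro set_eqI iffI)
  fix t assume "t \<in> leaders (eqs_ideal \<inter> homog_part s)"
  then obtain g where g: "g \<in> ideal_span" "g \<in> homog_part s" "g \<noteq> 0" "t = leader deglex g"
    by (auto simp: leaders_def eqs_ideal_eq)
  have "inj_on (leader deglex) (ideal_elt ` lead_ideal)"
    by (rule inj_onI) (auto simp: leader_ideal_elt mexp_inject)
  then have "t \<in> leader deglex ` (ideal_elt ` lead_ideal)"
    unfolding g(4) using g(1,3) unfolding ideal_span_def
    by (intro leader_in_span) (auto simp: leader_ideal_elt)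
  then obtain a b c d where abcd: "(a, b, c, d) \<in> lead_ideal" "t = mexp a b c d"
    by (auto simp: leader_ideal_elt)
  moreover have "mono_ord t = s"
    using leader_in_keys[OF g(3)] g(2,4) by (simp add: homog_part_def)
  ultimately show "t \<in> {mexp a b c d |a b c d. (a, b, c, d) \<in> lead_ideal \<and> a + b + c + d = s}"
    by (auto simp: mono_ord_mexp)
next
  fix t assume "t \<in> {mexp a b c d |a b c d. (a, b, c, d) \<in> lead_ideal \<and> a + b + c + d = s}"
  then obtain a b c d where abcd: "t = mexp a b c d" "(a, b, c, d) \<in> lead_ideal" "a + b + c + d = s"
    by blast
  then have "ideal_elt (a, b, c, d) \<in> eqs_ideal \<inter> homog_part s"
    using ideal_elt_in_eqs_ideal ideal_elt_homog by blast
  then show "t \<in> leaders (eqs_ideal \<inter> homog_part s)"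
    unfolding leaders_def abcd(1)
    by (intro image_eqI[of _ _ "ideal_elt (a, b, c, d)"]) (simp_all add: leader_ideal_elt)
qed

text \<open>
  The exponents of \<open>x\<^sub>1, x\<^sub>2, x\<^sub>3\<close> in the monomials that are not leaders; the exponent of \<open>x\<^sub>4\<close> is free,
  hence determined by the order.
\<close>

definition standard_exps :: "(nat \<times> nat \<times> nat) set" where
  "standard_exps = (SIGMA a : {..<e}. {..<e} \<times> {..<height a})"

lemma card_standard_exps: "2 * card standard_exps = e\<^sup>2 * (e + 1)\<^sup>2"
proof -
  have "card standard_exps = (\<Sum>a<e. e * ((e - a) * (e + 1)))"
    by (simp add: standard_exps_def height_def)
  also have "\<dots> = e * (e + 1) * (\<Sum>a<e. e - a)"
    by (simp add: sum_distrib_left algebra_simps)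
  also have "(\<Sum>a<e. e - a) = (\<Sum>a<e. Suc a)"
    by (rule sum.reindex_bij_witness[of _ "\<lambda>a. e - Suc a" "\<lambda>a. e - Suc a"]) auto
  also have "2 * (e * (e + 1) * (\<Sum>a<e. Suc a)) = e * (e + 1) * (e * (e + 1))"
  proof -
    have "2 * (\<Sum>a<n. Suc a) = n * (n + 1)" for n
      by (induction n) simp_all
    from this[of e] show ?thesis by (simp add: algebra_simps)
  qed
  finally show ?thesis
    by (simp add: power2_eq_square algebra_simps)
qed

lemma hilbert_fun_eqs:
  assumes s: "2 * e + e * (e + 1) \<le> s"
  shows "hilbert_fun smul {eq1, eq2} s = card standard_exps"
proof -
  let ?f = "\<lambda>(a, b, c). mexp a b c (s - (a + b + c))"
  have le_s: "a + b + c \<le> s" if "(a, b, c) \<in> standard_exps" for a b c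
  proof -
    have "c < height a" "a < e" "b < e"
      using that by (auto simp: standard_exps_def)
    moreover have "height a \<le> e * (e + 1)"
      unfolding height_def by (intro mult_right_mono) auto
    ultimately show ?thesis
      using s by linarith
  qed
  have "{t. mono_ord t = s} - leaders (eqs_ideal \<inter> homog_part s) = ?f ` standard_exps"
  proof (intro set_eqI iffI)
    fix t assume t: "t \<in> {t. mono_ord t = s} - leaders (eqs_ideal \<inter> homog_part s)"
    define a b c d where "a = lookup t 0" and "b = lookup t 1" and "c = lookup t 2" and "d = lookup t 3"
    have t_eq: "t = mexp a b c d"
      by (rule mexp_eqI) (simp_all add: a_def b_def c_def d_def)
    then have sum: "a + b + c + d = s"
      using t by (simp add: mono_ord_mexp)
    then have "(a, b, c, d) \<notin> lead_ideal"
      using t unfolding t_eq leaders_eqs_ideal by blast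
    then have "b < e" "c < height a"
      by (simp_all add: lead_ideal_def not_le)
    moreover from this have "a < e"
      using height_pos[of a] by simp
    ultimately have "(a, b, c) \<in> standard_exps"
      by (simp add: standard_exps_def)
    moreover have "t = ?f (a, b, c)"
      using sum by (auto simp: t_eq mexp_inject)
    ultimately show "t \<in> ?f ` standard_exps"
      by blast
  next
    fix t assume "t \<in> ?f ` standard_exps"
    then obtain a b c where abc: "(a, b, c) \<in> standard_exps" "t = mexp a b c (s - (a + b + c))"
      by auto
    then have "(a, b, c, s - (a + b + c)) \<notin> lead_ideal"
      by (auto simp: standard_exps_def lead_ideal_def)
    then have "t \<notin> leaders (eqs_ideal \<inter> homog_part s)"
      unfolding leaders_eqs_ideal abc(2) by (auto simp: mexp_inject)
    moreover have "mono_ord t = s"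
      using le_s[OF abc(1)] by (simp add: abc(2) mono_ord_mexp)
    ultimately show "t \<in> {t. mono_ord t = s} - leaders (eqs_ideal \<inter> homog_part s)"
      by simp
  qed
  moreover have "inj_on ?f standard_exps"
    by (rule inj_onI) (auto simp: mexp_inject)
  moreover have "hilbert_fun smul {eq1, eq2} s = card ({t. mono_ord t = s} - leaders (eqs_ideal \<inter> homog_part s))"
    unfolding hilbert_fun_def eqs_ideal_def[symmetric]
    by (intro quot_dim_standard gp.subspace_inter subspace_eqs_ideal subspace_homog_part) simp
  ultimately show ?thesis
    by (simp add: card_image)
qed

theorem extremal_system:
  "homog_system deglex smul {eq1, eq2} e"
  "has_codim smul {eq1, eq2} 3"
  "real_of_int (typical_dim smul {eq1, eq2}) = (real e)\<^sup>2 * (real e + 1)\<^sup>2 / 2"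
proof -
  have eq1_homog: "eq1 \<in> homog_part e"
    unfolding eq1_def by (rule falling_homog)
  show "homog_system deglex smul {eq1, eq2} e"
    using eq1_homog eq2_homog graded_gpoly_ring_axioms
    by (auto simp: homog_system_def ord_at_most_def homog_part_def)
  have symbol: "\<forall>\<^sub>F s in sequentially. int (hilbert_fun smul {eq1, eq2} s) =
      hilb CARD(4) (monom (int (card standard_exps)) 3) s"
    using eventually_ge_at_top[of "2 * e + e * (e + 1)"]
    by eventually_elim (simp add: hilbert_fun_eqs hilb_def eval_nat_numeral)
  have "0 < card standard_exps"
    using card_standard_exps e_pos by (cases "card standard_exps") auto
  then show cod: "has_codim smul {eq1, eq2} 3"
    by (subst has_codim_iff[OF symbol]) simp
  have "real (2 * card standard_exps) = (real e)\<^sup>2 * (real e + 1)\<^sup>2"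
    unfolding card_standard_exps by simp
  then show "real_of_int (typical_dim smul {eq1, eq2}) = (real e)\<^sup>2 * (real e + 1)\<^sup>2 / 2"
    using typical_dim_eq[OF symbol cod] by simp
qed

end

definition dilate :: "'a::field_char_0 fls \<Rightarrow> 'a fls" where
  "dilate f = fls_compose_fps f (fps_const 2 * fps_X)"

lemma extremal_example_dilate:
  "0 < e \<Longrightarrow> extremal_example (dilate :: 'a::field_char_0 fls \<Rightarrow> 'a fls) fls_X e"
proof unfold_locales
  have H: "fps_const 2 * fps_X \<noteq> (0 :: 'a fps)" "fps_nth (fps_const 2 * fps_X :: 'a fps) 0 = 0"
    by simp_all
  show "dilate (f + g) = dilate f + dilate g" "dilate (f * g) = dilate f * dilate g" for f g :: "'a fls"
    unfolding dilate_def using H by (rule fls_compose_fps_add fls_compose_fps_mult)+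
  show "dilate (1 :: 'a fls) = 1"
    by (simp add: dilate_def)
  show "dilate fls_X = 2 * (fls_X :: 'a fls)"
    by (simp add: dilate_def fls_times_fps_to_fls)
qed simp_all

text \<open>
  In codimension \<open>k\<close> the bound is the number of cones that survive \<open>k - 1\<close> cancellations, so the
  index of \<open>cone_degs\<close> is one less than the codimension.
\<close>

theorem theorem4:
  shows
    "(\<forall>(le :: 'x::finite monomial \<Rightarrow> 'x monomial \<Rightarrow> bool)
        (mul :: ('x, 'f::field) gpoly \<Rightarrow> ('x, 'f) gpoly \<Rightarrow> ('x, 'f) gpoly) \<Sigma> (e::nat).
        0 < e \<and> homog_system le mul \<Sigma> e \<and> has_codim mul \<Sigma> 3 \<longrightarrow>
        real_of_int (typical_dim mul \<Sigma>) \<le> (real e)^2 * (real e + 1)^2 / 2)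
     \<and> (\<forall>e::nat. 0 < e \<longrightarrow>
        (\<exists>(le :: 4 monomial \<Rightarrow> 4 monomial \<Rightarrow> bool)
          (mul :: (4, rat fls) gpoly \<Rightarrow> (4, rat fls) gpoly \<Rightarrow> (4, rat fls) gpoly) \<Sigma>.
          homog_system le mul \<Sigma> e \<and> has_codim mul \<Sigma> 3 \<and>
          real_of_int (typical_dim mul \<Sigma>) = (real e)^2 * (real e + 1)^2 / 2))
     \<and> (\<forall>(le :: 'x monomial \<Rightarrow> 'x monomial \<Rightarrow> bool)
        (mul :: ('x, 'f) gpoly \<Rightarrow> ('x, 'f) gpoly \<Rightarrow> ('x, 'f) gpoly) \<Sigma> (e::nat).
        0 < e \<and> homog_system le mul \<Sigma> e \<and> has_codim mul \<Sigma> 4 \<longrightarrow>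
        real_of_int (typical_dim mul \<Sigma>) \<le>
          (real e)^2 * (real e + 1)^2 *
            (3 * (real e)^4 + 6 * (real e)^3 + 11 * (real e)^2 + 8 * real e + 8) / 24)
     \<and> (\<forall>(le :: 'x monomial \<Rightarrow> 'x monomial \<Rightarrow> bool)
        (mul :: ('x, 'f) gpoly \<Rightarrow> ('x, 'f) gpoly \<Rightarrow> ('x, 'f) gpoly) \<Sigma> (e::nat).
        0 < e \<and> homog_system le mul \<Sigma> e \<and> has_codim mul \<Sigma> 5 \<longrightarrow>
        real_of_int (typical_dim mul \<Sigma>) \<le>
          (real e)^2 * (real e + 1)^2 / 1152 *
            (288 + 480 * real e + 952 * (real e)^2 + 1264 * (real e)^3 + 1592 * (real e)^4
             + 1648 * (real e)^5 + 1529 * (real e)^6 + 1174 * (real e)^7 + 775 * (real e)^8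
             + 420 * (real e)^9 + 183 * (real e)^10 + 54 * (real e)^11 + 9 * (real e)^12))
     \<and> (\<forall>k::nat. 0 < k \<longrightarrow>
        (\<forall>(le :: 'x monomial \<Rightarrow> 'x monomial \<Rightarrow> bool)
          (mul :: ('x, 'f) gpoly \<Rightarrow> ('x, 'f) gpoly \<Rightarrow> ('x, 'f) gpoly) \<Sigma> (e::nat).
          0 < e \<and> homog_system le mul \<Sigma> e \<and> has_codim mul \<Sigma> k \<longrightarrow>
          real_of_int (typical_dim mul \<Sigma>) \<le> real (codim_const k) * (real e)^(2^(k - 1))))"
proof (intro conjI allI impI; (elim conjE)?)
  fix le :: "'x monomial \<Rightarrow> 'x monomial \<Rightarrow> bool"
    and mul :: "('x, 'f) gpoly \<Rightarrow> ('x, 'f) gpoly \<Rightarrow> ('x, 'f) gpoly"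
    and \<Sigma> :: "('x, 'f) gpoly set" and e :: nat
  assume e: "0 < e" and sys: "homog_system le mul \<Sigma> e"
  have bound: "real_of_int (typical_dim mul \<Sigma>) \<le> real (length (cone_degs e (k - 1)))"
    if "has_codim mul \<Sigma> k" "0 < k" for k
    using typical_dim_le_length_cone_degs[OF sys that] by linarith
  show "real_of_int (typical_dim mul \<Sigma>) \<le> (real e)^2 * (real e + 1)^2 / 2"
    if "has_codim mul \<Sigma> 3"
    using bound[OF that] length_cone_degs_2[of e] by simp
  show "real_of_int (typical_dim mul \<Sigma>) \<le> (real e)^2 * (real e + 1)^2 *
      (3 * (real e)^4 + 6 * (real e)^3 + 11 * (real e)^2 + 8 * real e + 8) / 24"
    if "has_codim mul \<Sigma> 4"
    using bound[OF that] length_cone_degs_3[of e] by simp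
  show "real_of_int (typical_dim mul \<Sigma>) \<le> (real e)^2 * (real e + 1)^2 / 1152 *
      (288 + 480 * real e + 952 * (real e)^2 + 1264 * (real e)^3 + 1592 * (real e)^4
       + 1648 * (real e)^5 + 1529 * (real e)^6 + 1174 * (real e)^7 + 775 * (real e)^8
       + 420 * (real e)^9 + 183 * (real e)^10 + 54 * (real e)^11 + 9 * (real e)^12)"
    if "has_codim mul \<Sigma> 5"
    using bound[OF that] length_cone_degs_4[of e] by simp
  show "real_of_int (typical_dim mul \<Sigma>) \<le> real (codim_const k) * (real e)^(2^(k - 1))"
    if "0 < k" "has_codim mul \<Sigma> k" for k
  proof -
    have "real (length (cone_degs e (k - 1))) \<le> real ((2 * e) ^ 2 ^ (k - 1))"
      using length_cone_degs_le[OF e] by (rule of_nat_mono)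
    also have "\<dots> = real (codim_const k) * (real e)^(2^(k - 1))"
      by (simp add: codim_const_def power_mult_distrib)
    finally show ?thesis
      using bound[OF that(2,1)] by linarith
  qed
next
  fix e :: nat
  assume "0 < e"
  then interpret extremal_example "dilate :: rat fls \<Rightarrow> rat fls" fls_X e
    by (rule extremal_example_dilate)
  show "\<exists>(le :: 4 monomial \<Rightarrow> 4 monomial \<Rightarrow> bool)
      (mul :: (4, rat fls) gpoly \<Rightarrow> (4, rat fls) gpoly \<Rightarrow> (4, rat fls) gpoly) \<Sigma>.
      homog_system le mul \<Sigma> e \<and> has_codim mul \<Sigma> 3 \<and>
      real_of_int (typical_dim mul \<Sigma>) = (real e)^2 * (real e + 1)^2 / 2"
    using extremal_system by blast
qed

end
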